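(* Let $d\ge2$, $-2<s<d$, and let $(x_n)_{n\in\mathbb{N}}$ be a greedy sequence on $\mathbb{S}^d$ for $K_s$ with a fixed initial point $x_1\in\mathbb{S}^d$. For $N>1$ denote $\omega_{N,d}=\{x_1,\dots,x_N\}$. Then there exist positive constants $C_{s,d},C'_{s,d}$ (depending only on $s$ and $d$) such that the following hold for all $N\ge2$. (1) If $0<s<d$, then $$-C_{s,d}N^{1+s/d}\le E_{K_s}(\omega_{N,d})-\mathcal{I}_{s,d}N^2\le -C'_{s,d}N^{1+s/d}.$$ (2) If $-2<s<0$, then $$C_{s,d}N^{1+s/d}\le E_{K_s}(\omega_{N,d})-\mathcal{I}_{s,d}N^2\le -\mathcal{I}_{s,d}N-C'_{s,d}N^{1+s/d}.$$ (3) If $s=0$, then $$-\frac1d N\log(N)-C'_{0,d}N\le E_{K_0}(\omega_{N,d})-\mathcal{I}_{0,d}N^2\le\mathcal{O}(N),$$ where the implied constant depends only on $d$.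
   Context: $\mathbb{S}^d\subset\mathbb{R}^{d+1}$ is the unit sphere with Euclidean norm $\|\cdot\|$, and $\sigma_d$ is the surface measure normalized by $\sigma_d(\mathbb{S}^d)=1$. The Riesz $s$-kernel is $K_s(x,y)=\operatorname{sgn}(s)\|x-y\|^{-s}$ for $s\ne0$ and $K_0(x,y)=-\log\|x-y\|$ (with value $+\infty$ at $x=y$ when $s\ge0$). The discrete energy of $\omega_{N,d}=\{x_1,\dots,x_N\}$ is $E_{K}(\omega_{N,d})=2\sum_{1\le i<j\le N}K(x_i,x_j)$. For $s<d$, $\mathcal{I}_{s,d}=\int_{\mathbb{S}^d}\int_{\mathbb{S}^d}K_s(x,y)\,d\sigma_d(x)\,d\sigma_d(y)$. A greedy sequence for $K_s$ with initial point $x_1$ is a sequence such that for every $N\ge1$, $x_{N+1}$ is a minimizer (any one, if not unique) over $x\in\mathbb{S}^d$ of $\sum_{i=1}^{N}K_s(x,x_i)$. *)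

theory Defs
  imports "HOL-Analysis.Analysis"
begin

text \<open>
  Throughout, the sphere of dimension \<open>d\<close> is \<open>sphere 0 1\<close> in a Euclidean space of dimension
  \<open>d + 1\<close>.  Its surface measure is given by polar coordinates: the surface area of \<open>A\<close> is the
  dimension of the ambient space times the volume of the cone \<open>{t x | 0 < t < 1, x \<in> A}\<close>;
  see lemma \<open>emeasure_surface_measure\<close>.
\<close>

definition surface_measure :: "'a::euclidean_space measure" where
  "surface_measure =
     scale_measure (ennreal (real DIM('a)))
       (distr (restrict_space lborel (ball 0 1 - {0})) (restrict_space borel (sphere 0 1))
          (\<lambda>v. v /\<^sub>R norm v))"

definition sphere_measure :: "'a::euclidean_space measure" where
  "sphere_measure = uniform_measure surface_measure (sphere 0 1)"

text \<open>The convention \<open>K\<^sub>s(x,x) = \<infinity>\<close> for \<open>s \<ge> 0\<close> makes the kernel extended-real valued.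
  For \<open>s < 0\<close> the second branch gives \<open>K\<^sub>s(x,x) = 0\<close>, as \<open>0 powr (-s) = 0\<close>.\<close>

definition riesz_kernel :: "real \<Rightarrow> 'a::real_normed_vector \<Rightarrow> 'a \<Rightarrow> ereal" where
  "riesz_kernel s x y =
     (if x = y \<and> s \<ge> 0 then \<infinity>
      else if s \<noteq> 0 then ereal (sgn s * norm (x - y) powr (-s))
      else ereal (- ln (norm (x - y))))"

text \<open>Sequences are indexed from 1; the value at 0 is irrelevant.\<close>

definition discrete_energy :: "('a \<Rightarrow> 'a \<Rightarrow> ereal) \<Rightarrow> (nat \<Rightarrow> 'a) \<Rightarrow> nat \<Rightarrow> ereal" where
  "discrete_energy K x N = 2 * (\<Sum>i=1..N. \<Sum>j=i+1..N. K (x i) (x j))"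

text \<open>The kernel is infinite at most on the diagonal, which is a null set for
  \<open>sphere_measure\<close> when the ambient dimension is at least 2 (lemma
  \<open>emeasure_sphere_measure_singleton\<close>), so
  passing to \<open>real_of_ereal\<close> does not affect the integral.\<close>

definition continuous_energy :: "('a \<Rightarrow> 'a \<Rightarrow> ereal) \<Rightarrow> 'a measure \<Rightarrow> real" where
  "continuous_energy K \<mu> = (\<integral>y. (\<integral>x. real_of_ereal (K x y) \<partial>\<mu>) \<partial>\<mu>)"

definition greedy_sequence ::
    "('a::real_normed_vector \<Rightarrow> 'a \<Rightarrow> ereal) \<Rightarrow> 'a \<Rightarrow> (nat \<Rightarrow> 'a) \<Rightarrow> bool" where
  "greedy_sequence K a x \<longleftrightarrow>
     a \<in> sphere 0 1 \<and> x 1 = a \<and>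
     (\<forall>N\<ge>1. is_arg_min (\<lambda>y. \<Sum>i=1..N. K y (x i)) (\<lambda>y. y \<in> sphere 0 1) (x (N + 1)))"

lemma sets_surface_measure [simp, measurable_cong]:
  "sets (surface_measure :: 'a::euclidean_space measure) = sets (restrict_space borel (sphere 0 1))"
  by (simp add: surface_measure_def)

lemma space_surface_measure [simp]:
  "space (surface_measure :: 'a::euclidean_space measure) = sphere 0 1"
  by (simp add: surface_measure_def space_scale_measure space_restrict_space)

lemma sets_sphere_measure [simp, measurable_cong]:
  "sets (sphere_measure :: 'a::euclidean_space measure) = sets (restrict_space borel (sphere 0 1))"
  by (simp add: sphere_measure_def)

lemma space_sphere_measure [simp]:
  "space (sphere_measure :: 'a::euclidean_space measure) = sphere 0 1"
  by (simp add: sphere_measure_def)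

lemma emeasure_surface_measure:
  fixes A :: "'a::euclidean_space set"
  assumes A: "A \<in> sets borel" "A \<subseteq> sphere 0 1"
  shows "emeasure surface_measure A =
    ennreal (real DIM('a)) * emeasure lborel {t *\<^sub>R x | t x. 0 < t \<and> t < 1 \<and> x \<in> A}"
proof -
  let ?M = "restrict_space lborel (ball 0 1 - {0}) :: 'a measure"
  let ?S = "restrict_space borel (sphere 0 1) :: 'a measure"
  have A': "A \<in> sets ?S"
    using A by (auto simp: sets_restrict_space)
  have meas: "(\<lambda>v. v /\<^sub>R norm v) \<in> measurable ?M ?S"
    by (rule measurable_restrict_space2)
       (auto simp: space_restrict_space intro!: measurable_restrict_space1)
  have eq: "(\<lambda>v. v /\<^sub>R norm v) -` A \<inter> space ?M =
      {t *\<^sub>R x | t x. 0 < t \<and> t < 1 \<and> x \<in> A}" (is "?L = ?R")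
  proof (intro set_eqI iffI)
    fix v assume "v \<in> ?L"
    then have v: "v /\<^sub>R norm v \<in> A" "v \<noteq> 0" "norm v < 1"
      by (auto simp: space_restrict_space)
    then have "v = norm v *\<^sub>R (v /\<^sub>R norm v)" by simp
    with v show "v \<in> ?R"
      by (intro CollectI exI[of _ "norm v"] exI[of _ "v /\<^sub>R norm v"]) auto
  next
    fix v assume "v \<in> ?R"
    then obtain t x where tx: "v = t *\<^sub>R x" "0 < t" "t < 1" "x \<in> A" by auto
    then have "norm x = 1" using A by auto
    then show "v \<in> ?L" using tx by (auto simp: space_restrict_space)
  qed
  have "emeasure ?M ?R = emeasure lborel ?R"
    by (subst emeasure_restrict_space) (use eq in \<open>auto simp: space_restrict_space\<close>)
  then show ?thesis
    unfolding surface_measure_def emeasure_scale_measure emeasure_distr[OF meas A'] eq by simp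
qed

lemma emeasure_surface_measure_sphere:
  "emeasure surface_measure (sphere (0::'a::euclidean_space) 1) =
     ennreal (real DIM('a)) * emeasure lborel (ball (0::'a) 1)"
proof -
  have eq: "{t *\<^sub>R x | t x. 0 < t \<and> t < 1 \<and> x \<in> sphere (0::'a) 1} = ball 0 1 - {0}"
    (is "?L = ?R")
  proof (intro set_eqI iffI)
    fix v assume "v \<in> ?R"
    then show "v \<in> ?L"
      by (intro CollectI exI[of _ "norm v"] exI[of _ "v /\<^sub>R norm v"]) auto
  qed auto
  have "emeasure lborel (ball (0::'a) 1 - {0}) = emeasure lborel (ball (0::'a) 1)"
    by (subst emeasure_Diff) auto
  then show ?thesis
    by (subst emeasure_surface_measure) (auto simp only: eq, auto)
qed

lemma surface_measure_sphere_pos_finite: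
  "emeasure surface_measure (sphere (0::'a::euclidean_space) 1) \<noteq> 0"
  "emeasure surface_measure (sphere (0::'a::euclidean_space) 1) \<noteq> \<infinity>"
proof -
  have "emeasure lborel (ball (0::'a) 1) = ennreal (unit_ball_vol (real DIM('a)))"
    by (subst emeasure_ball) auto
  moreover have "unit_ball_vol (real DIM('a)) > 0" by simp
  ultimately have "emeasure surface_measure (sphere (0::'a) 1) =
      ennreal (real DIM('a) * unit_ball_vol (real DIM('a)))"
    by (simp add: emeasure_surface_measure_sphere ennreal_mult)
  moreover have "real DIM('a) * unit_ball_vol (real DIM('a)) > 0"
    by (intro mult_pos_pos) auto
  ultimately show "emeasure surface_measure (sphere (0::'a::euclidean_space) 1) \<noteq> 0"
    "emeasure surface_measure (sphere (0::'a::euclidean_space) 1) \<noteq> \<infinity>"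
    by (simp_all only: ennreal_eq_0_iff not_le infinity_ennreal_def ennreal_neq_top not_False_eq_True)
qed

lemma emeasure_sphere_measure_space:
  "emeasure sphere_measure (sphere (0::'a::euclidean_space) 1) = 1"
  unfolding sphere_measure_def
  by (rule emeasure_uniform_measure_1) (use surface_measure_sphere_pos_finite in auto)

lemma emeasure_sphere_measure_singleton:
  fixes p :: "'a::euclidean_space"
  assumes "DIM('a) \<ge> 2" "p \<in> sphere 0 1"
  shows "emeasure sphere_measure {p} = 0"
proof -
  have "negligible (span {p})"
    by (rule negligible_subset[OF negligible_lowdim]) (use assms in \<open>auto simp: dim_singleton\<close>)
  moreover have borel: "span {p} \<in> sets borel"
    by (intro borel_closed closed_subspace subspace_span)
  ultimately have "emeasure lborel (span {p}) = 0"
    by (simp add: negligible_iff_null_sets null_sets_completion_iff null_setsD1)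
  then have "emeasure lborel {t *\<^sub>R x | t x. 0 < t \<and> t < 1 \<and> x \<in> {p}} = 0"
    by (rule emeasure_eq_0[rotated]) (use borel in \<open>auto simp: span_singleton\<close>)
  then have "emeasure surface_measure {p} = 0"
    by (subst emeasure_surface_measure) (use assms in auto)
  then show ?thesis
    using assms by (simp add: sphere_measure_def emeasure_uniform_measure sets_restrict_space_iff)
qed

end

theory Submission
  imports Defs "HOL-Probability.Distributions"
begin

text \<open>
  Write \<open>t = |x - y|\<^sup>2\<close>. Up to a constant the kernel is a mixture of the Gaussians \<open>exp (- u t)\<close>
  over \<open>u > 0\<close>. Each Gaussian is a convolution square, so its energy dominates \<open>N\<^sup>2\<close> times its
  spherical mean; as that mean is \<open>O(u\<^bsup>-d/2\<^esup>)\<close>, cutting the mixture at \<open>u\<close> of order \<open>N\<^bsup>2/d\<^esup>\<close>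
  gives the lower bounds, which hold for all configurations.

  For the upper bounds, \<open>E\<close> is twice the sum over \<open>n < N\<close> of the minima of the potentials of the
  first \<open>n\<close> points, so it is enough that every potential of \<open>n\<close> points has minimum at most
  \<open>n I - c n\<^bsup>s/d\<^esup>\<close>.  The conformal maps of the sphere yield densities whose potential is
  \<open>(e + t)\<^bsup>-s/2\<^esup>\<close> in closed form. A finite difference in \<open>e\<close> of high order turns this into a positive
  bump of width of order \<open>n\<^bsup>-1/d\<^esup>\<close>. Integrating the potential against a constant plus the densities of
  the bumps centred away from the \<open>n\<close> points gains the required amount.
\<close>

section \<open>Integration over the sphere\<close>

text \<open>The surface measure is given only through volumes of cones, so every symmetry of the
  sphere has to be drawn from Lebesgue measure. Two are used: reflections, which make zonal means
  independent of the base point, and Lorentz boosts, which act on the sphere as conformal maps.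

  The obstacle in the upper bounds is to prescribe a potential: finding the density that produces it
  is a nonlocal problem, explicit only in special cases. The conformal maps give such a family in
  \<open>e\<close>, and differences in \<open>e\<close> act on density and potential simultaneously.
  A difference of low order may decay too slowly; order d + 2 makes the bump decay faster than the
  conformal weight. The resulting density is signed and can be large near its centre, but its L1
  norm stays bounded as the width shrinks. Averaged over centres it is therefore bounded, and adding
  a constant independent of \<open>n\<close> makes it nonnegative. For \<open>s = 0\<close> no gain
  is required, as averaging the potential already yields O(N).\<close>

lemma nn_integral_lborel_translate:
  fixes f :: "'a::euclidean_space \<Rightarrow> ennreal"
  assumes [measurable]: "f \<in> borel_measurable borel"
  shows "(\<integral>\<^sup>+v. f (a + v) \<partial>lborel) = (\<integral>\<^sup>+v. f v \<partial>lborel)"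
proof -
  have "(\<integral>\<^sup>+v. f v \<partial>lborel) = (\<integral>\<^sup>+v. f v \<partial>distr lborel borel ((+) a))"
    by (simp add: lborel_distr_plus)
  also have "\<dots> = (\<integral>\<^sup>+v. f (a + v) \<partial>lborel)"
    by (subst nn_integral_distr) auto
  finally show ?thesis ..
qed

lemma nn_integral_lborel_scale:
  fixes f :: "'a::euclidean_space \<Rightarrow> ennreal"
  assumes [measurable]: "f \<in> borel_measurable borel" and q: "q > 0"
  shows "(\<integral>\<^sup>+v. f (v /\<^sub>R q) \<partial>lborel) = ennreal (q ^ DIM('a)) * (\<integral>\<^sup>+v. f v \<partial>lborel)"
proof -
  have "(\<integral>\<^sup>+v. f (v /\<^sub>R q) \<partial>lborel) =
      (\<integral>\<^sup>+v. f (v /\<^sub>R q) \<partial>density (distr lborel borel (\<lambda>x. 0 + q *\<^sub>R x)) (\<lambda>_. ennreal (\<bar>q\<bar>^DIM('a))))"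
    using lborel_affine[of q "0::'a"] q by simp
  also have "\<dots> = ennreal (q ^ DIM('a)) * (\<integral>\<^sup>+v. f v \<partial>lborel)"
    using q by (simp add: nn_integral_density nn_integral_distr nn_integral_cmult)
  finally show ?thesis .
qed

text \<open>A substitute for Fubini along the direction \<open>x\<close>: average over the slab \<open>0 < v \<bullet> x < 1\<close>,
  every line in direction \<open>x\<close> meeting it in length 1.\<close>

lemma nn_integral_lborel_lines:
  fixes f :: "'a::euclidean_space \<Rightarrow> ennreal"
  assumes [measurable]: "f \<in> borel_measurable borel" and x: "norm x = 1"
  shows "(\<integral>\<^sup>+v. f v \<partial>lborel) =
    (\<integral>\<^sup>+v. (\<integral>\<^sup>+t. f (v + t *\<^sub>R x) \<partial>lborel) * indicator {v. 0 < v \<bullet> x \<and> v \<bullet> x < 1} v \<partial>lborel)"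
proof -
  let ?w = "\<lambda>v. indicator {v. 0 < v \<bullet> x \<and> v \<bullet> x < 1} v :: ennreal"
  have [measurable]: "?w \<in> borel_measurable borel"
    by measurable
  have xx: "x \<bullet> x = 1"
    using x by (simp add: dot_square_norm)
  have w1: "(\<integral>\<^sup>+t. ?w (v - t *\<^sub>R x) \<partial>lborel) = 1" for v
  proof -
    have "(\<integral>\<^sup>+t. ?w (v - t *\<^sub>R x) \<partial>lborel) = (\<integral>\<^sup>+t. indicator {v \<bullet> x - 1<..<v \<bullet> x} t \<partial>lborel)"
      by (intro nn_integral_cong) (auto simp: indicator_def inner_simps xx)
    then show ?thesis by simp
  qed
  have "(\<integral>\<^sup>+v. f v \<partial>lborel) = (\<integral>\<^sup>+v. (\<integral>\<^sup>+t. f v * ?w (v - t *\<^sub>R x) \<partial>lborel) \<partial>lborel)"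
    by (subst nn_integral_cmult) (auto simp: w1)
  also have "\<dots> = (\<integral>\<^sup>+t. (\<integral>\<^sup>+v. f v * ?w (v - t *\<^sub>R x) \<partial>lborel) \<partial>lborel)"
    by (rule lborel_pair.Fubini'[symmetric]) measurable
  also have "\<dots> = (\<integral>\<^sup>+t. (\<integral>\<^sup>+v. f (t *\<^sub>R x + v) * ?w ((t *\<^sub>R x + v) - t *\<^sub>R x) \<partial>lborel) \<partial>lborel)"
    by (intro nn_integral_cong nn_integral_lborel_translate[symmetric]) measurable
  also have "\<dots> = (\<integral>\<^sup>+v. (\<integral>\<^sup>+t. f (v + t *\<^sub>R x) * ?w v \<partial>lborel) \<partial>lborel)"
    by (subst lborel_pair.Fubini') (auto simp: add.commute)
  also have "\<dots> = (\<integral>\<^sup>+v. (\<integral>\<^sup>+t. f (v + t *\<^sub>R x) \<partial>lborel) * ?w v \<partial>lborel)"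
    by (intro nn_integral_cong nn_integral_multc) measurable
  finally show ?thesis .
qed

text \<open>On each line in direction \<open>u\<close> the reflection acts as the affine map t -> -2
  (v . u) - t, which preserves one-dimensional Lebesgue measure;
  \<open>nn_integral_lborel_lines\<close> assembles the lines.\<close>

lemma nn_integral_lborel_reflect:
  fixes f :: "'a::euclidean_space \<Rightarrow> ennreal"
  assumes [measurable]: "f \<in> borel_measurable borel" and u: "norm u = 1"
  shows "(\<integral>\<^sup>+v. f (v - (2 * (v \<bullet> u)) *\<^sub>R u) \<partial>lborel) = (\<integral>\<^sup>+v. f v \<partial>lborel)"
proof -
  have uu: "u \<bullet> u = 1"
    using u by (simp add: dot_square_norm)
  have eq: "(\<integral>\<^sup>+t. f (v + t *\<^sub>R u - (2 * ((v + t *\<^sub>R u) \<bullet> u)) *\<^sub>R u) \<partial>lborel)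
      = (\<integral>\<^sup>+t. f (v + t *\<^sub>R u) \<partial>lborel)" for v
  proof -
    have "v + t *\<^sub>R u - (2 * ((v + t *\<^sub>R u) \<bullet> u)) *\<^sub>R u = v + (-2 * (v \<bullet> u) + (-1) * t) *\<^sub>R u" for t
      by (simp add: inner_simps uu algebra_simps flip: scaleR_add_left)
    then have "(\<integral>\<^sup>+t. f (v + t *\<^sub>R u - (2 * ((v + t *\<^sub>R u) \<bullet> u)) *\<^sub>R u) \<partial>lborel)
      = (\<integral>\<^sup>+t. f (v + (-2 * (v \<bullet> u) + (-1) * t) *\<^sub>R u) \<partial>lborel)"
      by (simp only:)
    also have "\<dots> = (\<integral>\<^sup>+t. f (v + t *\<^sub>R u) \<partial>lborel)"
      using nn_integral_real_affine[of "\<lambda>t. f (v + t *\<^sub>R u)" "-1" "-2 * (v \<bullet> u)"] by simp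
    finally show ?thesis .
  qed
  show ?thesis
    by (subst (1 2) nn_integral_lborel_lines[OF _ u]) (auto simp: eq)
qed

text \<open>Carried by the Borel sets of the whole space, so that integrands can be Borel functions
  on \<open>'a\<close>; the sphere has full measure by \<open>AE_sph_norm\<close>.\<close>

definition sph :: "'a::euclidean_space measure" where
  "sph = distr sphere_measure borel (\<lambda>x. x)"

lemma sets_sph [simp, measurable_cong]: "sets sph = sets borel"
  by (simp add: sph_def)

lemma space_sph [simp]: "space sph = UNIV"
  by (simp add: sph_def)

lemma measurable_sphere_measure: "(\<lambda>x. x) \<in> measurable sphere_measure borel"
  by (auto simp: measurable_def sets_restrict_space)

lemma prob_space_sph: "prob_space (sph :: 'a::euclidean_space measure)"
proof
  show "emeasure (sph :: 'a measure) (space sph) = 1"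
    unfolding sph_def
    using measurable_sphere_measure by (subst emeasure_distr) (use emeasure_sphere_measure_space[where 'a='a] in auto)
qed

interpretation sph: prob_space "sph :: 'a::euclidean_space measure"
  by (rule prob_space_sph)

lemma AE_sph_norm: "AE x in sph. norm (x :: 'a::euclidean_space) = 1"
  unfolding sph_def using measurable_sphere_measure by (subst AE_distr_iff) auto

text \<open>The dimension factor of the surface measure cancels against the total mass. Integrals
  over the sphere thereby become averages over the solid ball of functions homogeneous of degree 0,
  and inherit the changes of variables of Lebesgue measure.\<close>

lemma nn_integral_sph:
  fixes f :: "'a::euclidean_space \<Rightarrow> ennreal"
  assumes [measurable]: "f \<in> borel_measurable borel"
  shows "(\<integral>\<^sup>+x. f x \<partial>sph) =
    (\<integral>\<^sup>+v. f (v /\<^sub>R norm v) * indicator (ball 0 1) v \<partial>lborel) / emeasure lborel (ball (0::'a) 1)"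
proof -
  let ?n = "ennreal (real DIM('a))" and ?V = "emeasure lborel (ball (0::'a) 1)"
  have fs: "f \<in> borel_measurable (restrict_space borel (sphere 0 1))"
    by (rule measurable_restrict_space1) simp
  have proj: "(\<lambda>v. v /\<^sub>R norm v) \<in> measurable (restrict_space lborel (ball 0 1 - {0::'a})) (restrict_space borel (sphere 0 1))"
    by (rule measurable_restrict_space2)
       (auto simp: space_restrict_space intro!: measurable_restrict_space1)
  have "(\<integral>\<^sup>+x. f x \<partial>sph) = (\<integral>\<^sup>+x. f x \<partial>sphere_measure)"
    unfolding sph_def by (rule nn_integral_distr[OF measurable_sphere_measure]) simp
  also have "\<dots> = (\<integral>\<^sup>+x. f x * indicator (sphere 0 1) x \<partial>surface_measure) / emeasure surface_measure (sphere (0::'a) 1)"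
    unfolding sphere_measure_def
    by (rule nn_integral_uniform_measure) (use fs in \<open>auto simp: measurable_cong_sets[OF sets_surface_measure refl] sets_restrict_space\<close>)
  also have "(\<integral>\<^sup>+x. f x * indicator (sphere 0 1) x \<partial>surface_measure) = (\<integral>\<^sup>+x. f x \<partial>surface_measure)"
    by (intro nn_integral_cong) auto
  also have "\<dots> = ?n * (\<integral>\<^sup>+v. f (v /\<^sub>R norm v) * indicator (ball 0 1 - {0}) v \<partial>lborel)"
    unfolding surface_measure_def
    using fs proj by (subst nn_integral_scale_measure) (auto simp: nn_integral_distr nn_integral_restrict_space)
  also have "(\<integral>\<^sup>+v. f (v /\<^sub>R norm v) * indicator (ball 0 1 - {0}) v \<partial>lborel) =
      (\<integral>\<^sup>+v. f (v /\<^sub>R norm v) * indicator (ball 0 1) v \<partial>lborel)"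
    using AE_lborel_singleton[of "0::'a"]
    by (intro nn_integral_cong_AE) (elim eventually_mono, auto simp: indicator_def)
  finally show ?thesis
    by (simp add: emeasure_surface_measure_sphere mult.commute[of ?n] divide_mult_eq)
qed

text \<open>Both sides of the next identity equal the integral of \<open>n q\<^bsup>-1\<^esup> h(v)\<close> over
  \<open>1 < q < r(v)/|v|\<close>.\<close>

lemma nn_integral_homogeneous_region:
  fixes h :: "'a::euclidean_space \<Rightarrow> ennreal" and r :: "'a \<Rightarrow> real"
  assumes [measurable]: "h \<in> borel_measurable borel" "r \<in> borel_measurable borel"
    and h: "\<And>q v. q > 0 \<Longrightarrow> h (q *\<^sub>R v) = h v" and r: "\<And>q v. q > 0 \<Longrightarrow> r (q *\<^sub>R v) = r v"
    and pos: "\<And>v. r v > 0"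
  shows "(\<integral>\<^sup>+v. h v * indicator {v. norm v < r v} v \<partial>lborel) =
    (\<integral>\<^sup>+v. h v * ennreal (r v ^ DIM('a)) * indicator (ball 0 1) v \<partial>lborel)"
proof -
  let ?n = "DIM('a)"
  have n0: "?n > 0" by simp
  let ?B = "indicator (ball 0 1) :: 'a \<Rightarrow> ennreal"
  \<comment> \<open>After rescaling \<open>v\<close> at fixed \<open>q\<close>, the left-hand
    integral comes out with the weight (n / q) q^(-n); these weights have total mass 1 over q >
    1.\<close>
  have I1: "(\<integral>\<^sup>+q. ennreal (?n / q * (1 / q) ^ ?n) * indicator {1..} q \<partial>lborel) = 1"
  proof -
    have "((\<lambda>q::real. - ((1 / q) ^ ?n)) \<longlongrightarrow> - (0 ^ ?n)) at_top"
      by (intro tendsto_intros real_tendsto_divide_at_top[OF tendsto_const] filterlim_ident)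
    then have "(\<integral>\<^sup>+q. ennreal (?n / q * (1 / q) ^ ?n) * indicator {1..} q \<partial>lborel) = ennreal (- (0 ^ ?n) - (- ((1 / 1) ^ ?n)))"
    proof (intro nn_integral_FTC_atLeast[where F = "\<lambda>q. - ((1 / q) ^ ?n)"])
      fix q :: real assume q: "1 \<le> q"
      have "((\<lambda>q. 1 / q) has_real_derivative - 1 / (q * q)) (at q)"
        using q by (auto intro!: derivative_eq_intros)
      from DERIV_cong[OF DERIV_minus[OF DERIV_power[OF this, of ?n]]]
      show "((\<lambda>q::real. - ((1 / q) ^ ?n)) has_real_derivative ?n / q * (1 / q) ^ ?n) (at q)"
        using q n0 by (simp add: power_eq_if[of _ ?n])
    qed auto
    then show ?thesis by simp
  qed
  have I2: "(\<integral>\<^sup>+q. ennreal (?n * q ^ (?n - 1)) * indicator {0..<R} q \<partial>lborel) = ennreal (R ^ ?n)" if "R > 0" for R :: real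
  proof -
    have "(\<integral>\<^sup>+q. ennreal (?n * q ^ (?n - 1)) * indicator {0..R} q \<partial>lborel) = ennreal (R ^ ?n - 0 ^ ?n)"
      using that by (intro nn_integral_FTC_Icc) (auto intro!: derivative_eq_intros)
    moreover have "(\<integral>\<^sup>+q. ennreal (?n * q ^ (?n - 1)) * indicator {0..R} q \<partial>lborel) =
        (\<integral>\<^sup>+q. ennreal (?n * q ^ (?n - 1)) * indicator {0..<R} q \<partial>lborel)"
      using AE_lborel_singleton[of R] by (intro nn_integral_cong_AE) (elim eventually_mono, auto simp: indicator_def)
    ultimately show ?thesis using n0 by (simp add: power_0_left)
  qed
  define J where "J q v = h v * ennreal (?n / q) * indicator {p. 1 < p} q * indicator {v. q * norm v < r v} v" for q v
  have Jm [measurable]: "case_prod J \<in> borel_measurable (borel \<Otimes>\<^sub>M borel)"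
    unfolding J_def by measurable
  let ?L = "\<integral>\<^sup>+v. h v * indicator {v. norm v < r v} v \<partial>lborel"
  have "(\<integral>\<^sup>+q. (\<integral>\<^sup>+v. J q v \<partial>lborel) \<partial>lborel) =
      (\<integral>\<^sup>+q. ennreal (?n / q * (1 / q) ^ ?n) * indicator {1..} q * ?L \<partial>lborel)"
  proof (rule nn_integral_cong_AE)
    show "AE q in lborel. (\<integral>\<^sup>+v. J q v \<partial>lborel) = ennreal (?n / q * (1 / q) ^ ?n) * indicator {1..} q * ?L"
      using AE_lborel_singleton[of "1::real"]
    proof eventually_elim
      case (elim q)
      show ?case
      proof (cases "q > 1")
        case True
        have "(\<integral>\<^sup>+v. h (v /\<^sub>R (1/q)) * indicator {v. norm v < r v} (v /\<^sub>R (1/q)) \<partial>lborel) = ennreal ((1/q) ^ ?n) * ?L"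
          using True by (intro nn_integral_lborel_scale) auto
        also have "(\<integral>\<^sup>+v. h (v /\<^sub>R (1/q)) * indicator {v. norm v < r v} (v /\<^sub>R (1/q)) \<partial>lborel)
            = (\<integral>\<^sup>+v. h v * indicator {v. q * norm v < r v} v \<partial>lborel)"
          using True by (intro nn_integral_cong) (simp add: h r indicator_def)
        finally have "(\<integral>\<^sup>+v. h v * indicator {v. q * norm v < r v} v \<partial>lborel) = ennreal ((1/q) ^ ?n) * ?L" .
        moreover have "(\<integral>\<^sup>+v. J q v \<partial>lborel) = ennreal (?n / q) * (\<integral>\<^sup>+v. h v * indicator {v. q * norm v < r v} v \<partial>lborel)"
          unfolding J_def using True
          by (subst nn_integral_cmult[symmetric]) (auto intro!: nn_integral_cong simp: mult_ac)
        moreover have "ennreal (?n / q * (1 / q) ^ ?n) = ennreal (?n / q) * ennreal ((1 / q) ^ ?n)"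
          using True by (intro ennreal_mult) auto
        ultimately show ?thesis
          using True by (simp only: mult.assoc) simp
      qed (use elim in \<open>auto simp: J_def\<close>)
    qed
  qed
  also have "\<dots> = ?L"
    using I1 by (subst nn_integral_multc) auto
  finally have 1: "?L = (\<integral>\<^sup>+v. (\<integral>\<^sup>+q. J q v \<partial>lborel) \<partial>lborel)"
    by (subst lborel_pair.Fubini') auto
  \<comment> \<open>The same integrand in the variable p = q |v|, for which dp / p = dq / q. At
    fixed \<open>p\<close> the constraint on |v| is a ball of radius \<open>p\<close>, which is
    rescaled to the unit ball, while p < r v is invariant under scaling of \<open>v\<close>.\<close>
  define J2 where "J2 p v = h v * ennreal (?n / p) * indicator {v. norm v < p} v * indicator {v. p < r v} v" for p v
  have J2m [measurable]: "case_prod J2 \<in> borel_measurable (borel \<Otimes>\<^sub>M borel)"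
    unfolding J2_def by measurable
  have "(\<integral>\<^sup>+v. (\<integral>\<^sup>+q. J q v \<partial>lborel) \<partial>lborel) = (\<integral>\<^sup>+v. (\<integral>\<^sup>+p. J2 p v \<partial>lborel) \<partial>lborel)"
  proof (rule nn_integral_cong_AE)
    show "AE v in lborel. (\<integral>\<^sup>+q. J q v \<partial>lborel) = (\<integral>\<^sup>+p. J2 p v \<partial>lborel)"
      using AE_lborel_singleton[of "0::'a"]
    proof eventually_elim
      case (elim v)
      have "(\<integral>\<^sup>+p. J2 p v \<partial>lborel) = \<bar>norm v\<bar> * (\<integral>\<^sup>+q. J2 (0 + norm v * q) v \<partial>lborel)"
        using elim by (intro nn_integral_real_affine) auto
      also have "\<dots> = (\<integral>\<^sup>+q. \<bar>norm v\<bar> * J2 (0 + norm v * q) v \<partial>lborel)"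
        by (subst nn_integral_cmult) auto
      also have "\<dots> = (\<integral>\<^sup>+q. J q v \<partial>lborel)"
      proof (intro nn_integral_cong)
        fix q :: real
        have "ennreal (norm v) * ennreal (?n / (norm v * q)) = ennreal (?n / q)" if "q > 1"
          using elim that by (simp add: ennreal_mult[symmetric])
        then show "\<bar>norm v\<bar> * J2 (0 + norm v * q) v = J q v"
          using elim by (auto simp: J_def J2_def indicator_def mult_ac)
      qed
      finally show ?case ..
    qed
  qed
  also have "\<dots> = (\<integral>\<^sup>+p. (\<integral>\<^sup>+v. J2 p v \<partial>lborel) \<partial>lborel)"
    by (subst lborel_pair.Fubini') auto
  also have "\<dots> = (\<integral>\<^sup>+p. (\<integral>\<^sup>+v. h v * ?B v * (ennreal (?n * p ^ (?n - 1)) * indicator {0..<r v} p) \<partial>lborel) \<partial>lborel)"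
  proof (rule nn_integral_cong_AE)
    have [measurable]: "ball (0::'a) 1 \<in> sets borel" "{v. p < r v} \<in> sets borel" for p
      by auto
    have [measurable]: "(\<lambda>v. h v * ?B v * indicator {v. p < r v} v) \<in> borel_measurable borel" for p
      by (intro borel_measurable_times_ennreal borel_measurable_indicator) auto
    show "AE p in lborel. (\<integral>\<^sup>+v. J2 p v \<partial>lborel) =
      (\<integral>\<^sup>+v. h v * ?B v * (ennreal (?n * p ^ (?n - 1)) * indicator {0..<r v} p) \<partial>lborel)"
      using AE_lborel_singleton[of "0::real"]
    proof eventually_elim
      case (elim p)
      show ?case
      proof (cases "p > 0")
        case True
        have "norm (v /\<^sub>R p) < 1 \<longleftrightarrow> norm v < p" for v :: 'a
          using True by (simp add: field_simps)
        then have "(\<integral>\<^sup>+v. J2 p v \<partial>lborel) =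
          ennreal (?n / p) * (\<integral>\<^sup>+v. h (v /\<^sub>R p) * ?B (v /\<^sub>R p) * indicator {v. p < r v} (v /\<^sub>R p) \<partial>lborel)"
          using True unfolding J2_def
          by (subst nn_integral_cmult[symmetric])
             (auto intro!: nn_integral_cong simp: mult_ac h r indicator_def simp del: norm_scaleR)
        also have "\<dots> = ennreal (?n / p) * (ennreal (p ^ ?n) * (\<integral>\<^sup>+v. h v * ?B v * indicator {v. p < r v} v \<partial>lborel))"
          using nn_integral_lborel_scale[of "\<lambda>v. h v * ?B v * indicator {v. p < r v} v" p] True by simp
        also have "\<dots> = ennreal (?n * p ^ (?n - 1)) * (\<integral>\<^sup>+v. h v * ?B v * indicator {v. p < r v} v \<partial>lborel)"
        proof -
          have "?n / p * p ^ ?n = ?n * p ^ (?n - 1)"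
            using True power_minus_mult[OF n0, of p] by (simp add: field_simps)
          then have "ennreal (?n / p) * ennreal (p ^ ?n) = ennreal (?n * p ^ (?n - 1))"
            using True by (subst ennreal_mult[symmetric]) auto
          then show ?thesis
            by (simp only: mult.assoc[symmetric])
        qed
        also have "\<dots> = (\<integral>\<^sup>+v. h v * ?B v * (ennreal (?n * p ^ (?n - 1)) * indicator {v. p < r v} v) \<partial>lborel)"
          by (subst nn_integral_cmult[symmetric]) (auto simp: mult_ac)
        finally show ?thesis
          using True by (simp add: indicator_def)
      next
        case False
        then have "\<not> norm v < p" for v :: 'a
          using norm_ge_zero[of v] by linarith
        then show ?thesis
          using False elim by (simp add: J2_def)
      qed
    qed
  qed
  also have "\<dots> = (\<integral>\<^sup>+v. (\<integral>\<^sup>+p. h v * ?B v * (ennreal (?n * p ^ (?n - 1)) * indicator {0..<r v} p) \<partial>lborel) \<partial>lborel)"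
    by (rule lborel_pair.Fubini') (auto simp: indicator_def)
  also have "\<dots> = (\<integral>\<^sup>+v. h v * ennreal (r v ^ ?n) * ?B v \<partial>lborel)"
  proof (intro nn_integral_cong)
    fix v
    have "(\<integral>\<^sup>+p. h v * ?B v * (ennreal (?n * p ^ (?n - 1)) * indicator {0..<r v} p) \<partial>lborel) =
        h v * ?B v * (\<integral>\<^sup>+p. ennreal (?n * p ^ (?n - 1)) * indicator {0..<r v} p \<partial>lborel)"
      by (rule nn_integral_cmult) auto
    also have "\<dots> = h v * ennreal (r v ^ ?n) * ?B v"
      by (subst I2[OF pos]) (simp only: mult_ac)
    finally show "(\<integral>\<^sup>+p. h v * ?B v * (ennreal (?n * p ^ (?n - 1)) * indicator {0..<r v} p) \<partial>lborel) =
        h v * ennreal (r v ^ ?n) * ?B v" .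
  qed
  finally show ?thesis
    using 1 by simp
qed

lemma ball_sets_borel [measurable]: "ball a r \<in> sets borel"
  by simp

lemma inner_reflect:
  fixes u :: "'a::euclidean_space"
  assumes "u \<bullet> u = 1"
  shows "(v - (2 * (v \<bullet> u)) *\<^sub>R u) \<bullet> (w - (2 * (w \<bullet> u)) *\<^sub>R u) = v \<bullet> w"
  using assms by (simp add: inner_diff_left inner_diff_right inner_commute[of u w])

lemma nn_integral_sph_reflect:
  fixes f :: "'a::euclidean_space \<Rightarrow> ennreal"
  assumes [measurable]: "f \<in> borel_measurable borel" and u: "norm u = 1"
  shows "(\<integral>\<^sup>+v. f (v - (2 * (v \<bullet> u)) *\<^sub>R u) \<partial>sph) = (\<integral>\<^sup>+v. f v \<partial>sph)"
proof -
  define R where "R v = v - (2 * (v \<bullet> u)) *\<^sub>R u" for v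
  have [measurable]: "R \<in> borel_measurable borel"
    unfolding R_def by measurable
  have uu: "u \<bullet> u = 1"
    using u by (simp add: dot_square_norm)
  have nR: "norm (R v) = norm v" for v
    by (simp add: norm_eq_sqrt_inner R_def inner_reflect[OF uu])
  have sR: "R (q *\<^sub>R v) = q *\<^sub>R R v" for q v
    by (simp add: R_def algebra_simps)
  have "(\<integral>\<^sup>+v. f (v /\<^sub>R norm v) * indicator (ball 0 1) v \<partial>lborel) =
      (\<integral>\<^sup>+v. f (R v /\<^sub>R norm (R v)) * indicator (ball 0 1) (R v) \<partial>lborel)"
    unfolding R_def
    by (rule nn_integral_lborel_reflect[where f = "\<lambda>v. f (v /\<^sub>R norm v) * indicator (ball 0 1) v", OF _ u, symmetric]) measurable
  also have "\<dots> = (\<integral>\<^sup>+v. f (R (v /\<^sub>R norm v)) * indicator (ball 0 1) v \<partial>lborel)"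
    by (intro nn_integral_cong) (simp add: sR nR indicator_def)
  finally show ?thesis
    by (subst (1 2) nn_integral_sph) (auto simp: R_def)
qed

text \<open>The reflection along x - y exchanges the unit vectors \<open>x\<close> and
  \<open>y\<close> and preserves distances as well as \<open>sph\<close>.\<close>

lemma nn_integral_sph_dist:
  fixes x y :: "'a::euclidean_space" and F :: "real \<Rightarrow> ennreal"
  assumes [measurable]: "F \<in> borel_measurable borel" and xy: "norm x = 1" "norm y = 1"
  shows "(\<integral>\<^sup>+v. F (norm (x - v)) \<partial>sph) = (\<integral>\<^sup>+v. F (norm (y - v)) \<partial>sph)"
proof (cases "x = y")
  case False
  define u where "u = (x - y) /\<^sub>R norm (x - y)"
  define R where "R v = v - (2 * (v \<bullet> u)) *\<^sub>R u" for v
  have u: "norm u = 1"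
    using False by (simp add: u_def)
  then have uu: "u \<bullet> u = 1"
    by (simp add: dot_square_norm)
  have nR: "norm (R v - R w) = norm (v - w)" for v w
  proof -
    have "R v - R w = R (v - w)"
      by (simp add: R_def algebra_simps inner_diff_left)
    then have "norm (R v - R w) = norm (R (v - w))"
      by (simp only:)
    also have "\<dots> = norm (v - w)"
      by (simp only: norm_eq_sqrt_inner R_def inner_reflect[OF uu])
    finally show ?thesis .
  qed
  \<comment> \<open>For unit vectors |x - y|^2 = 2 x . (x - y), so the reflection subtracts exactly
    x - y from \<open>x\<close>.\<close>
  have n2: "(norm (x - y))\<^sup>2 = 2 * (x \<bullet> (x - y))"
  proof -
    have "x \<bullet> x = 1" "y \<bullet> y = 1"
      using xy by (simp_all add: dot_square_norm)
    then show ?thesis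
      by (simp add: power2_norm_eq_inner inner_diff_left inner_diff_right inner_commute[of y x])
  qed
  have "2 * (x \<bullet> u) = norm (x - y)"
  proof -
    have "2 * (x \<bullet> u) = (2 * (x \<bullet> (x - y))) / norm (x - y)"
      by (simp add: u_def divide_inverse)
    then show ?thesis
      using False by (simp add: n2[symmetric] power2_eq_square)
  qed
  then have Rx: "R x = y"
    using False by (simp add: R_def u_def)
  have "(\<integral>\<^sup>+v. F (norm (y - v)) \<partial>sph) = (\<integral>\<^sup>+v. F (norm (R x - R v)) \<partial>sph)"
    unfolding Rx unfolding R_def
    by (rule nn_integral_sph_reflect[where f = "\<lambda>v. F (norm (y - v))", OF _ u, symmetric]) measurable
  then show ?thesis
    by (simp add: nR)
qed simp

section \<open>Change of variables under Lorentz boosts\<close>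

text \<open>The rule for compact intervals is applied on [-i, i]. Since \<open>g\<close> is
  nondecreasing and unbounded in both directions, the images exhaust the line and monotone
  convergence applies.\<close>

lemma nn_integral_substitution_real:
  fixes f :: "real \<Rightarrow> ennreal"
  assumes [measurable]: "f \<in> borel_measurable borel"
    and g: "\<And>x. (g has_real_derivative g' x) (at x)" and g': "continuous_on UNIV g'" "\<And>x. g' x \<ge> 0"
    and lim: "filterlim g at_top at_top" "filterlim g at_bot at_bot"
  shows "(\<integral>\<^sup>+x. f x \<partial>lborel) = (\<integral>\<^sup>+x. f (g x) * ennreal (g' x) \<partial>lborel)"
proof -
  have mono: "g x \<le> g y" if "x \<le> y" for x y
    using DERIV_nonneg_imp_nondecreasing[OF that] g g' by blast
  have [measurable]: "g' \<in> borel_measurable borel"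
    by (rule borel_measurable_continuous_onI[OF g'(1)])
  have "continuous_on UNIV g"
    by (rule DERIV_continuous_on) (use g in auto)
  then have [measurable]: "g \<in> borel_measurable borel"
    by (rule borel_measurable_continuous_onI)
  have ex: "\<exists>i. y \<in> {g (- real i)..g (real i)}" for y
  proof -
    have "eventually (\<lambda>x. y \<le> g x) at_top" "eventually (\<lambda>x. g x \<le> y) at_bot"
      using lim by (auto simp: filterlim_at_top filterlim_at_bot)
    then obtain p q where p: "\<And>x. x \<ge> p \<Longrightarrow> y \<le> g x" and q: "\<And>x. x \<le> q \<Longrightarrow> g x \<le> y"
      by (auto simp: eventually_at_top_linorder eventually_at_bot_linorder)
    obtain i :: nat where "real i \<ge> max p (- q)"
      using real_arch_simple by blast
    then show ?thesis
      using p[of "real i"] q[of "- real i"] by auto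
  qed
  have U: "(SUP i. indicator (A i) x) = (1::ennreal)" if "\<exists>i. x \<in> A i" for A :: "nat \<Rightarrow> real set" and x
    using that by (auto intro!: antisym SUP_least SUP_upper2 simp: indicator_def)
  have inc: "incseq (\<lambda>i x. F x * indicator (A i) x :: ennreal)" if "\<And>i. A i \<subseteq> A (Suc i)" for A :: "nat \<Rightarrow> real set" and F
    using that by (intro incseq_SucI le_funI mult_left_mono) (auto simp: indicator_def)
  have "(\<integral>\<^sup>+x. f x \<partial>lborel) = (\<integral>\<^sup>+x. (SUP i. f x * indicator {g (- real i)..g (real i)} x) \<partial>lborel)"
    using ex by (intro nn_integral_cong) (simp add: SUP_mult_left_ennreal[symmetric] U)
  also have "\<dots> = (SUP i. \<integral>\<^sup>+x. f x * indicator {g (- real i)..g (real i)} x \<partial>lborel)"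
    using mono by (intro nn_integral_monotone_convergence_SUP inc) (auto intro: order_trans)
  also have "\<dots> = (SUP i. \<integral>\<^sup>+x. f (g x) * ennreal (g' x) * indicator {- real i..real i} x \<partial>lborel)"
  proof (intro SUP_cong refl)
    fix i :: nat
    show "(\<integral>\<^sup>+x. f x * indicator {g (- real i)..g (real i)} x \<partial>lborel) =
        (\<integral>\<^sup>+x. f (g x) * ennreal (g' x) * indicator {- real i..real i} x \<partial>lborel)"
    \<comment> \<open>At i = 0 both intervals are single points and both integrals vanish.\<close>
    proof (cases "i = 0")
      case True
      then show ?thesis
        using AE_lborel_singleton[of "0::real"] AE_lborel_singleton[of "g 0"] 
        by (intro trans[OF nn_integral_0_iff_AE[THEN iffD2] nn_integral_0_iff_AE[THEN iffD2, symmetric]]) (auto simp: indicator_def)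
    next
      case False
      show ?thesis
        by (rule nn_integral_substitution_aux) (use False g g' in \<open>auto intro: continuous_on_subset\<close>)
    qed
  qed
  also have "\<dots> = (\<integral>\<^sup>+x. (SUP i. f (g x) * ennreal (g' x) * indicator {- real i..real i} x) \<partial>lborel)"
    by (intro nn_integral_monotone_convergence_SUP[symmetric] inc) auto
  also have "\<dots> = (\<integral>\<^sup>+x. f (g x) * ennreal (g' x) \<partial>lborel)"
  proof (intro nn_integral_cong)
    fix x :: real
    have "\<exists>i. x \<in> {- real i..real i}"
      using real_arch_simple[of "\<bar>x\<bar>"] by (auto simp: abs_le_iff) (metis minus_le_iff)
    then show "(SUP i. f (g x) * ennreal (g' x) * indicator {- real i..real i} x) = f (g x) * ennreal (g' x)"
      by (simp add: SUP_mult_left_ennreal[symmetric] U)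
  qed
  finally show ?thesis .
qed

text \<open>The Lorentz boost in direction \<open>x\<close>, acting on the light cone \<open>{(v, |v|)}\<close>, which is
  parametrised by \<open>v\<close>.  As it moves points along lines in direction \<open>x\<close> only, its Jacobian is a
  derivative in one variable.\<close>

definition boost :: "'a::euclidean_space \<Rightarrow> real \<Rightarrow> real \<Rightarrow> 'a \<Rightarrow> 'a" where
  "boost x b c v = v + ((c - 1) * (v \<bullet> x) - b * norm v) *\<^sub>R x"

lemma measurable_boost [measurable]: "boost x b c \<in> borel_measurable borel"
  unfolding boost_def by measurable

context
  fixes x :: "'a::euclidean_space" and b c :: real
  assumes x: "norm x = 1" and cb: "c\<^sup>2 = b\<^sup>2 + 1" and c: "c > 0"
begin

lemma boost_abs_less: "\<bar>b\<bar> < c"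
  by (rule power2_less_imp_less) (use cb c in auto)

text \<open>\<open>c\<close> and \<open>b\<close> are the hyperbolic cosine and sine of the
  rapidity, and the right-hand side is the boosted time coordinate of the light-like vector (v,
  |v|). As |b| < c it is nonnegative, so it equals the norm: the light cone is preserved.\<close>

lemma norm_boost: "norm (boost x b c v) = c * norm v - b * (v \<bullet> x)"
proof -
  let ?a = "v \<bullet> x" and ?r = "norm v" and ?k = "(c - 1) * (v \<bullet> x) - b * norm v"
  have xx: "x \<bullet> x = 1" using x by (simp add: dot_square_norm)
  have "boost x b c v \<bullet> boost x b c v = v \<bullet> v + 2 * ?k * ?a + ?k\<^sup>2"
    by (simp add: boost_def inner_add_left inner_add_right xx inner_commute[of x v] power2_eq_square)
       (simp add: algebra_simps)
  also have "v \<bullet> v = ?r\<^sup>2"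
    by (simp add: dot_square_norm)
  also have "?r\<^sup>2 + 2 * ?k * ?a + ?k\<^sup>2 = (c * ?r - b * ?a)\<^sup>2"
  proof -
    have "(c * ?r - b * ?a)\<^sup>2 = c\<^sup>2 * ?r\<^sup>2 + (c\<^sup>2 - (c\<^sup>2 - b\<^sup>2)) * ?a\<^sup>2 - 2 * b * c * ?r * ?a"
      by (simp add: power2_eq_square algebra_simps)
    also have "\<dots> = (b\<^sup>2 + 1) * ?r\<^sup>2 + (c\<^sup>2 - 1) * ?a\<^sup>2 - 2 * b * c * ?r * ?a"
      using cb by simp
    also have "\<dots> = ?r\<^sup>2 + 2 * ?k * ?a + ?k\<^sup>2"
      by (simp add: power2_eq_square algebra_simps)
    finally show ?thesis ..
  qed
  finally have "norm (boost x b c v) = \<bar>c * ?r - b * ?a\<bar>"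
    by (simp add: norm_eq_sqrt_inner)
  moreover have "b * ?a \<le> c * ?r"
  proof -
    have "b * ?a \<le> \<bar>b\<bar> * \<bar>?a\<bar>"
      by (simp flip: abs_mult)
    also have "\<dots> \<le> \<bar>b\<bar> * ?r"
      using Cauchy_Schwarz_ineq2[of v x] x by (intro mult_left_mono) auto
    also have "\<dots> \<le> c * ?r"
      using boost_abs_less by (intro mult_right_mono) auto
    finally show ?thesis .
  qed
  ultimately show ?thesis by simp
qed

lemma norm_boost_pos: "v \<noteq> 0 \<Longrightarrow> norm (boost x b c v) > 0"
proof -
  assume "v \<noteq> 0"
  have "b * (v \<bullet> x) \<le> \<bar>b\<bar> * \<bar>v \<bullet> x\<bar>"
    by (simp flip: abs_mult)
  also have "\<dots> \<le> \<bar>b\<bar> * norm v"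
    using Cauchy_Schwarz_ineq2[of v x] x by (intro mult_left_mono) auto
  also have "\<dots> < c * norm v"
    using boost_abs_less \<open>v \<noteq> 0\<close> by (intro mult_strict_right_mono) auto
  finally show ?thesis by (simp add: norm_boost)
qed

text \<open>The Lorentz product of the light-like vectors over \<open>v\<close> and
  \<open>w\<close>. For unit vectors it is half the squared distance, which is why the induced map
  of the sphere multiplies distances by conformal factors.\<close>

lemma boost_Lorentz:
  "norm (boost x b c v) * norm (boost x b c w) - boost x b c v \<bullet> boost x b c w = norm v * norm w - v \<bullet> w"
proof -
  have xx: "x \<bullet> x = 1" using x by (simp add: dot_square_norm)
  let ?a = "v \<bullet> x" and ?r = "norm v" and ?e = "w \<bullet> x" and ?s = "norm w"
  have "boost x b c v \<bullet> boost x b c w = v \<bullet> w + ((c - 1) * ?a - b * ?r) * ?e + ((c - 1) * ?e - b * ?s) * ?a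
      + ((c - 1) * ?a - b * ?r) * ((c - 1) * ?e - b * ?s)"
    by (simp add: boost_def inner_add_left inner_add_right xx inner_commute[of x w])
       (simp add: algebra_simps)
  also have "\<dots> = v \<bullet> w + (c\<^sup>2 - 1) * ?a * ?e + b\<^sup>2 * ?r * ?s - b * c * (?r * ?e + ?s * ?a)"
    by (simp add: power2_eq_square algebra_simps)
  finally have "norm (boost x b c v) * norm (boost x b c w) - boost x b c v \<bullet> boost x b c w =
      (c\<^sup>2 - b\<^sup>2) * (?r * ?s) - v \<bullet> w + (1 - (c\<^sup>2 - b\<^sup>2)) * ?a * ?e"
    by (simp add: norm_boost power2_eq_square algebra_simps)
  then show ?thesis
    using cb by simp
qed

lemma boost_scaleR: "q \<ge> 0 \<Longrightarrow> boost x b c (q *\<^sub>R v) = q *\<^sub>R boost x b c v"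
  by (simp add: boost_def algebra_simps)

text \<open>In other words, dv / |v| is the invariant measure on the light cone. Along a line in
  direction \<open>x\<close> the derivative of the moved coordinate is exactly
  \<open>norm (boost x b c v) / norm v\<close>, so the claim reduces to one variable.\<close>

lemma nn_integral_lborel_boost:
  fixes f :: "'a \<Rightarrow> ennreal"
  assumes [measurable]: "f \<in> borel_measurable borel" and dim: "DIM('a) \<ge> 2"
  shows "(\<integral>\<^sup>+v. f (boost x b c v) * ennreal (norm (boost x b c v) / norm v) \<partial>lborel) = (\<integral>\<^sup>+v. f v \<partial>lborel)"
proof -
  let ?L = "boost x b c"
  have xx: "x \<bullet> x = 1" using x by (simp add: dot_square_norm)
  have "negligible (span {x})"
    by (rule negligible_subset[OF negligible_lowdim]) (use dim x in \<open>auto simp: dim_singleton\<close>)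
  moreover have borel: "span {x} \<in> sets borel"
    by (intro borel_closed closed_subspace subspace_span)
  \<comment> \<open>The line through the origin in direction \<open>x\<close> is discarded, since
    the norm is not differentiable at 0; it is null because the dimension is at least 2.\<close>
  ultimately have ae: "AE v in lborel. v \<notin> span {x}"
    by (intro AE_not_in) (simp add: negligible_iff_null_sets null_sets_completion_iff)
  have line: "(\<integral>\<^sup>+t. f (?L (v + t *\<^sub>R x)) * ennreal (norm (?L (v + t *\<^sub>R x)) / norm (v + t *\<^sub>R x)) \<partial>lborel)
      = (\<integral>\<^sup>+t. f (v + t *\<^sub>R x) \<partial>lborel)" if v: "v \<notin> span {x}" for v
  proof -
    have nz: "v + t *\<^sub>R x \<noteq> 0" for t
      using v by (metis add.commute add_eq_0_iff2 scaleR_minus_left span_breakdown_eq span_empty singletonD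
          span_singleton UNIV_I image_eqI rangeI)
    define g where "g t = t + (c - 1) * (v \<bullet> x + t) - b * norm (v + t *\<^sub>R x)" for t
    define g' where "g' t = c - b * (v \<bullet> x + t) / norm (v + t *\<^sub>R x)" for t
    have Lg: "?L (v + t *\<^sub>R x) = v + g t *\<^sub>R x" for t
      by (simp add: boost_def g_def inner_add_left xx flip: scaleR_add_left) (simp add: algebra_simps)?
    have g'_eq: "norm (?L (v + t *\<^sub>R x)) / norm (v + t *\<^sub>R x) = g' t" for t
      using nz[of t] by (simp add: norm_boost g'_def diff_divide_distrib inner_add_left xx)
    have nrm: "norm (v + t *\<^sub>R x) = sqrt (v \<bullet> v + 2 * t * (v \<bullet> x) + t * t)" for t
      by (simp add: norm_eq_sqrt_inner inner_add_left inner_add_right xx inner_commute[of x v] algebra_simps)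
    have pos: "v \<bullet> v + 2 * t * (v \<bullet> x) + t * t > 0" for t
      using nz[of t] nrm[of t] by (metis zero_less_norm_iff real_sqrt_gt_0_iff)
    have der: "(g has_real_derivative g' t) (at t)" for t
      unfolding g_def g'_def nrm using pos[of t]
      by (auto intro!: derivative_eq_intros) (simp add: field_simps)
    have cont: "continuous_on UNIV g'"
      unfolding g'_def using nz by (intro continuous_intros) auto
    have "\<bar>b\<bar> < c" by (rule boost_abs_less)
    \<comment> \<open>As |b| < c, a deviation of g t from c t of at most K + |b| |t| forces both
      limits at infinity.\<close>
    define K where "K = \<bar>b\<bar> * norm v + \<bar>(c - 1) * (v \<bullet> x)\<bar>"
    have bd: "\<bar>g t - c * t\<bar> \<le> K + \<bar>b\<bar> * \<bar>t\<bar>" for t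
    proof -
      have "norm (v + t *\<^sub>R x) \<le> norm v + \<bar>t\<bar>"
        using norm_triangle_ineq[of v "t *\<^sub>R x"] x by simp
      then have "\<bar>b\<bar> * norm (v + t *\<^sub>R x) \<le> \<bar>b\<bar> * (norm v + \<bar>t\<bar>)"
        by (intro mult_left_mono) auto
      moreover have "g t - c * t = (c - 1) * (v \<bullet> x) - b * norm (v + t *\<^sub>R x)"
        by (simp add: g_def algebra_simps)
      moreover have "\<bar>b * norm (v + t *\<^sub>R x)\<bar> = \<bar>b\<bar> * norm (v + t *\<^sub>R x)"
        by (simp add: abs_mult)
      ultimately show ?thesis
        unfolding K_def distrib_left by linarith
    qed
    have top: "filterlim g at_top at_top"
      unfolding filterlim_at_top
    proof
      fix Z
      show "eventually (\<lambda>t. Z \<le> g t) at_top"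
        using eventually_ge_at_top[of 0] eventually_ge_at_top[of "(Z + K) / (c - \<bar>b\<bar>)"]
      proof eventually_elim
        case (elim t)
        then have "Z + K \<le> t * (c - \<bar>b\<bar>)"
          using \<open>\<bar>b\<bar> < c\<close> by (simp add: pos_divide_le_eq)
        then show ?case
          using bd[of t] elim by (simp add: algebra_simps abs_le_iff)
      qed
    qed
    have bot: "filterlim g at_bot at_bot"
      unfolding filterlim_at_bot
    proof
      fix Z
      show "eventually (\<lambda>t. g t \<le> Z) at_bot"
        using eventually_le_at_bot[of 0] eventually_le_at_bot[of "(Z - K) / (c - \<bar>b\<bar>)"]
      proof eventually_elim
        case (elim t)
        then have "t * (c - \<bar>b\<bar>) \<le> Z - K"
          using \<open>\<bar>b\<bar> < c\<close> by (simp add: pos_le_divide_eq)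
        then show ?case
          using bd[of t] elim by (simp add: algebra_simps abs_le_iff)
      qed
    qed
    have "g' t \<ge> 0" for t
      using g'_eq[of t] by (metis divide_nonneg_nonneg norm_ge_zero)
    then show ?thesis
      unfolding g'_eq unfolding Lg
      by (intro nn_integral_substitution_real[where f = "\<lambda>t. f (v + t *\<^sub>R x)", symmetric] der cont top bot) auto
  qed
  have "AE v in lborel. (\<integral>\<^sup>+t. f (?L (v + t *\<^sub>R x)) * ennreal (norm (?L (v + t *\<^sub>R x)) / norm (v + t *\<^sub>R x)) \<partial>lborel)
      * indicator {v. 0 < v \<bullet> x \<and> v \<bullet> x < 1} v
      = (\<integral>\<^sup>+t. f (v + t *\<^sub>R x) \<partial>lborel) * indicator {v. 0 < v \<bullet> x \<and> v \<bullet> x < 1} v"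
    using ae by eventually_elim (simp add: line)
  then show ?thesis
    by (subst (1 2) nn_integral_lborel_lines[OF _ x]) (auto intro: nn_integral_cong_AE)
qed

end

text \<open>The preimage of the unit ball under the boost is the region |w| < \<rho> w, with \<rho>
  homogeneous of degree 0. The Jacobian contributes 1 / \<rho> and the shape of the region the power
  d + 1 of \<rho>, which leaves \<rho> ^ d; on the sphere \<rho> w is the inverse of the boosted
  norm.\<close>

lemma nn_integral_sph_boost:
  fixes f :: "'a::euclidean_space \<Rightarrow> ennreal" and x :: 'a
  assumes [measurable]: "f \<in> borel_measurable borel" and dim: "DIM('a) = d + 1" "d \<ge> 1"
    and x: "norm x = 1" and cb: "c\<^sup>2 = b\<^sup>2 + 1" and c: "c > 0"
  shows "(\<integral>\<^sup>+w. f (boost x b c w /\<^sub>R norm (boost x b c w)) * ennreal ((1 / norm (boost x b c w)) ^ d) \<partial>sph) = (\<integral>\<^sup>+w. f w \<partial>sph)"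
proof -
  let ?L = "boost x b c"
  \<comment> \<open>The value at 0 keeps \<open>\<rho>\<close> positive everywhere, as
    \<open>nn_integral_homogeneous_region\<close> asks.\<close>
  define \<rho> where "\<rho> w = (if w = 0 then 1 else norm w / norm (?L w))" for w
  define \<phi> where "\<phi> w = ?L w /\<^sub>R norm (?L w)" for w
  have [measurable]: "\<rho> \<in> borel_measurable borel" "\<phi> \<in> borel_measurable borel"
    unfolding \<rho>_def \<phi>_def by measurable
  have Lpos: "norm (?L w) > 0" if "w \<noteq> 0" for w
    by (rule norm_boost_pos[OF x cb c that])
  have Lq: "?L (q *\<^sub>R w) = q *\<^sub>R ?L w" if "q > 0" for q w
    using boost_scaleR[OF x cb c, of q] that by simp
  have \<rho>q: "\<rho> (q *\<^sub>R w) = \<rho> w" if "q > 0" for q w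
    using that by (simp add: \<rho>_def Lq)
  have \<phi>q: "\<phi> (q *\<^sub>R w) = \<phi> w" if "q > 0" for q w
    using that by (simp add: \<phi>_def Lq)
  have \<rho>pos: "\<rho> w > 0" for w
    using Lpos[of w] by (simp add: \<rho>_def)
  let ?h = "\<lambda>w. f (\<phi> w) * ennreal (1 / \<rho> w)"
  have "(\<integral>\<^sup>+v. f (v /\<^sub>R norm v) * indicator (ball 0 1) v \<partial>lborel) =
      (\<integral>\<^sup>+w. f (?L w /\<^sub>R norm (?L w)) * indicator (ball 0 1) (?L w) * ennreal (norm (?L w) / norm w) \<partial>lborel)"
    by (rule nn_integral_lborel_boost[OF x cb c, symmetric, where f = "\<lambda>v. f (v /\<^sub>R norm v) * indicator (ball 0 1) v"])
       (use dim in \<open>auto intro!: borel_measurable_times_ennreal\<close>)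
  also have "\<dots> = (\<integral>\<^sup>+w. ?h w * indicator {w. norm w < \<rho> w} w \<partial>lborel)"
  proof (intro nn_integral_cong_AE)
    show "AE w in lborel. f (?L w /\<^sub>R norm (?L w)) * indicator (ball 0 1) (?L w) * ennreal (norm (?L w) / norm w)
        = ?h w * indicator {w. norm w < \<rho> w} w"
      using AE_lborel_singleton[of "0::'a"]
    proof eventually_elim
      case (elim w)
      have "norm w < \<rho> w \<longleftrightarrow> norm (?L w) < 1"
        using elim Lpos[OF elim] by (simp add: \<rho>_def field_simps)
      then show ?case
        using elim by (simp add: \<phi>_def \<rho>_def indicator_def)
    qed
  qed
  also have "\<dots> = (\<integral>\<^sup>+w. ?h w * ennreal (\<rho> w ^ DIM('a)) * indicator (ball 0 1) w \<partial>lborel)"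
    by (rule nn_integral_homogeneous_region) (auto simp: \<rho>q \<phi>q \<rho>pos)
  also have "\<dots> = (\<integral>\<^sup>+w. f (\<phi> (w /\<^sub>R norm w)) * ennreal (\<rho> (w /\<^sub>R norm w) ^ d) * indicator (ball 0 1) w \<partial>lborel)"
  proof (intro nn_integral_cong_AE)
    show "AE w in lborel. ?h w * ennreal (\<rho> w ^ DIM('a)) * indicator (ball 0 1) w
      = f (\<phi> (w /\<^sub>R norm w)) * ennreal (\<rho> (w /\<^sub>R norm w) ^ d) * indicator (ball 0 1) w"
      using AE_lborel_singleton[of "0::'a"]
    proof eventually_elim
      case (elim w)
      have "ennreal (1 / \<rho> w) * ennreal (\<rho> w ^ DIM('a)) = ennreal (\<rho> w ^ d)"
        using \<rho>pos[of w] dim by (subst ennreal_mult[symmetric]) auto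
      moreover have "\<rho> (w /\<^sub>R norm w) = \<rho> w" "\<phi> (w /\<^sub>R norm w) = \<phi> w"
        using elim by (auto intro: \<rho>q \<phi>q)
      ultimately show ?case
        by (simp add: mult.assoc)
    qed
  qed
  finally have "(\<integral>\<^sup>+w. f w \<partial>sph) = (\<integral>\<^sup>+w. f (\<phi> w) * ennreal (\<rho> w ^ d) \<partial>sph)"
    by (subst (1 2) nn_integral_sph) auto
  also have "\<dots> = (\<integral>\<^sup>+w. f (\<phi> w) * ennreal ((1 / norm (?L w)) ^ d) \<partial>sph)"
  proof (rule nn_integral_cong_AE)
    show "AE w in sph. f (\<phi> w) * ennreal (\<rho> w ^ d) = f (\<phi> w) * ennreal ((1 / norm (?L w)) ^ d)"
      using AE_sph_norm
    proof eventually_elim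
      case (elim w)
      then have "\<rho> w = 1 / norm (?L w)"
        by (auto simp: \<rho>_def)
      then show ?case by simp
    qed
  qed
  finally show ?thesis
    by (simp add: \<phi>_def)
qed

abbreviation sqd :: "'a::real_normed_vector \<Rightarrow> 'a \<Rightarrow> real" where
  "sqd x y \<equiv> (norm (x - y))\<^sup>2"

lemma sqd_unit:
  fixes x y :: "'a::real_inner"
  assumes "norm x = 1" "norm y = 1"
  shows "sqd x y = 2 - 2 * (x \<bullet> y)"
proof -
  have "x \<bullet> x = 1" "y \<bullet> y = 1"
    using assms by (simp_all add: dot_square_norm)
  then show ?thesis
    by (simp add: power2_norm_eq_inner inner_diff_left inner_diff_right inner_commute[of y x])
qed

lemma sqd_commute: "sqd x y = sqd y x"
  by (simp add: norm_minus_commute)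

lemma sqd_le_4:
  fixes x y :: "'a::real_inner"
  assumes "norm x = 1" "norm y = 1"
  shows "sqd x y \<le> 4"
proof -
  have "norm (x - y) \<le> 2"
    using norm_triangle_ineq4[of x y] assms by simp
  then show ?thesis
    using power_mono[of "norm (x - y)" 2 2] by simp
qed

text \<open>On the unit sphere the boost becomes the inversion in a sphere orthogonal to the unit sphere and
  centred on the axis through \<open>x\<close>; \<open>\<rho>\<close> is its conformal factor.\<close>

lemma sph_inversion:
  fixes x :: "'a::euclidean_space"
  assumes dim: "DIM('a) = d + 1" "d \<ge> 1" and x: "norm x = 1" and e: "e > 0"
  defines "\<rho> \<equiv> \<lambda>w. sqrt (e\<^sup>2 + 4 * e) / (e + sqd x w)"
  obtains \<phi> :: "'a \<Rightarrow> 'a" where "\<phi> \<in> borel_measurable borel"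
    "\<And>z. norm z = 1 \<Longrightarrow> norm (\<phi> z) = 1"
    "\<And>z w. norm z = 1 \<Longrightarrow> norm w = 1 \<Longrightarrow> sqd (\<phi> z) (\<phi> w) = sqd z w * (\<rho> z * \<rho> w)"
    "\<And>f. f \<in> borel_measurable borel \<Longrightarrow> (\<integral>\<^sup>+w. f w \<partial>sph) = (\<integral>\<^sup>+w. f (\<phi> w) * ennreal (\<rho> w ^ d) \<partial>sph)"
proof -
  define Q where "Q = e\<^sup>2 + 4 * e"
  have Q: "Q > 0" using e by (simp add: Q_def add_pos_pos)
  \<comment> \<open>As Q = (e + 2)^2 - 2^2, these are a hyperbolic sine and cosine, and on the unit
    sphere the boosted norm becomes (e + |x - w|^2) / sqrt Q.\<close>
  define b where "b = 2 / sqrt Q"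
  define c where "c = (e + 2) / sqrt Q"
  have c: "c > 0" using e Q by (simp add: c_def)
  have cb: "c\<^sup>2 = b\<^sup>2 + 1"
    using Q by (simp add: c_def b_def power_divide field_simps) (simp add: Q_def power2_eq_square algebra_simps)
  let ?L = "boost x b c"
  have nL: "1 / norm (?L w) = \<rho> w" if "norm w = 1" for w
  proof -
    have "norm (?L w) = (e + (2 - 2 * (x \<bullet> w))) / sqrt Q"
      using that unfolding norm_boost[OF x cb c]
      by (simp add: c_def b_def inner_commute[of w x] add_divide_distrib diff_divide_distrib)
    then show ?thesis
      using sqd_unit[OF x that] by (simp add: \<rho>_def Q_def)
  qed
  have Lpos: "norm (?L w) > 0" if "norm w = 1" for w
    using that by (intro norm_boost_pos[OF x cb c]) auto
  define \<phi> where "\<phi> w = ?L w /\<^sub>R norm (?L w)" for w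
  show thesis
  proof (rule that[of \<phi>])
    show "\<phi> \<in> borel_measurable borel"
      unfolding \<phi>_def by measurable
    show n1: "norm (\<phi> z) = 1" if "norm z = 1" for z
      using Lpos[OF that] by (simp add: \<phi>_def)
    show "sqd (\<phi> z) (\<phi> w) = sqd z w * (\<rho> z * \<rho> w)" if zw: "norm z = 1" "norm w = 1" for z w
    proof -
      have "sqd (\<phi> z) (\<phi> w) = 2 * (1 - \<phi> z \<bullet> \<phi> w)"
        using sqd_unit[OF n1 n1] zw by simp
      also have "1 - \<phi> z \<bullet> \<phi> w = (norm (?L z) * norm (?L w) - ?L z \<bullet> ?L w) * (1 / norm (?L z) * (1 / norm (?L w)))"
        using Lpos zw by (simp add: \<phi>_def field_simps)
      also have "\<dots> = (1 - z \<bullet> w) * (\<rho> z * \<rho> w)"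
        using zw by (simp only: nL boost_Lorentz[OF x cb c]) simp
      finally show ?thesis
        by (simp add: sqd_unit[OF zw] algebra_simps)
    qed
    show "(\<integral>\<^sup>+w. f w \<partial>sph) = (\<integral>\<^sup>+w. f (\<phi> w) * ennreal (\<rho> w ^ d) \<partial>sph)" if "f \<in> borel_measurable borel" for f
    proof -
      have "(\<integral>\<^sup>+w. f w \<partial>sph) = (\<integral>\<^sup>+w. f (\<phi> w) * ennreal ((1 / norm (?L w)) ^ d) \<partial>sph)"
        unfolding \<phi>_def by (rule nn_integral_sph_boost[OF that dim x cb c, symmetric])
      also have "\<dots> = (\<integral>\<^sup>+w. f (\<phi> w) * ennreal (\<rho> w ^ d) \<partial>sph)"
      proof (rule nn_integral_cong_AE)
        show "AE w in sph. f (\<phi> w) * ennreal ((1 / norm (?L w)) ^ d) = f (\<phi> w) * ennreal (\<rho> w ^ d)"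
          using AE_sph_norm by eventually_elim (simp only: nL)
      qed
      finally show ?thesis .
    qed
  qed
qed

section \<open>Conformal densities and spherical caps\<close>

locale unit_sphere =
  fixes d :: nat and pole :: "'a::euclidean_space"
  assumes dim: "DIM('a) = d + 1" and d2: "d \<ge> 2" and pole: "norm pole = 1"
begin

text \<open>The spherical mean of a zonal function, expressed through the fixed base point;
  \<open>smean_eq\<close> moves it to any other unit vector.\<close>

definition smean :: "(real \<Rightarrow> ennreal) \<Rightarrow> ennreal" where
  "smean F = (\<integral>\<^sup>+w. F (sqd pole w) \<partial>sph)"

lemma smean_eq:
  fixes x :: 'a
  assumes [measurable]: "F \<in> borel_measurable borel" and x: "norm x = 1"
  shows "(\<integral>\<^sup>+w. F (sqd x w) \<partial>sph) = smean F"
  unfolding smean_def by (rule nn_integral_sph_dist[where F = "\<lambda>r. F (r\<^sup>2)", OF _ x pole]) measurable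

lemma smean_mono:
  assumes "\<And>t. 0 \<le> t \<Longrightarrow> t \<le> 4 \<Longrightarrow> F t \<le> G t"
  shows "smean F \<le> smean G"
proof -
  have "AE w in sph. F (sqd pole w) \<le> G (sqd pole w)"
    using AE_sph_norm by eventually_elim (intro assms sqd_le_4[OF pole] zero_le_power2)
  then show ?thesis
    unfolding smean_def by (rule nn_integral_mono_AE)
qed

lemma smean_cmult:
  "F \<in> borel_measurable borel \<Longrightarrow> smean (\<lambda>t. a * F t) = a * smean F"
  unfolding smean_def by (rule nn_integral_cmult) simp

lemma smean_add:
  "F \<in> borel_measurable borel \<Longrightarrow> G \<in> borel_measurable borel \<Longrightarrow> smean (\<lambda>t. F t + G t) = smean F + smean G"
  unfolding smean_def by (rule nn_integral_add) simp_all

lemma smean_const: "smean (\<lambda>_. a) = a"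
  unfolding smean_def using sph.emeasure_space_1[where 'a='a] by simp

text \<open>With \<open>p = s / 2\<close> and \<open>t\<close> the squared distance to \<open>x\<close>, this is the multiple of
  \<open>\<rho>\<^bsup>d - p\<^esup>\<close> for which the potential in the next lemma has no further dependence on \<open>e\<close>.\<close>

definition bubble :: "real \<Rightarrow> real \<Rightarrow> real \<Rightarrow> real" where
  "bubble p e t = (e\<^sup>2 + 4 * e) powr (real d / 2 - p) * (e + t) powr (p - real d)"

lemma measurable_bubble [measurable]: "bubble p e \<in> borel_measurable borel"
  unfolding bubble_def by measurable

text \<open>The inversion is applied to the distance power centred at \<open>\<phi> z\<close>, whose
  mean does not depend on the centre. Distances acquire the factor \<rho> z \<rho> w and the measure
  the factor \<rho> w ^ d. The powers of \<rho> w make up the bubble, and those of \<rho> z leave (e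
  + sqd x z) powr p, which moves to the other side.\<close>

lemma bubble_potential:
  fixes x z :: 'a
  assumes x: "norm x = 1" and z: "norm z = 1" and e: "e > 0"
  shows "(\<integral>\<^sup>+w. ennreal (sqd z w powr (-p)) * ennreal (bubble p e (sqd x w)) \<partial>sph) =
    smean (\<lambda>t. ennreal (t powr (-p))) * ennreal ((e + sqd x z) powr (-p))"
proof -
  define Q where "Q = e\<^sup>2 + 4 * e"
  have Q: "Q > 0" using e by (simp add: Q_def add_pos_pos)
  define \<rho> where "\<rho> w = sqrt Q / (e + sqd x w)" for w
  have d1: "d \<ge> 1" using d2 by simp
  obtain \<phi> :: "'a \<Rightarrow> 'a" where \<phi>: "\<phi> \<in> borel_measurable borel"
    "\<And>z. norm z = 1 \<Longrightarrow> norm (\<phi> z) = 1"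
    "\<And>z w. norm z = 1 \<Longrightarrow> norm w = 1 \<Longrightarrow> sqd (\<phi> z) (\<phi> w) = sqd z w * (\<rho> z * \<rho> w)"
    "\<And>f. f \<in> borel_measurable borel \<Longrightarrow> (\<integral>\<^sup>+w. f w \<partial>sph) = (\<integral>\<^sup>+w. f (\<phi> w) * ennreal (\<rho> w ^ d) \<partial>sph)"
    by (rule sph_inversion[OF dim d1 x e, folded Q_def, folded \<rho>_def], rule that, assumption+)
  have pos: "e + sqd x w > 0" for w
    using e by (simp add: add_pos_nonneg)
  have \<rho>pos: "\<rho> w > 0" for w
    using pos Q by (simp add: \<rho>_def)
  have *: "(sqd (\<phi> z) (\<phi> w)) powr (-p) * \<rho> w ^ d = (e + sqd x z) powr p * (sqd z w powr (-p) * bubble p e (sqd x w))"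
    if w: "norm w = 1" for w
  proof -
    have r1: "\<rho> w powr a = Q powr (a / 2) * (e + sqd x w) powr (- a)" for a w
    proof -
      have "\<rho> w = Q powr (1 / 2) / (e + sqd x w)"
        using Q by (simp add: \<rho>_def powr_half_sqrt)
      also have "\<dots> powr a = (Q powr (1 / 2)) powr a / (e + sqd x w) powr a"
        by (rule powr_divide)
      also have "\<dots> = Q powr (a / 2) * (e + sqd x w) powr (- a)"
        by (simp only: powr_powr powr_minus divide_inverse mult_1_left mult.commute)
      finally show ?thesis .
    qed
    have "(sqd (\<phi> z) (\<phi> w)) powr (-p) * \<rho> w ^ d = sqd z w powr (-p) * \<rho> z powr (-p) * (\<rho> w powr (-p) * \<rho> w powr real d)"
      using \<rho>pos[of z] \<rho>pos[of w] by (simp add: \<phi>(3)[OF z w] powr_mult powr_realpow)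
    also have "\<rho> w powr (-p) * \<rho> w powr real d = \<rho> w powr (real d - p)"
      by (simp flip: powr_add)
    also have "\<rho> w powr (real d - p) = Q powr ((real d - p) / 2) * (e + sqd x w) powr (p - real d)"
      by (simp add: r1)
    also have "\<rho> z powr (-p) = Q powr (- p / 2) * (e + sqd x z) powr p"
      by (simp add: r1)
    also have "sqd z w powr (-p) * (Q powr (- p / 2) * (e + sqd x z) powr p) * (Q powr ((real d - p) / 2) * (e + sqd x w) powr (p - real d))
      = (e + sqd x z) powr p * (sqd z w powr (-p) * ((Q powr (- p / 2) * Q powr ((real d - p) / 2)) * (e + sqd x w) powr (p - real d)))"
      by (simp only: mult_ac)
    also have "Q powr (- p / 2) * Q powr ((real d - p) / 2) = Q powr (real d / 2 - p)"
      unfolding powr_add[symmetric] by (rule arg_cong[where f = "(powr) Q"]) (simp add: field_simps)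
    finally show ?thesis
      by (simp add: bubble_def Q_def)
  qed
  have "smean (\<lambda>t. ennreal (t powr (-p))) = (\<integral>\<^sup>+w. ennreal ((sqd (\<phi> z) w) powr (-p)) \<partial>sph)"
    by (rule smean_eq[symmetric]) (use \<phi>(2)[OF z] in auto)
  also have "\<dots> = (\<integral>\<^sup>+w. ennreal ((sqd (\<phi> z) (\<phi> w)) powr (-p)) * ennreal (\<rho> w ^ d) \<partial>sph)"
    by (rule \<phi>(4)) measurable
  also have "\<dots> = (\<integral>\<^sup>+w. ennreal ((e + sqd x z) powr p) * (ennreal (sqd z w powr (-p)) * ennreal (bubble p e (sqd x w))) \<partial>sph)"
  proof (rule nn_integral_cong_AE)
    show "AE w in sph. ennreal ((sqd (\<phi> z) (\<phi> w)) powr (-p)) * ennreal (\<rho> w ^ d)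
        = ennreal ((e + sqd x z) powr p) * (ennreal (sqd z w powr (-p)) * ennreal (bubble p e (sqd x w)))"
      using AE_sph_norm
    proof eventually_elim
      case (elim w)
      from *[OF elim] show ?case
        using \<rho>pos[of w] by (simp add: ennreal_mult[symmetric] bubble_def)
    qed
  qed
  also have "\<dots> = ennreal ((e + sqd x z) powr p) * (\<integral>\<^sup>+w. ennreal (sqd z w powr (-p)) * ennreal (bubble p e (sqd x w)) \<partial>sph)"
    by (rule nn_integral_cmult) measurable
  finally have "ennreal ((e + sqd x z) powr (-p)) * smean (\<lambda>t. ennreal (t powr (-p))) =
      (ennreal ((e + sqd x z) powr (-p)) * ennreal ((e + sqd x z) powr p)) *
      (\<integral>\<^sup>+w. ennreal (sqd z w powr (-p)) * ennreal (bubble p e (sqd x w)) \<partial>sph)"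
    by (simp add: mult.assoc)
  moreover have "ennreal ((e + sqd x z) powr (-p)) * ennreal ((e + sqd x z) powr p) = 1"
    using pos[of z] by (simp add: ennreal_mult[symmetric] flip: powr_add)
  ultimately show ?thesis
    by (simp add: mult.commute)
qed

end

context unit_sphere
begin

text \<open>The change of variables for the constant function 1: its Jacobian Q^(d/2) (e + t)^(-d),
  with Q = e^2 + 4 e, has mean 1.\<close>

lemma smean_conformal:
  assumes e: "e > 0"
  shows "smean (\<lambda>t. ennreal ((e + t) powr (- real d))) = ennreal ((e\<^sup>2 + 4 * e) powr (- (real d / 2)))"
proof -
  define Q where "Q = e\<^sup>2 + 4 * e"
  have Q: "Q > 0" using e by (simp add: Q_def add_pos_pos)
  have d1: "d \<ge> 1" using d2 by simp
  define \<rho> where "\<rho> w = sqrt Q / (e + sqd pole w)" for w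
  obtain \<phi> :: "'a \<Rightarrow> 'a" where
    "\<And>f. f \<in> borel_measurable borel \<Longrightarrow> (\<integral>\<^sup>+w. f w \<partial>sph) = (\<integral>\<^sup>+w. f (\<phi> w) * ennreal (\<rho> w ^ d) \<partial>sph)"
    by (rule sph_inversion[OF dim d1 pole e, folded Q_def, folded \<rho>_def], rule that, assumption)
  from this[of "\<lambda>_. 1"] have "1 = (\<integral>\<^sup>+w. ennreal (\<rho> w ^ d) \<partial>sph)"
    using sph.emeasure_space_1[where 'a='a] by simp
  also have "\<dots> = smean (\<lambda>t. ennreal (Q powr (real d / 2)) * ennreal ((e + t) powr (- real d)))"
    unfolding smean_def
  proof (intro nn_integral_cong)
    fix w
    have pos: "e + sqd pole w > 0"
      using e by (simp add: add_pos_nonneg)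
    have "\<rho> w ^ d = \<rho> w powr real d"
      using pos Q by (simp add: \<rho>_def powr_realpow)
    also have "\<dots> = (Q powr (1 / 2)) powr real d / (e + sqd pole w) powr real d"
      using pos Q by (simp add: \<rho>_def powr_divide powr_half_sqrt)
    also have "\<dots> = Q powr (real d / 2) * (e + sqd pole w) powr (- real d)"
      unfolding powr_powr powr_minus divide_inverse by simp
    finally show "ennreal (\<rho> w ^ d) = ennreal (Q powr (real d / 2)) * ennreal ((e + sqd pole w) powr (- real d))"
      by (simp add: ennreal_mult)
  qed
  also have "\<dots> = ennreal (Q powr (real d / 2)) * smean (\<lambda>t. ennreal ((e + t) powr (- real d)))"
    by (rule smean_cmult) measurable
  finally have "ennreal (Q powr (- (real d / 2))) * 1 = (ennreal (Q powr (- (real d / 2))) * ennreal (Q powr (real d / 2))) * smean (\<lambda>t. ennreal ((e + t) powr (- real d)))"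
    by (simp add: mult.assoc)
  moreover have "ennreal (Q powr (- (real d / 2))) * ennreal (Q powr (real d / 2)) = 1"
    using Q by (simp add: ennreal_mult[symmetric] flip: powr_add)
  ultimately show ?thesis
    by (simp add: Q_def)
qed

lemma smean_conformal_le:
  assumes e: "e > 0"
  shows "smean (\<lambda>t. ennreal ((e + t) powr (- real d))) \<le> ennreal ((4 * e) powr (- (real d / 2)))"
  unfolding smean_conformal[OF e] using e by (intro ennreal_leI powr_mono2') auto

section \<open>Spherical caps and distance powers\<close>

text \<open>The measure of a cap is found up to constants by comparing its indicator with a conformal
  weight, whose mean is known exactly.\<close>

lemma cap_le:
  assumes r: "r > 0"
  shows "smean (indicator {..r}) \<le> ennreal (r powr (real d / 2))"
proof -
  have "smean (indicator {..r}) \<le> smean (\<lambda>t. ennreal ((2 * r) powr real d) * ennreal ((r + t) powr (- real d)))"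
  proof (rule smean_mono)
    fix t :: real assume t: "0 \<le> t" "t \<le> 4"
    show "indicator {..r} t \<le> ennreal ((2 * r) powr real d) * ennreal ((r + t) powr (- real d))"
    proof (cases "t \<le> r")
      case True
      have "(2 * r) powr (- real d) \<le> (r + t) powr (- real d)"
        using True t r by (intro powr_mono2') auto
      then have "(2 * r) powr real d * (2 * r) powr (- real d) \<le> (2 * r) powr real d * (r + t) powr (- real d)"
        by (intro mult_left_mono) auto
      then have "1 \<le> (2 * r) powr real d * (r + t) powr (- real d)"
        using r by (simp flip: powr_add)
      then have "ennreal 1 \<le> ennreal ((2 * r) powr real d * (r + t) powr (- real d))"
        by (rule ennreal_leI)
      then show ?thesis
        using True by (simp add: ennreal_mult)
    qed auto
  qed
  also have "\<dots> = ennreal ((2 * r) powr real d) * smean (\<lambda>t. ennreal ((r + t) powr (- real d)))"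
    by (rule smean_cmult) measurable
  also have "\<dots> \<le> ennreal ((2 * r) powr real d) * ennreal ((4 * r) powr (- (real d / 2)))"
    by (intro mult_left_mono smean_conformal_le r) auto
  also have "\<dots> = ennreal (r powr (real d / 2))"
  proof -
    have "(4 * r) powr (- (real d / 2)) = 4 powr (- (real d / 2)) * r powr (- (real d / 2))"
      using r by (simp add: powr_mult)
    moreover have "(4::real) powr (- (real d / 2)) = 2 powr (- real d)"
      using powr_powr[of 2 2 "- (real d / 2)"] by simp
    moreover have "(2 * r) powr real d = 2 powr real d * r powr real d"
      using r by (simp add: powr_mult)
    ultimately have "(2 * r) powr real d * (4 * r) powr (- (real d / 2)) =
        (2 powr real d * 2 powr (- real d)) * (r powr real d * r powr (- (real d / 2)))"
      by (simp only: mult_ac)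
    also have "\<dots> = r powr (real d / 2)"
      by (simp flip: powr_add)
    finally show ?thesis
      by (simp add: ennreal_mult[symmetric])
  qed
  finally show ?thesis .
qed

lemma cap_ge:
  assumes e: "0 < e" "e \<le> 4"
  shows "ennreal (8 powr (- (real d / 2)) / 2 * e powr (real d / 2)) \<le> smean (indicator {..31 * e})"
proof -
  let ?c = "8 powr (- (real d / 2)) :: real"
  have P8: "(8 * e) powr (- (real d / 2)) = ?c * e powr (- (real d / 2))"
    using e by (simp add: powr_mult)
  \<comment> \<open>For t > 31 e one has e + t >= (32 e + t) / 2, so the far part is at most 2^d
    times the mean of the conformal weight of parameter 32 e, hence at most 2^d (128 e)^(-d/2) =
    2^(-d) (8 e)^(-d/2). The radius 31 e is taken so large that at most half of (8 e)^(-d/2) lies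
    outside.\<close>
  have far: "smean (\<lambda>t. ennreal ((e + t) powr (- real d)) * indicator {31 * e<..} t) \<le> ennreal ((8 * e) powr (- (real d / 2)) / 2)"
  proof -
    have "smean (\<lambda>t. ennreal ((e + t) powr (- real d)) * indicator {31 * e<..} t) \<le>
        smean (\<lambda>t. ennreal (2 powr real d) * ennreal ((32 * e + t) powr (- real d)))"
    proof (rule smean_mono)
      fix t :: real assume t: "0 \<le> t" "t \<le> 4"
      show "ennreal ((e + t) powr (- real d)) * indicator {31 * e<..} t \<le> ennreal (2 powr real d) * ennreal ((32 * e + t) powr (- real d))"
      proof (cases "t > 31 * e")
        case True
        have "(e + t) powr (- real d) \<le> ((32 * e + t) / 2) powr (- real d)"
          using True e t by (intro powr_mono2') auto
        also have "\<dots> = 2 powr real d * (32 * e + t) powr (- real d)"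
          unfolding powr_divide by (simp add: powr_minus field_simps)
        finally show ?thesis
          using True by (simp add: ennreal_mult[symmetric] ennreal_leI)
      qed auto
    qed
    also have "\<dots> = ennreal (2 powr real d) * smean (\<lambda>t. ennreal ((32 * e + t) powr (- real d)))"
      by (rule smean_cmult) measurable
    also have "\<dots> \<le> ennreal (2 powr real d) * ennreal ((4 * (32 * e)) powr (- (real d / 2)))"
      using e by (intro mult_left_mono smean_conformal_le) auto
    also have "\<dots> \<le> ennreal ((8 * e) powr (- (real d / 2)) / 2)"
    proof -
      have "(4 * (32 * e)) powr (- (real d / 2)) = 16 powr (- (real d / 2)) * (8 * e) powr (- (real d / 2))"
        using e powr_mult[of 16 "8 * e" "- (real d / 2)"] by simp
      moreover have "(16::real) powr (- (real d / 2)) = 4 powr (- real d)"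
        using powr_powr[of 4 2 "- (real d / 2)"] by simp
      moreover have "(4::real) powr (- real d) = 2 powr (- real d) * 2 powr (- real d)"
        using powr_mult[of 2 2 "- real d"] by simp
      ultimately have "2 powr real d * (4 * (32 * e)) powr (- (real d / 2)) =
          (2 powr real d * 2 powr (- real d)) * (2 powr (- real d) * (8 * e) powr (- (real d / 2)))"
        by (simp only: mult_ac)
      also have "\<dots> = 2 powr (- real d) * (8 * e) powr (- (real d / 2))"
        by (simp flip: powr_add)
      also have "\<dots> \<le> 2 powr (- 1) * (8 * e) powr (- (real d / 2))"
        using d2 by (intro mult_right_mono powr_mono) auto
      finally show ?thesis
        by (simp add: ennreal_mult[symmetric] ennreal_leI powr_minus)
    qed
    finally show ?thesis .
  qed
  \<comment> \<open>Since e <= 4, e^2 + 4 e <= 8 e, so the whole mean is at least (8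
    e)^(-d/2).\<close>
  have "ennreal ((8 * e) powr (- (real d / 2))) \<le> smean (\<lambda>t. ennreal ((e + t) powr (- real d)))"
    unfolding smean_conformal[OF e(1)] using e
    by (intro ennreal_leI powr_mono2') (auto simp: power2_eq_square add_pos_pos)
  also have "\<dots> \<le> smean (\<lambda>t. ennreal ((e + t) powr (- real d)) * indicator {31 * e<..} t + ennreal (e powr (- real d)) * indicator {..31 * e} t)"
    using e by (intro smean_mono) (auto simp: indicator_def intro!: ennreal_leI powr_mono2')
  also have "\<dots> = smean (\<lambda>t. ennreal ((e + t) powr (- real d)) * indicator {31 * e<..} t) + smean (\<lambda>t. ennreal (e powr (- real d)) * indicator {..31 * e} t)"
    by (rule smean_add) measurable
  also have "smean (\<lambda>t. ennreal (e powr (- real d)) * indicator {..31 * e} t) = ennreal (e powr (- real d)) * smean (indicator {..31 * e})"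
    by (rule smean_cmult) measurable
  finally have A: "ennreal ((8 * e) powr (- (real d / 2))) \<le>
      ennreal ((8 * e) powr (- (real d / 2)) / 2) + ennreal (e powr (- real d)) * smean (indicator {..31 * e})"
    using far by (meson add_right_mono order_trans)
  obtain m where m: "smean (indicator {..31 * e}) = ennreal m" "m \<ge> 0"
  proof -
    have "smean (indicator {..31 * e}) \<le> smean (\<lambda>_. 1)"
      by (rule smean_mono) (auto simp: indicator_def)
    then have "smean (indicator {..31 * e}) \<noteq> top"
      by (auto simp: smean_const top_unique)
    then show thesis
      using that by (cases "smean (indicator {..31 * e})") auto
  qed
  have "(8 * e) powr (- (real d / 2)) \<le> (8 * e) powr (- (real d / 2)) / 2 + e powr (- real d) * m"
    using A m by (simp add: ennreal_mult[symmetric] ennreal_plus[symmetric] del: ennreal_plus)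
  then have "e powr real d * ((8 * e) powr (- (real d / 2)) / 2) \<le> e powr real d * (e powr (- real d) * m)"
    by (intro mult_left_mono) auto
  moreover have "e powr real d * (e powr (- real d) * m) = m"
    using e by (simp flip: mult.assoc powr_add)
  moreover have "e powr real d * ((8 * e) powr (- (real d / 2)) / 2) = ?c / 2 * e powr (real d / 2)"
  proof -
    have ee: "e powr real d * e powr (- (real d / 2)) = e powr (real d / 2)"
      by (simp flip: powr_add)
    show ?thesis
      unfolding P8 ee[symmetric] by (simp only: times_divide_eq_right times_divide_eq_left mult_ac)
  qed
  ultimately show ?thesis
    using m by (simp add: ennreal_leI)
qed

text \<open>For p > 0 the power is dominated by the layers 4^(k p) on the caps t <= 4^(1 - k). The
  cap of index k has measure at most 4^((1 - k) d / 2), so the sum is geometric with ratio 4^(p -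
  d/2) < 1.\<close>

lemma smean_powr_finite:
  assumes p: "p < real d / 2"
  shows "smean (\<lambda>t. ennreal (t powr (-p))) < \<infinity>"
proof (cases "p \<le> 0")
  case True
  have "smean (\<lambda>t. ennreal (t powr (-p))) \<le> smean (\<lambda>_. ennreal (4 powr (-p)))"
    using True by (intro smean_mono ennreal_leI powr_mono2) auto
  then show ?thesis
    by (simp add: smean_const order_le_less_trans)
next
  case False
  let ?F = "\<lambda>k::nat. (\<lambda>t::real. ennreal (4 powr (real k * p)) * indicator {..4 powr (1 - real k)} t)"
  have "smean (\<lambda>t. ennreal (t powr (-p))) \<le> smean (\<lambda>t. \<Sum>k. ?F k t)"
  proof (rule smean_mono)
    fix t :: real assume t: "0 \<le> t" "t \<le> 4"
    show "ennreal (t powr (-p)) \<le> (\<Sum>k. ?F k t)"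
    \<comment> \<open>At t = 0 the left-hand side vanishes, as
      \<open>0 powr (-p) = 0\<close>.\<close>
    proof (cases "t = 0")
      case False
      then have "t > 0" using t by simp
      then have ex: "\<exists>k. 4 powr (- real k) < t"
      proof -
        obtain k where "(1/4) ^ k < t"
          using real_arch_pow_inv[of t "1/4"] \<open>t > 0\<close> by auto
        then show ?thesis
          by (intro exI[of _ k]) (simp add: powr_minus powr_realpow power_one_over inverse_eq_divide)
      qed
      define k where "k = (LEAST k. 4 powr (- real k) < t)"
      have k1: "4 powr (- real k) < t"
        unfolding k_def using ex by (rule LeastI_ex)
      have k2: "t \<le> 4 powr (1 - real k)"
      proof (cases k)
        case 0
        then show ?thesis using t by simp
      next
        case (Suc j)
        then have "\<not> 4 powr (- real j) < t"
          unfolding k_def by (metis not_less_Least lessI)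
        then show ?thesis
          using Suc by simp
      qed
      have "t powr (-p) \<le> (4 powr (- real k)) powr (-p)"
        using k1 \<open>\<not> p \<le> 0\<close> by (intro powr_mono2') auto
      also have "\<dots> = 4 powr (real k * p)"
        by (simp add: powr_powr)
      finally have "ennreal (t powr (-p)) \<le> ?F k t"
        using k2 by (simp add: ennreal_leI)
      also have "\<dots> = (\<Sum>i\<in>{k}. ?F i t)"
        by (simp only: sum.empty sum.insert finite.emptyI empty_iff not_False_eq_True add_0_right)
      also have "\<dots> \<le> (\<Sum>k. ?F k t)"
        by (intro sum_le_suminf) (auto simp: summableI)
      finally show ?thesis .
    qed auto
  qed
  also have "\<dots> = (\<Sum>k. smean (?F k))"
    unfolding smean_def by (rule nn_integral_suminf) measurable
  also have "\<dots> \<le> (\<Sum>k. ennreal (4 powr (real d / 2) * (4 powr (p - real d / 2)) ^ k))"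
  proof (intro suminf_le summableI)
    fix k :: nat
    have "smean (?F k) = ennreal (4 powr (real k * p)) * smean (indicator {..4 powr (1 - real k)})"
      by (rule smean_cmult) measurable
    also have "\<dots> \<le> ennreal (4 powr (real k * p)) * ennreal ((4 powr (1 - real k)) powr (real d / 2))"
      by (intro mult_left_mono cap_le) auto
    also have "\<dots> = ennreal (4 powr (real d / 2) * (4 powr (p - real d / 2)) ^ k)"
    proof -
      have "4 powr (real k * p) * (4 powr (1 - real k)) powr (real d / 2) = 4 powr (real k * p + (1 - real k) * (real d / 2))"
        by (simp only: powr_powr powr_add)
      also have "real k * p + (1 - real k) * (real d / 2) = real d / 2 + (p - real d / 2) * real k"
        by (simp add: field_simps)
      also have "4 powr \<dots> = 4 powr (real d / 2) * (4 powr (p - real d / 2)) powr (real k)"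
        by (simp only: powr_powr powr_add)
      finally show ?thesis
        by (simp add: ennreal_mult[symmetric] powr_realpow)
    qed
    finally show "smean (?F k) \<le> ennreal (4 powr (real d / 2) * (4 powr (p - real d / 2)) ^ k)" .
  qed
  also have "\<dots> < \<infinity>"
  proof -
    have "4 powr (p - real d / 2) < (1::real)"
      using p by (simp add: powr_less_one)
    then have "summable (\<lambda>k. 4 powr (real d / 2) * (4 powr (p - real d / 2)) ^ k)"
      by (intro summable_mult summable_geometric) auto
    then show ?thesis
      by (subst suminf_ennreal2) auto
  qed
  finally show ?thesis .
qed

end

section \<open>Lower bounds by Gaussian mixtures\<close>

definition gauss_mass :: "'a::euclidean_space itself \<Rightarrow> real \<Rightarrow> ennreal" where
  "gauss_mass _ a = (\<integral>\<^sup>+z. ennreal (exp (- a * (norm (z :: 'a))\<^sup>2)) \<partial>lborel)"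

lemma gauss_mass_finite:
  assumes a: "a > 0"
  shows "gauss_mass TYPE('a::euclidean_space) a < \<infinity>"
proof -
  have one: "(\<integral>\<^sup>+t. ennreal (exp (- a * t\<^sup>2)) \<partial>lborel) < \<infinity>"
  proof -
    define s where "s = 1 / sqrt (2 * a)"
    have s: "s > 0" "2 * s\<^sup>2 = 1 / a"
      using a by (simp_all add: s_def power_divide)
    have dens: "exp (- a * t\<^sup>2) = sqrt (2 * pi * s\<^sup>2) * normal_density 0 s t" for t
      using s a by (simp add: normal_density_def)
    have "(\<integral>\<^sup>+t. ennreal (exp (- a * t\<^sup>2)) \<partial>lborel) = ennreal (sqrt (2 * pi * s\<^sup>2)) * (\<integral>\<^sup>+t. ennreal (normal_density 0 s t) \<partial>lborel)"
      unfolding dens by (subst nn_integral_cmult[symmetric]) (auto simp: ennreal_mult)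
    also have "(\<integral>\<^sup>+t. ennreal (normal_density 0 s t) \<partial>lborel) = 1"
      using prob_space.emeasure_space_1[OF prob_space_normal_density[OF s(1), of 0]]
      by (simp add: emeasure_density)
    finally show ?thesis by simp
  qed
  have "gauss_mass TYPE('a) a = (\<integral>\<^sup>+z. (\<Prod>b\<in>Basis. ennreal (exp (- a * ((z :: 'a) \<bullet> b)\<^sup>2))) \<partial>lborel)"
    unfolding gauss_mass_def
  proof (intro nn_integral_cong)
    fix z :: 'a
    have "(norm z)\<^sup>2 = (\<Sum>b\<in>Basis. (z \<bullet> b)\<^sup>2)"
      by (subst euclidean_inner[of z z, folded power2_norm_eq_inner]) (simp add: power2_eq_square)
    then have "exp (- a * (norm z)\<^sup>2) = (\<Prod>b\<in>Basis. exp (- a * (z \<bullet> b)\<^sup>2))"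
      by (simp add: exp_sum[symmetric] sum_distrib_left sum_negf)
    then show "ennreal (exp (- a * (norm z)\<^sup>2)) = (\<Prod>b\<in>Basis. ennreal (exp (- a * (z \<bullet> b)\<^sup>2)))"
      by (simp add: prod_ennreal)
  qed
  also have "\<dots> = (\<Prod>b\<in>(Basis :: 'a set). (\<integral>\<^sup>+t. ennreal (exp (- a * t\<^sup>2)) \<partial>lborel))"
    by (rule nn_integral_lborel_prod) auto
  also have "\<dots> < \<infinity>"
    using one by (simp add: power_less_top_ennreal)
  finally show ?thesis .
qed

lemma gauss_mass_pos: "gauss_mass TYPE('a::euclidean_space) a \<noteq> 0"
  unfolding gauss_mass_def
  by (subst nn_integral_0_iff_AE) (auto simp: eventually_False ae_filter_eq_bot_iff)

text \<open>By the parallelogram law the product is a Gaussian about the midpoint, times a factor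
  depending on |x - y| only. So, up to a constant, the Gaussian kernel is an L2 inner product of
  translates.\<close>

lemma gauss_convolution:
  fixes x y :: "'a::euclidean_space"
  shows "(\<integral>\<^sup>+z. ennreal (exp (- (2 * u) * sqd z x)) * ennreal (exp (- (2 * u) * sqd z y)) \<partial>lborel) =
    gauss_mass TYPE('a) (4 * u) * ennreal (exp (- u * sqd x y))"
proof -
  define m where "m = (1 / 2) *\<^sub>R (x + y)"
  have parallelogram: "2 * sqd z x + 2 * sqd z y = 4 * sqd z m + sqd x y" for z
    unfolding m_def power2_norm_eq_inner
    by (simp add: inner_diff_left inner_diff_right inner_add_left inner_add_right inner_commute[of x z] inner_commute[of y z] inner_commute[of y x])
       (simp add: field_simps)?
  have e: "exp (- (2 * u) * sqd z x) * exp (- (2 * u) * sqd z y) = exp (- u * sqd x y) * exp (- (4 * u) * sqd z m)" for z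
  proof -
    have "- (2 * u) * sqd z x + - (2 * u) * sqd z y = - u * (2 * sqd z x + 2 * sqd z y)"
      by (simp add: algebra_simps)
    also have "\<dots> = - u * sqd x y + - (4 * u) * sqd z m"
      unfolding parallelogram by (simp add: algebra_simps)
    finally show ?thesis
      by (simp only: exp_add[symmetric])
  qed
  have "(\<integral>\<^sup>+z. ennreal (exp (- (2 * u) * sqd z x)) * ennreal (exp (- (2 * u) * sqd z y)) \<partial>lborel) =
      (\<integral>\<^sup>+z. ennreal (exp (- u * sqd x y)) * ennreal (exp (- (4 * u) * sqd z m)) \<partial>lborel)"
    by (simp only: ennreal_mult[symmetric] exp_ge_zero e)
  also have "\<dots> = ennreal (exp (- u * sqd x y)) * (\<integral>\<^sup>+z. ennreal (exp (- (4 * u) * sqd z m)) \<partial>lborel)"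
    by (rule nn_integral_cmult) measurable
  also have "(\<integral>\<^sup>+z. ennreal (exp (- (4 * u) * sqd z m)) \<partial>lborel) = (\<integral>\<^sup>+z. ennreal (exp (- (4 * u) * sqd (m + z) m)) \<partial>lborel)"
    by (rule nn_integral_lborel_translate[where f = "\<lambda>z. ennreal (exp (- (4 * u) * sqd z m))", symmetric]) measurable
  also have "\<dots> = gauss_mass TYPE('a) (4 * u)"
    by (simp add: gauss_mass_def)
  finally show ?thesis
    by (simp add: mult.commute)
qed

lemma ennreal_two_mult_le:
  fixes a b :: ennreal
  shows "2 * (a * b) \<le> a * a + b * b"
proof (cases a; cases b)
  fix r s :: real assume "a = ennreal r" "0 \<le> r" "b = ennreal s" "0 \<le> s"
  moreover have "2 * (r * s) \<le> r * r + s * s"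
    using zero_le_power2[of "r - s"] by (simp add: power2_eq_square algebra_simps)
  ultimately show ?thesis
    by (simp add: ennreal_mult[symmetric] ennreal_plus[symmetric] ennreal_leI del: ennreal_plus
        flip: ennreal_numeral)
qed (auto simp: ennreal_mult_top top_unique ennreal_top_mult)

context unit_sphere
begin

text \<open>The Gaussian is a convolution square, so the sum is at least its value with the empirical
  measure replaced by the rotation-invariant one.\<close>

lemma gauss_sum_ge:
  fixes x :: "nat \<Rightarrow> 'a"
  assumes u: "u > 0" and x: "\<And>i. i \<in> A \<Longrightarrow> norm (x i) = 1" and A: "finite A"
  shows "(of_nat (card A))\<^sup>2 * smean (\<lambda>t. ennreal (exp (- u * t))) \<le> (\<Sum>i\<in>A. \<Sum>j\<in>A. ennreal (exp (- u * sqd (x i) (x j))))"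
proof -
  define h where "h z y = ennreal (exp (- (2 * u) * sqd z y))" for z y :: 'a
  have [measurable]: "case_prod h \<in> borel_measurable (borel \<Otimes>\<^sub>M borel)" "h z \<in> borel_measurable borel"
      "(\<lambda>z. h z y) \<in> borel_measurable borel" for z y
    unfolding h_def by measurable
  let ?c = "gauss_mass TYPE('a) (4 * u)" and ?g = "smean (\<lambda>t. ennreal (exp (- u * t)))" and ?N = "of_nat (card A) :: ennreal"
  let ?F = "\<lambda>z. \<Sum>i\<in>A. h z (x i)"
  define f where "f z = (\<integral>\<^sup>+y. h z y \<partial>sph)" for z
  have [measurable]: "f \<in> borel_measurable borel"
    unfolding f_def by measurable
  interpret pair_sigma_finite "sph :: 'a measure" "lborel :: 'a measure" ..
  have hh: "(\<integral>\<^sup>+z. h z a * h z b \<partial>lborel) = ?c * ennreal (exp (- u * sqd a b))" for a b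
    unfolding h_def by (rule gauss_convolution)
  have hf: "(\<integral>\<^sup>+z. h z a * f z \<partial>lborel) = ?c * ?g" if a: "norm a = 1" for a
  proof -
    have "(\<integral>\<^sup>+z. h z a * f z \<partial>lborel) = (\<integral>\<^sup>+z. (\<integral>\<^sup>+y. h z a * h z y \<partial>sph) \<partial>lborel)"
      unfolding f_def by (intro nn_integral_cong nn_integral_cmult[symmetric]) measurable
    also have "\<dots> = (\<integral>\<^sup>+y. (\<integral>\<^sup>+z. h z a * h z y \<partial>lborel) \<partial>sph)"
      by (rule Fubini') measurable
    also have "\<dots> = ?c * (\<integral>\<^sup>+y. ennreal (exp (- u * sqd a y)) \<partial>sph)"
      unfolding hh by (rule nn_integral_cmult) measurable
    also have "(\<integral>\<^sup>+y. ennreal (exp (- u * sqd a y)) \<partial>sph) = ?g"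
      by (rule smean_eq[OF _ a]) measurable
    finally show ?thesis .
  qed
  have ff: "(\<integral>\<^sup>+z. f z * f z \<partial>lborel) = ?c * ?g"
  proof -
    have "(\<integral>\<^sup>+z. f z * f z \<partial>lborel) = (\<integral>\<^sup>+z. (\<integral>\<^sup>+y. h z y * f z \<partial>sph) \<partial>lborel)"
      unfolding f_def by (intro nn_integral_cong nn_integral_multc[symmetric]) measurable
    also have "\<dots> = (\<integral>\<^sup>+y. (\<integral>\<^sup>+z. h z y * f z \<partial>lborel) \<partial>sph)"
      by (rule Fubini') measurable
    also have "\<dots> = (\<integral>\<^sup>+y. ?c * ?g \<partial>(sph :: 'a measure))"
    proof (rule nn_integral_cong_AE)
      show "AE y in sph. (\<integral>\<^sup>+z. h z y * f z \<partial>lborel) = ?c * ?g"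
        using AE_sph_norm by eventually_elim (rule hf)
    qed
    also have "\<dots> = ?c * ?g"
      using sph.emeasure_space_1[where 'a='a] by simp
    finally show ?thesis .
  qed
  have Ff: "(\<integral>\<^sup>+z. ?F z * f z \<partial>lborel) = ?N * (?c * ?g)"
  proof -
    have "(\<integral>\<^sup>+z. ?F z * f z \<partial>lborel) = (\<Sum>i\<in>A. \<integral>\<^sup>+z. h z (x i) * f z \<partial>lborel)"
      unfolding sum_distrib_right by (rule nn_integral_sum) measurable
    also have "\<dots> = (\<Sum>i\<in>A. ?c * ?g)"
      by (intro sum.cong refl hf x)
    finally show ?thesis by simp
  qed
  have FF: "(\<integral>\<^sup>+z. ?F z * ?F z \<partial>lborel) = ?c * (\<Sum>i\<in>A. \<Sum>j\<in>A. ennreal (exp (- u * sqd (x i) (x j))))"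
  proof -
    have "(\<integral>\<^sup>+z. ?F z * ?F z \<partial>lborel) = (\<Sum>i\<in>A. \<Sum>j\<in>A. \<integral>\<^sup>+z. h z (x i) * h z (x j) \<partial>lborel)"
      unfolding sum_product by (subst nn_integral_sum, measurable)+
    then show ?thesis
      by (simp only: hh sum_distrib_left)
  qed
  \<comment> \<open>With <.,.> the L2 product this is 2 <F, N f> <= <F, F> + <N f, N f>, the
    nonnegativity of the square of F - N f written without subtraction. As <F, f> = N c g and <f, f>
    = c g, one copy of N^2 c g, being finite, cancels and N^2 c g <= <F, F> remains.\<close>
  have "(\<integral>\<^sup>+z. 2 * (?F z * (?N * f z)) \<partial>lborel) \<le> (\<integral>\<^sup>+z. ?F z * ?F z + ?N * f z * (?N * f z) \<partial>lborel)"
    by (intro nn_integral_mono ennreal_two_mult_le)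
  also have "\<dots> = (\<integral>\<^sup>+z. ?F z * ?F z \<partial>lborel) + (\<integral>\<^sup>+z. ?N\<^sup>2 * (f z * f z) \<partial>lborel)"
    by (subst nn_integral_add) (auto simp: power2_eq_square mult_ac)
  also have "(\<integral>\<^sup>+z. ?N\<^sup>2 * (f z * f z) \<partial>lborel) = ?N\<^sup>2 * (?c * ?g)"
    by (subst nn_integral_cmult) (auto simp: ff)
  also have "(\<integral>\<^sup>+z. 2 * (?F z * (?N * f z)) \<partial>lborel) = (\<integral>\<^sup>+z. (2 * ?N) * (?F z * f z) \<partial>lborel)"
    by (intro nn_integral_cong) (simp only: mult_ac)
  also have "\<dots> = (2 * ?N) * (?N * (?c * ?g))"
    unfolding Ff[symmetric] by (rule nn_integral_cmult) measurable
  also have "\<dots> = ?c * (?N\<^sup>2 * ?g) + ?N\<^sup>2 * (?c * ?g)"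
    by (simp only: mult_2 distrib_right distrib_left power2_eq_square mult_ac)
  finally have le: "?c * (?N\<^sup>2 * ?g) + ?N\<^sup>2 * (?c * ?g) \<le> (?c * (\<Sum>i\<in>A. \<Sum>j\<in>A. ennreal (exp (- u * sqd (x i) (x j))))) + ?N\<^sup>2 * (?c * ?g)"
    unfolding FF .
  have "?g \<le> smean (\<lambda>_. 1)"
    using u by (intro smean_mono) auto
  then have "?g < \<infinity>"
    by (simp add: smean_const order_le_less_trans)
  then have "?N\<^sup>2 * (?c * ?g) < \<infinity>"
    using gauss_mass_finite[of "4 * u", where 'a='a] u
    by (simp add: ennreal_mult_less_top power2_eq_square of_nat_less_top)
  moreover have "?N\<^sup>2 * (?c * ?g) + ?c * (?N\<^sup>2 * ?g) \<le> ?N\<^sup>2 * (?c * ?g) + ?c * (\<Sum>i\<in>A. \<Sum>j\<in>A. ennreal (exp (- u * sqd (x i) (x j))))"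
    using le by (simp only: add.commute)
  ultimately have "?c * (?N\<^sup>2 * ?g) \<le> ?c * (\<Sum>i\<in>A. \<Sum>j\<in>A. ennreal (exp (- u * sqd (x i) (x j))))"
    by (simp only: ennreal_add_left_cancel_le) auto
  then show ?thesis
    using gauss_mass_finite[of "4 * u", where 'a='a] gauss_mass_pos[where 'a='a] u
    by (subst (asm) ennreal_mult_le_mult_iff) auto
qed

lemma power_div_fact_le_exp: "z \<ge> 0 \<Longrightarrow> z ^ n / fact n \<le> exp (z :: real)"
proof -
  assume z: "z \<ge> 0"
  have "(\<Sum>k\<in>{n}. z ^ k /\<^sub>R fact k) \<le> (\<Sum>k. z ^ k /\<^sub>R fact k)"
    by (rule sum_le_suminf[OF summable_exp_generic]) (use z in auto)
  then show ?thesis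
    by (simp add: exp_def divide_inverse mult.commute)
qed

text \<open>By z^d / d! <= exp z at z = 1 + u t, the Gaussian is at most a multiple of (1 / u + t)
  powr (- d), the conformal weight of parameter 1 / u, whose mean is known.\<close>

lemma gauss_mean_le:
  obtains C where "C > 0" "\<And>u. u > 0 \<Longrightarrow> smean (\<lambda>t. ennreal (exp (- u * t))) \<le> ennreal (C * u powr (- (real d / 2)))"
proof -
  define C where "C = (exp 1 * fact d * 4 powr (- (real d / 2)) :: real)"
  show thesis
  proof (rule that[of C])
    show "C > 0" by (simp add: C_def)
    fix u :: real assume u: "u > 0"
    have "smean (\<lambda>t. ennreal (exp (- u * t))) \<le> smean (\<lambda>t. ennreal (exp 1 * fact d * u powr (- real d)) * ennreal ((1 / u + t) powr (- real d)))"
    proof (rule smean_mono)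
      fix t :: real assume t: "0 \<le> t" "t \<le> 4"
      define z where "z = u * (1 / u + t)"
      have z: "z = 1 + u * t" "z > 0"
        using u t by (simp_all add: z_def field_simps add_pos_nonneg)
      have "z ^ d / fact d \<le> exp z"
        using z by (intro power_div_fact_le_exp) auto
      from le_imp_inverse_le[OF this] have "exp (- z) \<le> fact d * z powr (- real d)"
        using z(2) by (simp add: exp_minus powr_minus powr_realpow divide_inverse mult.commute)
      then have "exp 1 * exp (- z) \<le> exp 1 * (fact d * z powr (- real d))"
        by (intro mult_left_mono) auto
      moreover have "exp 1 * exp (- z) = exp (- u * t)"
        by (simp add: z flip: exp_add)
      moreover have "z powr (- real d) = u powr (- real d) * (1 / u + t) powr (- real d)"
        using u t by (simp add: z_def powr_mult)
      ultimately have "exp (- u * t) \<le> exp 1 * fact d * u powr (- real d) * (1 / u + t) powr (- real d)"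
        by (simp add: mult_ac)
      then show "ennreal (exp (- u * t)) \<le> ennreal (exp 1 * fact d * u powr (- real d)) * ennreal ((1 / u + t) powr (- real d))"
        by (simp add: ennreal_mult[symmetric] ennreal_leI)
    qed
    also have "\<dots> = ennreal (exp 1 * fact d * u powr (- real d)) * smean (\<lambda>t. ennreal ((1 / u + t) powr (- real d)))"
      by (rule smean_cmult) measurable
    also have "\<dots> \<le> ennreal (exp 1 * fact d * u powr (- real d)) * ennreal ((4 * (1 / u)) powr (- (real d / 2)))"
      using u by (intro mult_left_mono smean_conformal_le) auto
    also have "\<dots> = ennreal (C * u powr (- (real d / 2)))"
    proof -
      have "(4 * (1 / u)) powr (- (real d / 2)) = 4 powr (- (real d / 2)) * u powr (real d / 2)"
      proof -
        have "(4 * (1 / u)) powr (- (real d / 2)) = 4 powr (- (real d / 2)) * (1 / u) powr (- (real d / 2))"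
          by (rule powr_mult)
        also have "(1 / u) powr (- (real d / 2)) = u powr (real d / 2)"
          unfolding powr_divide powr_minus by (simp add: field_simps)
        finally show ?thesis .
      qed
      moreover have "u powr (- real d) * u powr (real d / 2) = u powr (- (real d / 2))"
        by (simp flip: powr_add)
      moreover have "exp 1 * fact d * u powr (- real d) * (4 powr (- (real d / 2)) * u powr (real d / 2)) =
          C * (u powr (- real d) * u powr (real d / 2))"
        unfolding C_def by (simp only: mult_ac)
      ultimately have "exp 1 * fact d * u powr (- real d) * (4 * (1 / u)) powr (- (real d / 2)) = C * u powr (- (real d / 2))"
        by (simp only:)
      then show ?thesis
        by (simp add: ennreal_mult[symmetric])
    qed
    finally show "smean (\<lambda>t. ennreal (exp (- u * t))) \<le> ennreal (C * u powr (- (real d / 2)))" .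
  qed
qed

end

section \<open>The Riesz kernel as a mixture of Gaussians\<close>

text \<open>The Riesz kernel as a function of the squared distance; junk values: \<open>kern s 0 = 0\<close> for all \<open>s\<close>.\<close>

definition kern :: "real \<Rightarrow> real \<Rightarrow> real" where
  "kern s t = (if s = 0 then - ln t / 2 else sgn s * t powr (- s / 2))"

text \<open>The coefficient of t powr (- (s / 2 + 1)) in minus the derivative of the kernel; the
  separate value at s = 0 lets the logarithm obey the same formula as the powers.\<close>

definition kern_slope :: "real \<Rightarrow> real" where
  "kern_slope s = (if s = 0 then 1 / 2 else \<bar>s\<bar> / 2)"

lemma kern_slope_pos: "kern_slope s > 0"
  by (simp add: kern_slope_def)

lemma measurable_kern [measurable]: "kern s \<in> borel_measurable borel"
  unfolding kern_def by measurable

lemma DERIV_kern: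
  assumes "t > 0"
  shows "(kern s has_real_derivative - kern_slope s * t powr (- (s / 2 + 1))) (at t)"
proof (cases "s = 0")
  case True
  then have "kern s = (\<lambda>t. - ln t / 2)"
    by (simp add: kern_def fun_eq_iff)
  moreover have "((\<lambda>t. - ln t / 2) has_real_derivative - (1 / t) / 2) (at t)"
    using assms by (intro DERIV_cdivide DERIV_minus DERIV_ln_divide)
  moreover have "- kern_slope s * t powr (- (s / 2 + 1)) = - (1 / t) / 2"
    using True assms by (simp add: kern_slope_def powr_neg_one)
  ultimately show ?thesis
    by (simp only:)
next
  case False
  then have k: "kern s = (\<lambda>t. sgn s * t powr (- s / 2))"
    by (simp add: kern_def fun_eq_iff)
  have "((\<lambda>t. sgn s * t powr (- s / 2)) has_real_derivative sgn s * (- s / 2 * t powr (- s / 2 - 1))) (at t)"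
    using assms by (intro DERIV_cmult has_real_derivative_powr)
  moreover have "sgn s * (- s / 2 * t powr (- s / 2 - 1)) = - kern_slope s * t powr (- (s / 2 + 1))"
  proof -
    have "- s / 2 - 1 = - (s / 2 + 1)" by simp
    moreover have "sgn s * (- s / 2) = - kern_slope s"
      using False by (simp add: kern_slope_def abs_sgn mult.commute)
    ultimately show ?thesis
      by (simp only: mult.assoc[symmetric])
  qed
  ultimately show ?thesis
    unfolding k by (simp only:)
qed

lemma kern_antimono:
  assumes "0 < t" "t \<le> t'"
  shows "kern s t' \<le> kern s t"
proof (rule DERIV_nonpos_imp_nonincreasing[OF assms(2)])
  fix y assume "t \<le> y" "y \<le> t'"
  then have "y > 0"
    using assms by simp
  then show "\<exists>D. (kern s has_real_derivative D) (at y) \<and> D \<le> 0"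
    using kern_slope_pos[of s] by (intro exI[of _ "- kern_slope s * y powr (- (s / 2 + 1))"] conjI DERIV_kern) auto
qed

lemma kern_diff:
  assumes t: "0 \<le> t" "t \<le> 4" "t > 0 \<or> s < 0"
  shows "(\<integral>\<^sup>+\<tau>. ennreal (kern_slope s * \<tau> powr (- (s / 2 + 1))) * indicator {t..4} \<tau> \<partial>lborel) = ennreal (kern s t - kern s 4)"
proof (rule nn_integral_has_integral_lebesgue')
  show "0 \<le> kern_slope s * \<tau> powr (- (s / 2 + 1))" for \<tau>
    using kern_slope_pos[of s] by (intro mult_nonneg_nonneg) auto
  have "((\<lambda>\<tau>. kern_slope s * \<tau> powr (- (s / 2 + 1))) has_integral (- kern s 4 - (- kern s t))) {t..4}"
  \<comment> \<open>Continuity at the left end suffices: at t = 0, allowed for s < 0, the kernel is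
    continuous while its derivative may blow up.\<close>
  proof (rule fundamental_theorem_of_calculus_interior[OF t(2)])
    show "continuous_on {t..4} (\<lambda>\<tau>. - kern s \<tau>)"
    proof (cases "t > 0")
      case True
      show ?thesis
        by (intro continuous_on_minus DERIV_continuous_on[where D = "\<lambda>\<tau>. - kern_slope s * \<tau> powr (- (s / 2 + 1))"] has_field_derivative_at_within[OF DERIV_kern])
           (use True in auto)
    next
      case False
      with t have "s < 0" by simp
      then show ?thesis
        using t unfolding kern_def by (auto intro!: continuous_intros continuous_on_powr')
    qed
    show "((\<lambda>\<tau>. - kern s \<tau>) has_vector_derivative kern_slope s * \<tau> powr (- (s / 2 + 1))) (at \<tau>)" if "\<tau> \<in> {t<..<4}" for \<tau>
      using DERIV_minus[OF DERIV_kern[of \<tau> s]] that t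
      by (simp add: has_real_derivative_iff_has_vector_derivative)
  qed
  then show "((\<lambda>\<tau>. kern_slope s * \<tau> powr (- (s / 2 + 1))) has_integral kern s t - kern s 4) {t..4}"
    by simp
qed

definition kern_weight :: "real \<Rightarrow> real" where
  "kern_weight s = kern_slope s / Gamma (s / 2 + 1)"

lemma kern_weight_pos: "s > - 2 \<Longrightarrow> kern_weight s > 0"
  unfolding kern_weight_def by (intro divide_pos_pos kern_slope_pos Gamma_real_pos) simp

text \<open>For s <= 0 the mass near u = 0 is infinite, so only the differences kern s t - kern s 4
  are represented: exp (- u t) - exp (- 4 u) is O(u) at 0, which s > -2 makes integrable there. As 4
  is the largest squared distance on the unit sphere, these integrands are nonnegative.\<close>

definition kern_mix :: "real \<Rightarrow> real measure" where
  "kern_mix s = density lborel (\<lambda>u. ennreal (kern_weight s * u powr (s / 2 - 1)) * indicator {0<..} u)"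

lemma sets_kern_mix [simp, measurable_cong]: "sets (kern_mix s) = sets borel"
  by (simp add: kern_mix_def)

lemma nn_integral_kern_mix:
  "f \<in> borel_measurable borel \<Longrightarrow> (\<integral>\<^sup>+u. f u \<partial>kern_mix s) =
    (\<integral>\<^sup>+u. ennreal (kern_weight s * u powr (s / 2 - 1)) * indicator {0<..} u * f u \<partial>lborel)"
  unfolding kern_mix_def by (rule nn_integral_density) auto

lemma sigma_finite_kern_mix: "sigma_finite_measure (kern_mix s)"
  unfolding kern_mix_def
  by (subst sigma_finite_measure.sigma_finite_iff_density_finite[OF lborel.sigma_finite_measure_axioms])
     (auto simp: indicator_def)

lemma powr_eq_Gamma_integral:
  assumes q: "q > 0" and \<tau>: "\<tau> > 0"
  shows "ennreal (Gamma q * \<tau> powr (- q)) = (\<integral>\<^sup>+u. ennreal (u powr (q - 1) * exp (- u * \<tau>)) * indicator {0<..} u \<partial>lborel)"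
proof -
  let ?f = "\<lambda>u. ennreal (indicator {0..} u * u powr (q - 1) / exp u)"
  have "ennreal (Gamma q) = \<bar>\<tau>\<bar> * (\<integral>\<^sup>+u. ?f (0 + \<tau> * u) \<partial>lborel)"
    unfolding Gamma_conv_nn_integral_real[OF q] using \<tau> by (intro nn_integral_real_affine) auto
  also have "\<dots> = (\<integral>\<^sup>+u. ennreal \<tau> * ?f (0 + \<tau> * u) \<partial>lborel)"
    using \<tau> by (subst nn_integral_cmult) auto
  also have "\<dots> = (\<integral>\<^sup>+u. ennreal (\<tau> powr q) * (ennreal (u powr (q - 1) * exp (- u * \<tau>)) * indicator {0<..} u) \<partial>lborel)"
  proof (intro nn_integral_cong)
    fix u :: real
    have "\<tau> * \<tau> powr (q - 1) = \<tau> powr q"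
      using \<tau> by (simp add: powr_diff)
    then have "u > 0 \<Longrightarrow> \<tau> * ((\<tau> * u) powr (q - 1) / exp (\<tau> * u)) = \<tau> powr q * (u powr (q - 1) * exp (- u * \<tau>))"
      using \<tau> by (simp add: powr_mult exp_minus divide_inverse mult_ac)
    moreover have "0 \<le> \<tau> * u \<longleftrightarrow> 0 \<le> u"
      using \<tau> by (simp add: zero_le_mult_iff)
    ultimately show "ennreal \<tau> * ?f (0 + \<tau> * u) = ennreal (\<tau> powr q) * (ennreal (u powr (q - 1) * exp (- u * \<tau>)) * indicator {0<..} u)"
      using \<tau> by (cases "u = 0") (auto simp: indicator_def ennreal_mult[symmetric])
  qed
  also have "\<dots> = ennreal (\<tau> powr q) * (\<integral>\<^sup>+u. ennreal (u powr (q - 1) * exp (- u * \<tau>)) * indicator {0<..} u \<partial>lborel)"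
    by (rule nn_integral_cmult) measurable
  finally have "ennreal (\<tau> powr (- q)) * ennreal (Gamma q) =
      ennreal (\<tau> powr (- q)) * ennreal (\<tau> powr q) * (\<integral>\<^sup>+u. ennreal (u powr (q - 1) * exp (- u * \<tau>)) * indicator {0<..} u \<partial>lborel)"
    by (simp add: mult.assoc)
  moreover have "ennreal (\<tau> powr (- q)) * ennreal (\<tau> powr q) = 1"
    using \<tau> by (simp add: ennreal_mult[symmetric] flip: powr_add)
  ultimately show ?thesis
    using Gamma_real_pos[OF q] by (simp add: ennreal_mult mult.commute)
qed

text \<open>Minus the derivative of the kernel is a multiple of a negative power of \<tau>, hence by
  the Gamma integral a mixture of the functions exp (- u \<tau>). Integrating over \<tau> in [t, 4]
  and exchanging the integrals yields the difference of exponentials divided by u.\<close>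

lemma kern_eq_mixture:
  assumes s: "s > - 2" and t: "0 \<le> t" "t \<le> 4" "t > 0 \<or> s < 0"
  shows "ennreal (kern s t - kern s 4) = (\<integral>\<^sup>+u. ennreal (exp (- u * t) - exp (- u * 4)) \<partial>kern_mix s)"
proof -
  let ?q = "s / 2 + 1" and ?k = "kern_weight s"
  have q: "?q > 0" using s by simp
  have k: "?k > 0" by (rule kern_weight_pos[OF s])
  define J where "J \<tau> u = ennreal (?k * (u powr (?q - 1) * exp (- u * \<tau>))) * indicator {0<..} u * indicator {t..4} \<tau>" for \<tau> u
  have [measurable]: "case_prod J \<in> borel_measurable (borel \<Otimes>\<^sub>M borel)"
    unfolding J_def by measurable
  have "ennreal (kern s t - kern s 4) = (\<integral>\<^sup>+\<tau>. (\<integral>\<^sup>+u. J \<tau> u \<partial>lborel) \<partial>lborel)"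
    unfolding kern_diff[OF t, symmetric]
  proof (rule nn_integral_cong_AE)
    show "AE \<tau> in lborel. ennreal (kern_slope s * \<tau> powr (- ?q)) * indicator {t..4} \<tau> = (\<integral>\<^sup>+u. J \<tau> u \<partial>lborel)"
      using AE_lborel_singleton[of "0::real"]
    proof eventually_elim
      case (elim \<tau>)
      show ?case
      proof (cases "\<tau> \<in> {t..4}")
        case True
        with elim t have \<tau>: "\<tau> > 0" by auto
        have kG: "kern_slope s * \<tau> powr (- ?q) = ?k * (Gamma ?q * \<tau> powr (- ?q))"
          using Gamma_real_pos[OF q] by (simp add: kern_weight_def)
        have "ennreal (kern_slope s * \<tau> powr (- ?q)) = ennreal ?k * ennreal (Gamma ?q * \<tau> powr (- ?q))"
          unfolding kG using k Gamma_real_pos[OF q] by (intro ennreal_mult mult_nonneg_nonneg) auto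
        also have "\<dots> = (\<integral>\<^sup>+u. ennreal ?k * (ennreal (u powr (?q - 1) * exp (- u * \<tau>)) * indicator {0<..} u) \<partial>lborel)"
          unfolding powr_eq_Gamma_integral[OF q \<tau>] by (rule nn_integral_cmult[symmetric]) measurable
        also have "\<dots> = (\<integral>\<^sup>+u. J \<tau> u \<partial>lborel)"
          using True k by (intro nn_integral_cong) (simp add: J_def ennreal_mult mult_ac)
        finally show ?thesis
          using True by simp
      qed (simp add: J_def)
    qed
  qed
  also have "\<dots> = (\<integral>\<^sup>+u. (\<integral>\<^sup>+\<tau>. J \<tau> u \<partial>lborel) \<partial>lborel)"
    by (rule lborel_pair.Fubini') simp
  also have "\<dots> = (\<integral>\<^sup>+u. ennreal (?k * u powr (s / 2 - 1)) * indicator {0<..} u * ennreal (exp (- u * t) - exp (- u * 4)) \<partial>lborel)"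
  proof (intro nn_integral_cong)
    fix u :: real
    show "(\<integral>\<^sup>+\<tau>. J \<tau> u \<partial>lborel) = ennreal (?k * u powr (s / 2 - 1)) * indicator {0<..} u * ennreal (exp (- u * t) - exp (- u * 4))"
    proof (cases "u > 0")
      case True
      have "(\<integral>\<^sup>+\<tau>. ennreal (exp (- u * \<tau>)) * indicator {t..4} \<tau> \<partial>lborel) = ennreal ((- exp (- u * 4) / u) - (- exp (- u * t) / u))"
        using t True by (intro nn_integral_FTC_Icc) (auto intro!: derivative_eq_intros)
      also have "(- exp (- u * 4) / u) - (- exp (- u * t) / u) = (exp (- u * t) - exp (- u * 4)) / u"
        by (simp add: diff_divide_distrib)
      finally have I: "(\<integral>\<^sup>+\<tau>. ennreal (exp (- u * \<tau>)) * indicator {t..4} \<tau> \<partial>lborel) = ennreal ((exp (- u * t) - exp (- u * 4)) / u)" .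
      have mono: "exp (- u * 4) \<le> exp (- u * t)"
        using t True by simp
      have "(\<integral>\<^sup>+\<tau>. J \<tau> u \<partial>lborel) = (\<integral>\<^sup>+\<tau>. ennreal (?k * u powr (?q - 1)) * (ennreal (exp (- u * \<tau>)) * indicator {t..4} \<tau>) \<partial>lborel)"
        using True k by (intro nn_integral_cong) (simp add: J_def ennreal_mult mult_ac)
      also have "\<dots> = ennreal (?k * u powr (?q - 1)) * ennreal ((exp (- u * t) - exp (- u * 4)) / u)"
        unfolding I[symmetric] by (rule nn_integral_cmult) measurable
      also have "\<dots> = ennreal (?k * u powr (s / 2 - 1)) * ennreal (exp (- u * t) - exp (- u * 4))"
      proof -
        have "u powr (?q - 1) = u powr (s / 2 - 1) * u"
          using True by (simp add: powr_diff)
        then have "?k * u powr (?q - 1) * ((exp (- u * t) - exp (- u * 4)) / u) = ?k * u powr (s / 2 - 1) * (exp (- u * t) - exp (- u * 4))"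
          using True by simp
        then show ?thesis
          using True k mono by (simp only: ennreal_mult[symmetric] mult_nonneg_nonneg less_imp_le powr_ge_zero divide_nonneg_pos diff_ge_0_iff_ge)
      qed
      finally show ?thesis
        using True by simp
    qed (simp add: J_def)
  qed
  also have "\<dots> = (\<integral>\<^sup>+u. ennreal (exp (- u * t) - exp (- u * 4)) \<partial>kern_mix s)"
    by (rule nn_integral_kern_mix[symmetric]) measurable
  finally show ?thesis .
qed

lemma nn_integral_powr_tail:
  assumes b: "b > 0" and M: "M > 0"
  shows "(\<integral>\<^sup>+u. ennreal (u powr (- b - 1)) * indicator {M..} u \<partial>lborel) = ennreal (M powr (- b) / b)"
proof -
  have "((\<lambda>u. - (u powr (- b)) / b) \<longlongrightarrow> - 0 / b) at_top"
    using b by (intro tendsto_intros tendsto_neg_powr filterlim_ident) auto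
  then have "(\<integral>\<^sup>+u. ennreal (u powr (- b - 1)) * indicator {M..} u \<partial>lborel) = ennreal (- 0 / b - (- (M powr (- b)) / b))"
    using b M by (intro nn_integral_FTC_atLeast[where F = "\<lambda>u. - (u powr (- b)) / b"])
      (auto intro!: derivative_eq_intros)
  then show ?thesis by simp
qed

lemma nn_integral_powr_head:
  assumes a: "a > 0" and M: "M > 0"
  shows "(\<integral>\<^sup>+u. ennreal (u powr (a - 1)) * indicator {0..M} u \<partial>lborel) = ennreal (M powr a / a)"
proof (rule nn_integral_has_integral_lebesgue')
  have "((\<lambda>u. u powr (a - 1)) has_integral (M powr a / a - 0 powr a / a)) {0..M}"
  proof (rule fundamental_theorem_of_calculus_interior)
    show "continuous_on {0..M} (\<lambda>u. u powr a / a)"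
      using a by (intro continuous_intros continuous_on_powr') auto
    show "((\<lambda>u. u powr a / a) has_vector_derivative u powr (a - 1)) (at u)" if "u \<in> {0<..<M}" for u
      using that a unfolding has_real_derivative_iff_has_vector_derivative[symmetric]
      by (auto intro!: derivative_eq_intros)
  qed (use M in simp)
  then show "((\<lambda>u. u powr (a - 1)) has_integral M powr a / a) {0..M}"
    by simp
qed simp

lemma AE_kern_mix_pos: "AE u in kern_mix s. u > 0"
  unfolding kern_mix_def by (subst AE_density) (auto simp: indicator_def)

section \<open>Kernel means and the transfer from Gaussians to the kernel\<close>

context unit_sphere
begin

lemma AE_sph_ne:
  fixes z :: 'a
  assumes z: "norm z = 1"
  shows "AE w in sph. w \<noteq> z"
proof -
  have "emeasure (sph :: 'a measure) {z} = 0"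
    unfolding sph_def using measurable_sphere_measure
    by (subst emeasure_distr) (use emeasure_sphere_measure_singleton[of z] dim d2 z in auto)
  then have "{z} \<in> null_sets sph"
    by (intro null_setsI) auto
  from AE_not_in[OF this] show ?thesis
    by simp
qed

lemma AE_sqd_pole: "AE w in sph. 0 < sqd pole w \<and> sqd pole w \<le> 4"
  using AE_sph_norm AE_sph_ne[OF pole] by eventually_elim (use sqd_le_4[OF pole] in auto)

lemma smean_cong_pos:
  assumes "\<And>t. 0 < t \<Longrightarrow> t \<le> 4 \<Longrightarrow> F t = G t"
  shows "smean F = smean G"
proof -
  have "AE w in sph. F (sqd pole w) = G (sqd pole w)"
    using AE_sqd_pole by eventually_elim (use assms in blast)
  then show ?thesis
    unfolding smean_def by (rule nn_integral_cong_AE)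
qed

lemma smean_mono_pos:
  assumes "\<And>t. 0 < t \<Longrightarrow> t \<le> 4 \<Longrightarrow> F t \<le> G t"
  shows "smean F \<le> smean G"
proof -
  have "AE w in sph. F (sqd pole w) \<le> G (sqd pole w)"
    using AE_sqd_pole by eventually_elim (use assms in blast)
  then show ?thesis
    unfolding smean_def by (rule nn_integral_mono_AE)
qed

definition gmean :: "real \<Rightarrow> real" where
  "gmean u = enn2real (smean (\<lambda>t. ennreal (exp (- u * t))))"

lemma measurable_gmean [measurable]: "gmean \<in> borel_measurable borel"
  unfolding gmean_def smean_def by measurable

lemma gmean_nonneg: "gmean u \<ge> 0"
  by (simp add: gmean_def)

lemma smean_exp: "u \<ge> 0 \<Longrightarrow> smean (\<lambda>t. ennreal (exp (- u * t))) = ennreal (gmean u)"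
proof -
  assume u: "u \<ge> 0"
  have "smean (\<lambda>t. ennreal (exp (- u * t))) \<le> smean (\<lambda>_. 1)"
    using u by (intro smean_mono) auto
  then have "smean (\<lambda>t. ennreal (exp (- u * t))) < top"
    by (simp add: smean_const order_le_less_trans)
  then show ?thesis
    by (simp add: gmean_def)
qed

lemma smean_exp_diff:
  assumes u: "u \<ge> 0"
  shows "smean (\<lambda>t. ennreal (exp (- u * t) - exp (- u * 4))) = ennreal (gmean u - exp (- u * 4))"
    and "exp (- u * 4) \<le> gmean u"
proof -
  have "ennreal (gmean u) = smean (\<lambda>t. ennreal (exp (- u * t) - exp (- u * 4)) + ennreal (exp (- u * 4)))"
    unfolding smean_exp[OF u, symmetric]
    using u by (intro smean_cong_pos) (simp add: ennreal_plus[symmetric] mult_left_mono del: ennreal_plus)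
  also have "\<dots> = smean (\<lambda>t. ennreal (exp (- u * t) - exp (- u * 4))) + ennreal (exp (- u * 4))"
    by (subst smean_add) (auto simp: smean_const)
  finally have A: "ennreal (gmean u) = smean (\<lambda>t. ennreal (exp (- u * t) - exp (- u * 4))) + ennreal (exp (- u * 4))" .
  then have "ennreal (exp (- u * 4)) \<le> ennreal (gmean u)"
    by simp
  then show le: "exp (- u * 4) \<le> gmean u"
    by (simp add: gmean_nonneg)
  have "ennreal (exp (- u * 4)) + smean (\<lambda>t. ennreal (exp (- u * t) - exp (- u * 4))) = ennreal (exp (- u * 4)) + ennreal (gmean u - exp (- u * 4))"
    using A le by (simp add: ennreal_plus[symmetric] add.commute del: ennreal_plus)
  then show "smean (\<lambda>t. ennreal (exp (- u * t) - exp (- u * 4))) = ennreal (gmean u - exp (- u * 4))"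
    by simp
qed

lemma gauss_sum_ge_real:
  fixes x :: "nat \<Rightarrow> 'a"
  assumes u: "u > 0" and x: "\<And>i. i \<in> A \<Longrightarrow> norm (x i) = 1" and A: "finite A"
  shows "(real (card A))\<^sup>2 * gmean u \<le> (\<Sum>i\<in>A. \<Sum>j\<in>A. exp (- u * sqd (x i) (x j)))"
proof -
  have "ennreal ((real (card A))\<^sup>2 * gmean u) = (of_nat (card A))\<^sup>2 * smean (\<lambda>t. ennreal (exp (- u * t)))"
    using u by (subst smean_exp) (simp_all add: ennreal_mult gmean_nonneg ennreal_of_nat_eq_real_of_nat ennreal_power)
  also have "\<dots> \<le> (\<Sum>i\<in>A. \<Sum>j\<in>A. ennreal (exp (- u * sqd (x i) (x j))))"
    by (rule gauss_sum_ge[OF u x A])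
  also have "\<dots> = ennreal (\<Sum>i\<in>A. \<Sum>j\<in>A. exp (- u * sqd (x i) (x j)))"
    by (simp add: sum_nonneg)
  finally show ?thesis
    by (simp add: sum_nonneg)
qed

definition kmean :: "real \<Rightarrow> real" where
  "kmean s = (\<integral>w. kern s (sqd pole w) \<partial>sph)"

context
  fixes s :: real
  assumes s: "- 2 < s" "s < real d"
begin

lemma smean_kern_diff_finite: "smean (\<lambda>t. ennreal (kern s t - kern s 4)) < \<infinity>"
proof -
  \<comment> \<open>For s = 0 the logarithm is dominated by t powr (-1/2), which is integrable
    because d >= 2.\<close>
  define p where "p = (if s = 0 then 1 / 2 else s / 2)"
  have p: "p < real d / 2"
    using s d2 by (simp add: p_def)
  have "smean (\<lambda>t. ennreal (kern s t - kern s 4)) \<le> smean (\<lambda>t. ennreal (t powr (-p)) + ennreal \<bar>kern s 4\<bar>)"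
  proof (rule smean_mono_pos)
    fix t :: real assume t: "0 < t" "t \<le> 4"
    have "kern s t \<le> t powr (- p)"
    proof (cases "s = 0")
      case True
      have "ln (1 / sqrt t) \<le> 1 / sqrt t"
        using t by (intro order_trans[OF ln_le_minus_one]) auto
      moreover have "ln (1 / sqrt t) = - ln t / 2"
        using t by (simp add: ln_div ln_sqrt)
      moreover have "t powr (- p) = 1 / sqrt t"
      proof -
        have "t powr (- p) = inverse (t powr (1 / 2))"
          using True by (simp only: p_def powr_minus simp_thms if_True)
        then show ?thesis
          using t by (simp add: powr_half_sqrt inverse_eq_divide)
      qed
      ultimately show ?thesis
        using True by (simp add: kern_def)
    qed (auto simp: kern_def p_def sgn_if)
    then have "ennreal (kern s t - kern s 4) \<le> ennreal (t powr (-p) + \<bar>kern s 4\<bar>)"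
      by (intro ennreal_leI) linarith
    then show "ennreal (kern s t - kern s 4) \<le> ennreal (t powr (-p)) + ennreal \<bar>kern s 4\<bar>"
      by simp
  qed
  also have "\<dots> = smean (\<lambda>t. ennreal (t powr (-p))) + ennreal \<bar>kern s 4\<bar>"
    by (subst smean_add) (auto simp: smean_const)
  also have "\<dots> < \<infinity>"
    using smean_powr_finite[OF p] by simp
  finally show ?thesis .
qed

lemma kmean_eq:
  "integrable sph (\<lambda>w. kern s (sqd pole w))"
  "smean (\<lambda>t. ennreal (kern s t - kern s 4)) = ennreal (kmean s - kern s 4)"
  "kern s 4 \<le> kmean s"
proof -
  have ae: "AE w in sph. 0 \<le> kern s (sqd pole w) - kern s 4"
    using AE_sqd_pole by eventually_elim (simp add: kern_antimono)
  have int: "integrable sph (\<lambda>w. kern s (sqd pole w) - kern s 4)"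
    using smean_kern_diff_finite ae unfolding smean_def
    by (intro integrableI_nonneg) auto
  from Bochner_Integration.integrable_add[OF int, of "\<lambda>_. kern s 4"]
  show i: "integrable sph (\<lambda>w. kern s (sqd pole w))"
    by simp
  have eq: "(\<integral>w. kern s (sqd pole w) - kern s 4 \<partial>sph) = kmean s - kern s 4"
    using i by (simp add: kmean_def sph.prob_space[simplified])
  show "smean (\<lambda>t. ennreal (kern s t - kern s 4)) = ennreal (kmean s - kern s 4)"
    unfolding smean_def eq[symmetric] using int ae by (intro nn_integral_eq_integral) auto
  have "0 \<le> (\<integral>w. kern s (sqd pole w) - kern s 4 \<partial>sph)"
    using ae by (rule integral_nonneg_AE)
  then show "kern s 4 \<le> kmean s"
    using eq by simp
qed

lemma kmean_mixture:
  "ennreal (kmean s - kern s 4) = (\<integral>\<^sup>+u. ennreal (gmean u - exp (- u * 4)) \<partial>kern_mix s)"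
proof -
  interpret km: sigma_finite_measure "kern_mix s"
    by (rule sigma_finite_kern_mix)
  interpret pair_sigma_finite "sph :: 'a measure" "kern_mix s" ..
  have "ennreal (kmean s - kern s 4) = smean (\<lambda>t. \<integral>\<^sup>+u. ennreal (exp (- u * t) - exp (- u * 4)) \<partial>kern_mix s)"
    unfolding kmean_eq(2)[symmetric] by (intro smean_cong_pos kern_eq_mixture s(1)) auto
  also have "\<dots> = (\<integral>\<^sup>+u. smean (\<lambda>t. ennreal (exp (- u * t) - exp (- u * 4))) \<partial>kern_mix s)"
    unfolding smean_def by (rule Fubini'[symmetric]) measurable
  also have "\<dots> = (\<integral>\<^sup>+u. ennreal (gmean u - exp (- u * 4)) \<partial>kern_mix s)"
  proof (rule nn_integral_cong_AE)
    show "AE u in kern_mix s. smean (\<lambda>t. ennreal (exp (- u * t) - exp (- u * 4))) = ennreal (gmean u - exp (- u * 4))"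
      using AE_kern_mix_pos by eventually_elim (rule smean_exp_diff(1)[OF less_imp_le])
  qed
  finally show ?thesis .
qed

lemma energy_compare:
  fixes x :: "nat \<Rightarrow> 'a"
  assumes B: "finite B" "\<And>i j. (i, j) \<in> B \<Longrightarrow> norm (x i) = 1 \<and> norm (x j) = 1 \<and> (x i \<noteq> x j \<or> s < 0)"
    and [measurable]: "f \<in> borel_measurable borel" "h \<in> borel_measurable borel"
    and f: "\<And>u. u > 0 \<Longrightarrow> f u \<ge> 0" and h: "\<And>u. u > 0 \<Longrightarrow> h u \<ge> 0"
    and le: "\<And>u. u > 0 \<Longrightarrow> c * (gmean u - exp (- u * 4)) + f u \<le> (\<Sum>(i, j)\<in>B. exp (- u * sqd (x i) (x j)) - exp (- u * 4)) + h u"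
    and c: "c \<ge> 0" and fh: "(\<integral>\<^sup>+u. ennreal (f u) \<partial>kern_mix s) = ennreal F" "F \<ge> 0" "(\<integral>\<^sup>+u. ennreal (h u) \<partial>kern_mix s) \<le> ennreal H" "H \<ge> 0"
  shows "c * (kmean s - kern s 4) + F \<le> (\<Sum>(i, j)\<in>B. kern s (sqd (x i) (x j)) - kern s 4) + H"
proof -
  have nn: "0 \<le> exp (- u * sqd (x i) (x j)) - exp (- u * 4)" if "u > 0" "(i, j) \<in> B" for u i j
    using that B(2)[OF that(2)] sqd_le_4[of "x i" "x j"] by simp
  have kn: "0 \<le> kern s (sqd (x i) (x j)) - kern s 4" if "(i, j) \<in> B" for i j
  proof (cases "x i = x j")
    case True
    then show ?thesis
      using B(2)[OF that] by (simp add: kern_def)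
  next
    case False
    then show ?thesis
      using B(2)[OF that] sqd_le_4[of "x i" "x j"] by (auto intro!: kern_antimono)
  qed
  have "ennreal (c * (kmean s - kern s 4) + F) = (\<integral>\<^sup>+u. ennreal c * ennreal (gmean u - exp (- u * 4)) + ennreal (f u) \<partial>kern_mix s)"
  proof -
    have "(\<integral>\<^sup>+u. ennreal c * ennreal (gmean u - exp (- u * 4)) \<partial>kern_mix s) = ennreal c * ennreal (kmean s - kern s 4)"
      unfolding kmean_mixture by (rule nn_integral_cmult) measurable
    then show ?thesis
      using c kmean_eq(3) fh by (subst nn_integral_add) (auto simp: ennreal_mult simp del: mult_minus_left)
  qed
  also have "\<dots> \<le> (\<integral>\<^sup>+u. (\<Sum>(i, j)\<in>B. ennreal (exp (- u * sqd (x i) (x j)) - exp (- u * 4))) + ennreal (h u) \<partial>kern_mix s)"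
  proof (rule nn_integral_mono_AE)
    show "AE u in kern_mix s. ennreal c * ennreal (gmean u - exp (- u * 4)) + ennreal (f u) \<le>
        (\<Sum>(i, j)\<in>B. ennreal (exp (- u * sqd (x i) (x j)) - exp (- u * 4))) + ennreal (h u)"
      using AE_kern_mix_pos
    proof eventually_elim
      case (elim u)
      have S: "(\<Sum>(i, j)\<in>B. ennreal (exp (- u * sqd (x i) (x j)) - exp (- u * 4))) = ennreal (\<Sum>(i, j)\<in>B. exp (- u * sqd (x i) (x j)) - exp (- u * 4))"
        using nn[OF elim] by (subst sum_ennreal[symmetric]) (auto intro!: sum.cong)
      have S0: "0 \<le> (\<Sum>(i, j)\<in>B. exp (- u * sqd (x i) (x j)) - exp (- u * 4))"
        using nn[OF elim] by (intro sum_nonneg) auto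
      have "ennreal c * ennreal (gmean u - exp (- u * 4)) + ennreal (f u) = ennreal (c * (gmean u - exp (- u * 4)) + f u)"
        using c f[OF elim] smean_exp_diff(2)[of u] elim by (simp add: ennreal_mult)
      also have "\<dots> \<le> ennreal ((\<Sum>(i, j)\<in>B. exp (- u * sqd (x i) (x j)) - exp (- u * 4)) + h u)"
        by (rule ennreal_leI[OF le[OF elim]])
      also have "\<dots> = (\<Sum>(i, j)\<in>B. ennreal (exp (- u * sqd (x i) (x j)) - exp (- u * 4))) + ennreal (h u)"
        unfolding S using S0 h[OF elim] by (rule ennreal_plus)
      finally show ?case .
    qed
  qed
  also have "\<dots> = (\<Sum>(i, j)\<in>B. (\<integral>\<^sup>+u. ennreal (exp (- u * sqd (x i) (x j)) - exp (- u * 4)) \<partial>kern_mix s)) + (\<integral>\<^sup>+u. ennreal (h u) \<partial>kern_mix s)"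
    by (subst nn_integral_add) (auto simp: split_beta nn_integral_sum)
  also have "(\<Sum>(i, j)\<in>B. (\<integral>\<^sup>+u. ennreal (exp (- u * sqd (x i) (x j)) - exp (- u * 4)) \<partial>kern_mix s)) = (\<Sum>(i, j)\<in>B. ennreal (kern s (sqd (x i) (x j)) - kern s 4))"
  proof (rule sum.cong[OF refl])
    fix ij assume "ij \<in> B"
    moreover obtain i j where ij: "ij = (i, j)"
      by (cases ij)
    ultimately have *: "norm (x i) = 1" "norm (x j) = 1" "0 < sqd (x i) (x j) \<or> s < 0"
      using B(2)[of i j] by auto
    show "(case ij of (i, j) \<Rightarrow> \<integral>\<^sup>+u. ennreal (exp (- u * sqd (x i) (x j)) - exp (- u * 4)) \<partial>kern_mix s) =
        (case ij of (i, j) \<Rightarrow> ennreal (kern s (sqd (x i) (x j)) - kern s 4))"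
      unfolding ij prod.case by (rule kern_eq_mixture[symmetric]) (use * s sqd_le_4[OF *(1,2)] in auto)
  qed
  also have "\<dots> = ennreal (\<Sum>(i, j)\<in>B. kern s (sqd (x i) (x j)) - kern s 4)"
    using kn by (subst sum_ennreal[symmetric]) (auto intro!: sum.cong)
  also have "\<dots> + (\<integral>\<^sup>+u. ennreal (h u) \<partial>kern_mix s) \<le> ennreal (\<Sum>(i, j)\<in>B. kern s (sqd (x i) (x j)) - kern s 4) + ennreal H"
    using fh by (intro add_left_mono) auto
  also have "\<dots> = ennreal ((\<Sum>(i, j)\<in>B. kern s (sqd (x i) (x j)) - kern s 4) + H)"
    using kn fh by (intro ennreal_plus[symmetric] sum_nonneg) auto
  finally show ?thesis
    using kn fh by (subst (asm) ennreal_le_iff) (auto intro!: add_nonneg_nonneg sum_nonneg)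
qed

end

end

text \<open>Used with b = d / 2, the decay exponent of the Gaussian mean, and for s < 0 with b =
  0.\<close>

lemma kern_mix_tail:
  assumes s: "s > - 2" and b: "b > s / 2" and M: "M > 0" and C: "C \<ge> 0"
  shows "(\<integral>\<^sup>+u. ennreal (C * u powr (- b)) * indicator {M..} u \<partial>kern_mix s) =
    ennreal (kern_weight s * C * (M powr (s / 2 - b) / (b - s / 2)))"
proof -
  have "(\<integral>\<^sup>+u. ennreal (C * u powr (- b)) * indicator {M..} u \<partial>kern_mix s) =
      (\<integral>\<^sup>+u. ennreal (kern_weight s * u powr (s / 2 - 1)) * indicator {0<..} u * (ennreal (C * u powr (- b)) * indicator {M..} u) \<partial>lborel)"
    by (rule nn_integral_kern_mix) measurable
  also have "\<dots> = (\<integral>\<^sup>+u. ennreal (kern_weight s * C) * (ennreal (u powr (- (b - s / 2) - 1)) * indicator {M..} u) \<partial>lborel)"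
  proof (intro nn_integral_cong)
    fix u :: real
    have "u powr (s / 2 - 1) * u powr (- b) = u powr (- (b - s / 2) - 1)"
      unfolding powr_add[symmetric] by (rule arg_cong[where f = "(powr) u"]) simp
    then have "kern_weight s * u powr (s / 2 - 1) * (C * u powr (- b)) = kern_weight s * C * u powr (- (b - s / 2) - 1)"
      by (metis (no_types, opaque_lifting) mult.assoc mult.left_commute)
    then have "ennreal (kern_weight s * u powr (s / 2 - 1)) * ennreal (C * u powr (- b)) = ennreal (kern_weight s * C) * ennreal (u powr (- (b - s / 2) - 1))"
      using kern_weight_pos[OF s] C by (simp only: ennreal_mult[symmetric] mult_nonneg_nonneg less_imp_le powr_ge_zero)
    then show "ennreal (kern_weight s * u powr (s / 2 - 1)) * indicator {0<..} u * (ennreal (C * u powr (- b)) * indicator {M..} u)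
        = ennreal (kern_weight s * C) * (ennreal (u powr (- (b - s / 2) - 1)) * indicator {M..} u)"
      using M by (auto simp: indicator_def)
  qed
  also have "\<dots> = ennreal (kern_weight s * C) * ennreal (M powr (- (b - s / 2)) / (b - s / 2))"
    using b M by (subst nn_integral_cmult) (auto simp only: nn_integral_powr_tail, auto)
  finally show ?thesis
    using kern_weight_pos[OF s] C b by (simp add: ennreal_mult[symmetric])
qed

lemma kern_mix_head:
  assumes s: "s > 0" and M: "M > 0"
  shows "(\<integral>\<^sup>+u. indicator {0..M} u \<partial>kern_mix s) = ennreal (kern_weight s * (M powr (s / 2) / (s / 2)))"
proof -
  have "(\<integral>\<^sup>+u. indicator {0..M} u \<partial>kern_mix s) =
      (\<integral>\<^sup>+u. ennreal (kern_weight s * u powr (s / 2 - 1)) * indicator {0<..} u * indicator {0..M} u \<partial>lborel)"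
    by (rule nn_integral_kern_mix) measurable
  also have "\<dots> = (\<integral>\<^sup>+u. ennreal (kern_weight s) * (ennreal (u powr (s / 2 - 1)) * indicator {0..M} u) \<partial>lborel)"
    using kern_weight_pos[of s] s by (intro nn_integral_cong) (auto simp: indicator_def ennreal_mult)
  also have "\<dots> = ennreal (kern_weight s) * ennreal (M powr (s / 2) / (s / 2))"
    using s M nn_integral_powr_head[of "s / 2" M] by (subst nn_integral_cmult) auto
  finally show ?thesis
    using kern_weight_pos[of s] s by (simp add: ennreal_mult[symmetric])
qed

text \<open>At s = 0 the mixing density is 1 / (2 u). The bound 1 - exp (- 4 u) <= 4 u makes the
  integrand at most 2 on (0, 1]; beyond 1 the integral of 1 / (2 u) supplies ln M / 2, the source of
  the coefficient 1 / d in the logarithmic case.\<close>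

lemma kern_mix_head_log:
  assumes M: "M \<ge> 1"
  shows "(\<integral>\<^sup>+u. ennreal (1 - exp (- u * 4)) * indicator {..<M} u \<partial>kern_mix 0) \<le> ennreal (2 + ln M / 2)"
proof -
  have w: "kern_weight 0 = 1 / 2"
    by (simp add: kern_weight_def kern_slope_def)
  have "(\<integral>\<^sup>+u. ennreal (1 - exp (- u * 4)) * indicator {..<M} u \<partial>kern_mix 0) =
      (\<integral>\<^sup>+u. ennreal (kern_weight 0 * u powr (0 / 2 - 1)) * indicator {0<..} u * (ennreal (1 - exp (- u * 4)) * indicator {..<M} u) \<partial>lborel)"
    by (rule nn_integral_kern_mix) measurable
  also have "\<dots> \<le> (\<integral>\<^sup>+u. ennreal 2 * indicator {0..1} u + ennreal (1 / 2 * (1 / u)) * indicator {1..M} u \<partial>lborel)"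
  proof (intro nn_integral_mono)
    fix u :: real
    show "ennreal (kern_weight 0 * u powr (0 / 2 - 1)) * indicator {0<..} u * (ennreal (1 - exp (- u * 4)) * indicator {..<M} u)
       \<le> ennreal 2 * indicator {0..1} u + ennreal (1 / 2 * (1 / u)) * indicator {1..M} u"
    proof (cases "0 < u \<and> u < M")
      case True
      have pw: "kern_weight 0 * u powr (0 / 2 - 1) = 1 / 2 * (1 / u)"
        using True by (simp add: w powr_neg_one)
      show ?thesis
      proof (cases "u \<le> 1")
        case u1: True
        have "1 - exp (- u * 4) \<le> u * 4"
          using exp_ge_add_one_self[of "- u * 4"] by simp
        then have "1 / 2 * (1 / u) * (1 - exp (- u * 4)) \<le> 1 / 2 * (1 / u) * (u * 4)"
          using True by (intro mult_left_mono) auto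
        then have "ennreal (1 / 2 * (1 / u) * (1 - exp (- u * 4))) \<le> ennreal 2"
          using True by (intro ennreal_leI) simp
        moreover have "ennreal (1 / 2 * (1 / u)) * ennreal (1 - exp (- u * 4)) = ennreal (1 / 2 * (1 / u) * (1 - exp (- u * 4)))"
          using True by (intro ennreal_mult[symmetric]) auto
        ultimately have "ennreal (1 / 2 * (1 / u)) * ennreal (1 - exp (- u * 4)) \<le> ennreal 2"
          by simp
        then show ?thesis
          unfolding pw using True u1 by (simp add: indicator_def add_increasing2)
      next
        case False
        have "ennreal (1 / 2 * (1 / u)) * ennreal (1 - exp (- u * 4)) \<le> ennreal (1 / 2 * (1 / u)) * ennreal 1"
          by (intro mult_left_mono ennreal_leI) auto
        then show ?thesis
          unfolding pw using True False by (simp add: indicator_def)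
      qed
    qed auto
  qed
  also have "\<dots> = ennreal 2 + (\<integral>\<^sup>+u. ennreal (1 / 2 * (1 / u)) * indicator {1..M} u \<partial>lborel)"
    by (subst nn_integral_add) (auto simp: nn_integral_cmult)
  also have "(\<integral>\<^sup>+u. ennreal (1 / 2 * (1 / u)) * indicator {1..M} u \<partial>lborel) = ennreal (1 / 2 * ln M - 1 / 2 * ln 1)"
    using M by (intro nn_integral_FTC_Icc) (auto intro!: derivative_eq_intros)
  also have "ennreal 2 + ennreal (1 / 2 * ln M - 1 / 2 * ln 1) = ennreal (2 + ln M / 2)"
    using M by (subst ennreal_plus[symmetric]) auto
  finally show ?thesis .
qed

section \<open>Lower bounds for the energy of arbitrary configurations\<close>

context unit_sphere
begin

lemma gmean_le:
  obtains C where "C > 0" "\<And>u. u > 0 \<Longrightarrow> gmean u \<le> C * u powr (- (real d / 2))"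
proof -
  obtain C where C: "C > 0" "\<And>u. u > 0 \<Longrightarrow> smean (\<lambda>t. ennreal (exp (- u * t))) \<le> ennreal (C * u powr (- (real d / 2)))"
    by (rule gauss_mean_le, rule that, assumption+)
  show thesis
  proof (rule that[OF C(1)])
    fix u :: real assume u: "u > 0"
    have "ennreal (gmean u) \<le> ennreal (C * u powr (- (real d / 2)))"
      using C(2)[OF u] smean_exp[of u] u by simp
    then show "gmean u \<le> C * u powr (- (real d / 2))"
      using C(1) by (subst (asm) ennreal_le_iff) auto
  qed
qed

text \<open>Below the cutoff \<open>M\<close> the Gaussian inequality for the full double sum is
  used, at the price of the N diagonal terms; above it only the positivity of the off-diagonal
  terms, at the price of N^2 times the Gaussian mean. \<open>H\<close> bounds the total
  price.\<close>

lemma energy_offdiag_ge: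
  fixes x :: "nat \<Rightarrow> 'a"
  assumes s: "- 2 < s" "s < real d" and A: "finite A" "\<And>i. i \<in> A \<Longrightarrow> norm (x i) = 1" "inj_on x A"
    and H: "(\<integral>\<^sup>+u. ennreal (if u < M then real (card A) * (1 - exp (- u * 4)) else (real (card A))\<^sup>2 * gmean u) \<partial>kern_mix s) \<le> ennreal H" "H \<ge> 0"
  shows "(real (card A))\<^sup>2 * kmean s - real (card A) * kern s 4 - H \<le> (\<Sum>(i, j)\<in>{(i, j)\<in>A \<times> A. i \<noteq> j}. kern s (sqd (x i) (x j)))"
proof -
  let ?N = "real (card A)" and ?B = "{(i, j)\<in>A \<times> A. i \<noteq> j}"
  have split: "(\<Sum>i\<in>A. \<Sum>j\<in>A. F i j) = (\<Sum>(i, j)\<in>?B. F i j) + (\<Sum>i\<in>A. F i i)" for F :: "nat \<Rightarrow> nat \<Rightarrow> real"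
  proof -
    have AA: "A \<times> A = ?B \<union> (\<lambda>i. (i, i)) ` A"
      by auto
    have "finite ?B"
      using A(1) by (auto intro: finite_subset[of _ "A \<times> A"])
    then have "(\<Sum>(i, j)\<in>A \<times> A. F i j) = (\<Sum>(i, j)\<in>?B. F i j) + (\<Sum>(i, j)\<in>(\<lambda>i. (i, i)) ` A. F i j)"
      using A(1) by (subst AA, intro sum.union_disjoint) auto
    also have "(\<Sum>(i, j)\<in>(\<lambda>i. (i, i)) ` A. F i j) = (\<Sum>i\<in>A. F i i)"
      by (subst sum.reindex) (auto simp: inj_on_def)
    finally show ?thesis
      by (simp add: sum.cartesian_product)
  qed
  have cB: "(\<Sum>(i, j)\<in>?B. k) = (?N\<^sup>2 - ?N) * k" for k :: real
    using split[of "\<lambda>_ _. k"] by (simp add: power2_eq_square algebra_simps)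
  have "?N\<^sup>2 * (kmean s - kern s 4) + 0 \<le> (\<Sum>(i, j)\<in>?B. kern s (sqd (x i) (x j)) - kern s 4) + H"
  proof (rule energy_compare[OF s])
    show "finite ?B"
      by (rule finite_subset[of _ "A \<times> A"]) (use A(1) in auto)
    show "norm (x i) = 1 \<and> norm (x j) = 1 \<and> (x i \<noteq> x j \<or> s < 0)" if "(i, j) \<in> ?B" for i j
      using that A(2,3) by (auto dest: inj_onD)
    show "(\<integral>\<^sup>+u. ennreal 0 \<partial>kern_mix s) = ennreal 0" by simp
    show "?N\<^sup>2 * (gmean u - exp (- u * 4)) + 0 \<le> (\<Sum>(i, j)\<in>?B. exp (- u * sqd (x i) (x j)) - exp (- u * 4)) +
        (if u < M then ?N * (1 - exp (- u * 4)) else ?N\<^sup>2 * gmean u)" if u: "u > 0" for u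
    proof (cases "u < M")
      case True
      have "?N\<^sup>2 * gmean u \<le> (\<Sum>(i, j)\<in>?B. exp (- u * sqd (x i) (x j))) + ?N"
        using gauss_sum_ge_real[of u A x, OF u A(2,1)] split[of "\<lambda>i j. exp (- u * sqd (x i) (x j))"] by simp
      moreover have "(\<Sum>(i, j)\<in>?B. exp (- u * sqd (x i) (x j)) - exp (- u * 4)) = (\<Sum>(i, j)\<in>?B. exp (- u * sqd (x i) (x j))) - (?N\<^sup>2 - ?N) * exp (- u * 4)"
        unfolding cB[symmetric] by (simp add: split_beta sum_subtractf)
      ultimately show ?thesis
        using True by (simp add: algebra_simps)
    next
      case False
      have "0 \<le> (\<Sum>(i, j)\<in>?B. exp (- u * sqd (x i) (x j)) - exp (- u * 4))"
        using u by (intro sum_nonneg) (auto intro!: sqd_le_4 A(2))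
      moreover have "0 \<le> ?N\<^sup>2 * exp (- u * 4)" by simp
      ultimately show ?thesis
        using False by (simp add: algebra_simps)
    qed
  qed (use H gmean_nonneg in auto)
  moreover have "(\<Sum>(i, j)\<in>?B. kern s (sqd (x i) (x j)) - kern s 4) = (\<Sum>(i, j)\<in>?B. kern s (sqd (x i) (x j))) - (?N\<^sup>2 - ?N) * kern s 4"
    unfolding cB[symmetric] by (simp add: split_beta sum_subtractf)
  ultimately show ?thesis
    by (simp add: algebra_simps)
qed

text \<open>At the cutoff M = N^(2/d) the diagonal price N M^(s/2) and the tail price N^2 M^(s/2 -
  d/2) have the same order.\<close>

lemma powr_scaling:
  fixes N :: real
  assumes N: "N > 0"
  shows "N * (N powr (2 / real d)) powr (s / 2) = N powr (1 + s / real d)"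
    "N\<^sup>2 * (N powr (2 / real d)) powr (s / 2 - real d / 2) = N powr (1 + s / real d)"
proof -
  have d: "real d \<noteq> 0" using d2 by simp
  have "N * (N powr (2 / real d)) powr (s / 2) = N powr 1 * N powr (2 / real d * (s / 2))"
    using N by (simp add: powr_powr)
  also have "\<dots> = N powr (1 + s / real d)"
    unfolding powr_add[symmetric] by simp
  finally show "N * (N powr (2 / real d)) powr (s / 2) = N powr (1 + s / real d)" .
  have "N\<^sup>2 * (N powr (2 / real d)) powr (s / 2 - real d / 2) = N powr 2 * N powr (2 / real d * (s / 2 - real d / 2))"
    using N by (simp add: powr_powr)
  also have "\<dots> = N powr (1 + s / real d)"
    unfolding powr_add[symmetric] by (rule arg_cong[where f = "(powr) N"]) (use d in \<open>simp add: field_simps\<close>)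
  finally show "N\<^sup>2 * (N powr (2 / real d)) powr (s / 2 - real d / 2) = N powr (1 + s / real d)" .
qed

lemma energy_ge_pos:
  assumes s: "0 < s" "s < real d"
  obtains C where "C > 0" "\<And>(x :: nat \<Rightarrow> 'a) A. finite A \<Longrightarrow> A \<noteq> {} \<Longrightarrow> (\<And>i. i \<in> A \<Longrightarrow> norm (x i) = 1) \<Longrightarrow> inj_on x A \<Longrightarrow>
    kmean s * (real (card A))\<^sup>2 - C * real (card A) powr (1 + s / real d) \<le> (\<Sum>(i, j)\<in>{(i, j)\<in>A \<times> A. i \<noteq> j}. kern s (sqd (x i) (x j)))"
proof -
  obtain C where C: "C > 0" "\<And>u. u > 0 \<Longrightarrow> gmean u \<le> C * u powr (- (real d / 2))"
    by (rule gmean_le, rule that, assumption+)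
  let ?k = "kern_weight s"
  have s2: "s > - 2" using s by simp
  have k: "?k > 0" by (rule kern_weight_pos[OF s2])
  define a where "a = ?k / (s / 2)"
  define b where "b = ?k * C / (real d / 2 - s / 2)"
  have ab: "a > 0" "b > 0"
    using k s C(1) by (auto simp: a_def b_def)
  show thesis
  \<comment> \<open>\<open>a\<close> and \<open>b\<close> come from the head and the tail of the
    mixture; the 1 absorbs \<open>N * kern s 4\<close>, which is at most N and so at most N^(1 +
    s/d).\<close>
  proof (rule that[of "1 + a + b"])
    show "1 + a + b > 0" using ab by simp
    fix x :: "nat \<Rightarrow> 'a" and A :: "nat set"
    assume A: "finite A" "A \<noteq> {}" "\<And>i. i \<in> A \<Longrightarrow> norm (x i) = 1" "inj_on x A"
    let ?N = "real (card A)"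
    have N: "?N \<ge> 1" using A(1,2) by (simp add: Suc_leI card_gt_0_iff)
    define M where "M = ?N powr (2 / real d)"
    define Z where "Z = ?N powr (1 + s / real d)"
    have M: "M > 0" using N by (simp add: M_def)
    have "(\<integral>\<^sup>+u. ennreal (if u < M then ?N * (1 - exp (- u * 4)) else ?N\<^sup>2 * gmean u) \<partial>kern_mix s)
       \<le> (\<integral>\<^sup>+u. ennreal ?N * indicator {0..M} u + ennreal (?N\<^sup>2 * C * u powr (- (real d / 2))) * indicator {M..} u \<partial>kern_mix s)"
    proof (rule nn_integral_mono_AE)
      show "AE u in kern_mix s. ennreal (if u < M then ?N * (1 - exp (- u * 4)) else ?N\<^sup>2 * gmean u)
        \<le> ennreal ?N * indicator {0..M} u + ennreal (?N\<^sup>2 * C * u powr (- (real d / 2))) * indicator {M..} u"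
        using AE_kern_mix_pos
      proof eventually_elim
        case (elim u)
        show ?case
        proof (cases "u < M")
          case True
          have "?N * (1 - exp (- u * 4)) \<le> ?N * 1"
            by (intro mult_left_mono) auto
          then show ?thesis
            using True elim by (simp add: ennreal_leI)
        next
          case False
          have "?N\<^sup>2 * gmean u \<le> ?N\<^sup>2 * (C * u powr (- (real d / 2)))"
            by (intro mult_left_mono C elim) auto
          then have "ennreal (?N\<^sup>2 * gmean u) \<le> ennreal (?N\<^sup>2 * C * u powr (- (real d / 2)))"
            by (intro ennreal_leI) (simp add: mult.assoc)
          then show ?thesis
            using False by (simp add: add_increasing)
        qed
      qed
    qed
    also have "\<dots> = ennreal ?N * ennreal (?k * (M powr (s / 2) / (s / 2))) + ennreal (?k * (?N\<^sup>2 * C) * (M powr (s / 2 - real d / 2) / (real d / 2 - s / 2)))"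
      using s C(1) M kern_mix_head[OF s(1) M]
      by (subst nn_integral_add) (auto simp: nn_integral_cmult kern_mix_tail)
    also have "\<dots> = ennreal (a * Z + b * Z)"
    proof -
      have "?N * (?k * (M powr (s / 2) / (s / 2))) = a * Z"
        unfolding a_def Z_def M_def powr_scaling(1)[of ?N s, symmetric, OF less_le_trans[OF zero_less_one N]]
        by (simp add: field_simps)
      moreover have "?k * (?N\<^sup>2 * C) * (M powr (s / 2 - real d / 2) / (real d / 2 - s / 2)) = b * Z"
        unfolding b_def Z_def M_def powr_scaling(2)[of ?N s, symmetric, OF less_le_trans[OF zero_less_one N]]
        by (simp only: times_divide_eq_left times_divide_eq_right mult_ac)
      ultimately show ?thesis
        using ab k s by (simp add: ennreal_mult[symmetric] ennreal_plus[symmetric] Z_def del: ennreal_plus)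
    qed
    finally have "?N\<^sup>2 * kmean s - ?N * kern s 4 - (a * Z + b * Z) \<le> (\<Sum>(i, j)\<in>{(i, j)\<in>A \<times> A. i \<noteq> j}. kern s (sqd (x i) (x j)))"
      using ab by (intro energy_offdiag_ge[OF s2 s(2) A(1,3,4)]) (auto simp: Z_def)
    moreover have "?N * kern s 4 \<le> Z"
    proof -
      have "kern s 4 \<le> 1"
        using s by (simp add: kern_def powr_minus inverse_le_1_iff ge_one_powr_ge_zero)
      then have "?N * kern s 4 \<le> ?N * 1"
        using N by (intro mult_left_mono) auto
      also have "\<dots> \<le> Z"
        using N s powr_mono[of 1 "1 + s / real d" ?N] by (simp add: Z_def)
      finally show ?thesis .
    qed
    ultimately show "kmean s * ?N\<^sup>2 - (1 + a + b) * ?N powr (1 + s / real d) \<le> (\<Sum>(i, j)\<in>{(i, j)\<in>A \<times> A. i \<noteq> j}. kern s (sqd (x i) (x j)))"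
      unfolding Z_def[symmetric] by (simp add: algebra_simps)
  qed
qed

lemma energy_ge_zero:
  obtains C where "C > 0" "\<And>(x :: nat \<Rightarrow> 'a) A. finite A \<Longrightarrow> A \<noteq> {} \<Longrightarrow> (\<And>i. i \<in> A \<Longrightarrow> norm (x i) = 1) \<Longrightarrow> inj_on x A \<Longrightarrow>
    kmean 0 * (real (card A))\<^sup>2 - 1 / real d * real (card A) * ln (real (card A)) - C * real (card A)
      \<le> (\<Sum>(i, j)\<in>{(i, j)\<in>A \<times> A. i \<noteq> j}. kern 0 (sqd (x i) (x j)))"
proof -
  obtain C where C: "C > 0" "\<And>u. u > 0 \<Longrightarrow> gmean u \<le> C * u powr (- (real d / 2))"
    by (rule gmean_le, rule that, assumption+)
  let ?k = "kern_weight 0"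
  have k: "?k > 0" by (rule kern_weight_pos) simp
  have s2: "- 2 < (0::real)" "0 < real d" using d2 by auto
  define b where "b = ?k * C / (real d / 2)"
  have b: "b > 0"
    using k s2 C(1) by (auto simp: b_def)
  show thesis
  \<comment> \<open>The 2 comes from the part u <= 1 of the head; \<open>kern 0 4\<close> is
    negative, so its term only strengthens the bound.\<close>
  proof (rule that[of "2 + b"])
    show "2 + b > 0" using b by simp
    fix x :: "nat \<Rightarrow> 'a" and A :: "nat set"
    assume A: "finite A" "A \<noteq> {}" "\<And>i. i \<in> A \<Longrightarrow> norm (x i) = 1" "inj_on x A"
    let ?N = "real (card A)"
    have N: "?N \<ge> 1" using A(1,2) by (simp add: Suc_leI card_gt_0_iff)
    define M where "M = ?N powr (2 / real d)"
    have M: "M \<ge> 1" using N by (simp add: M_def ge_one_powr_ge_zero)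
    \<comment> \<open>The choice M = N^(2/d) turns the head term N ln M / 2 into N ln N / d.\<close>
    have lnM: "ln M / 2 = ln ?N / real d"
      using N by (simp add: M_def ln_powr)
    have "(\<integral>\<^sup>+u. ennreal (if u < M then ?N * (1 - exp (- u * 4)) else ?N\<^sup>2 * gmean u) \<partial>kern_mix 0)
       \<le> (\<integral>\<^sup>+u. ennreal ?N * (ennreal (1 - exp (- u * 4)) * indicator {..<M} u) + ennreal (?N\<^sup>2 * C * u powr (- (real d / 2))) * indicator {M..} u \<partial>kern_mix 0)"
    proof (rule nn_integral_mono_AE)
      show "AE u in kern_mix 0. ennreal (if u < M then ?N * (1 - exp (- u * 4)) else ?N\<^sup>2 * gmean u)
        \<le> ennreal ?N * (ennreal (1 - exp (- u * 4)) * indicator {..<M} u) + ennreal (?N\<^sup>2 * C * u powr (- (real d / 2))) * indicator {M..} u"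
        using AE_kern_mix_pos
      proof eventually_elim
        case (elim u)
        show ?case
        proof (cases "u < M")
          case True
          then show ?thesis
            using elim by (simp add: ennreal_mult)
        next
          case False
          have "?N\<^sup>2 * gmean u \<le> ?N\<^sup>2 * (C * u powr (- (real d / 2)))"
            by (intro mult_left_mono C elim) auto
          then have "ennreal (?N\<^sup>2 * gmean u) \<le> ennreal (?N\<^sup>2 * C * u powr (- (real d / 2)))"
            by (intro ennreal_leI) (simp add: mult.assoc)
          then show ?thesis
            using False by (simp add: add_increasing)
        qed
      qed
    qed
    also have "\<dots> = ennreal ?N * (\<integral>\<^sup>+u. ennreal (1 - exp (- u * 4)) * indicator {..<M} u \<partial>kern_mix 0) + ennreal (?k * (?N\<^sup>2 * C) * (M powr (0 / 2 - real d / 2) / (real d / 2 - 0 / 2)))"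
      using C(1) M s2 kern_mix_tail[of 0 "real d / 2" M "?N\<^sup>2 * C"]
      by (subst nn_integral_add) (auto simp: nn_integral_cmult)
    also have "\<dots> \<le> ennreal ?N * ennreal (2 + ln M / 2) + ennreal (b * ?N)"
    proof (intro add_mono mult_left_mono kern_mix_head_log M)
      have "?k * (?N\<^sup>2 * C) * (M powr (0 / 2 - real d / 2) / (real d / 2 - 0 / 2)) = b * (?N\<^sup>2 * M powr (0 / 2 - real d / 2))"
        unfolding b_def by (simp add: field_simps)
      also have "?N\<^sup>2 * M powr (0 / 2 - real d / 2) = ?N"
        unfolding M_def using powr_scaling(2)[of ?N 0] N by simp
      finally show "ennreal (?k * (?N\<^sup>2 * C) * (M powr (0 / 2 - real d / 2) / (real d / 2 - 0 / 2))) \<le> ennreal (b * ?N)"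
        by simp
    qed auto
    also have "\<dots> = ennreal (?N * (2 + ln ?N / real d) + b * ?N)"
      using b N by (simp add: lnM ennreal_mult[symmetric] ennreal_plus[symmetric] del: ennreal_plus)
    finally have "?N\<^sup>2 * kmean 0 - ?N * kern 0 4 - (?N * (2 + ln ?N / real d) + b * ?N) \<le> (\<Sum>(i, j)\<in>{(i, j)\<in>A \<times> A. i \<noteq> j}. kern 0 (sqd (x i) (x j)))"
      using b N by (intro energy_offdiag_ge[OF s2 A(1,3,4)]) auto
    moreover have "?N * kern 0 4 \<le> 0"
      by (simp add: kern_def mult_nonneg_nonpos)
    ultimately show "kmean 0 * ?N\<^sup>2 - 1 / real d * ?N * ln ?N - (2 + b) * ?N \<le> (\<Sum>(i, j)\<in>{(i, j)\<in>A \<times> A. i \<noteq> j}. kern 0 (sqd (x i) (x j)))"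
      by (simp add: algebra_simps)
  qed
qed

text \<open>For negative \<open>s\<close> the diagonal contributes: the Gaussian sum is also at least \<open>N\<close>, which beats
  the mean as soon as \<open>u\<close> exceeds a multiple of \<open>N\<^bsup>2/d\<^esup>\<close>.\<close>

lemma energy_ge_neg:
  assumes s: "- 2 < s" "s < 0"
  obtains c where "c > 0" "\<And>(x :: nat \<Rightarrow> 'a) A. finite A \<Longrightarrow> A \<noteq> {} \<Longrightarrow> (\<And>i. i \<in> A \<Longrightarrow> norm (x i) = 1) \<Longrightarrow>
    kmean s * (real (card A))\<^sup>2 + c * real (card A) powr (1 + s / real d) \<le> (\<Sum>(i, j)\<in>A \<times> A. kern s (sqd (x i) (x j)))"
proof -
  obtain C where C: "C > 0" "\<And>u. u > 0 \<Longrightarrow> gmean u \<le> C * u powr (- (real d / 2))"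
    by (rule gmean_le, rule that, assumption+)
  let ?k = "kern_weight s"
  have sd: "s < real d" using s d2 by simp
  have k: "?k > 0" by (rule kern_weight_pos[OF s(1)])
  define c where "c = ?k * (1 / 2) * ((2 * C) powr (s / real d) / (- s / 2))"
  have c: "c > 0"
    using k s C(1) by (auto simp: c_def zero_less_mult_iff divide_pos_neg)
  show thesis
  proof (rule that[OF c])
    fix x :: "nat \<Rightarrow> 'a" and A :: "nat set"
    assume A: "finite A" "A \<noteq> {}" "\<And>i. i \<in> A \<Longrightarrow> norm (x i) = 1"
    let ?N = "real (card A)"
    have N: "?N \<ge> 1" using A(1,2) by (simp add: Suc_leI card_gt_0_iff)
    \<comment> \<open>Chosen so that N^2 C M^(-d/2) = N / 2: for u >= M the Gaussian sum is at least
      N while N^2 times the mean is at most N / 2, which leaves a gain of N / 2.\<close>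
    define M where "M = (2 * C * ?N) powr (2 / real d)"
    have M: "M > 0" using N C by (simp add: M_def)
    have cc: "(\<Sum>(i, j)\<in>A \<times> A. k) = ?N\<^sup>2 * k" for k :: real
      by (simp add: power2_eq_square card_cartesian_product)
    \<comment> \<open>The factor \<open>u powr (- 0)\<close>, equal to 1 for u > 0, gives the gain
      the shape of \<open>kern_mix_tail\<close> with b = 0, which is admissible since s < 0.\<close>
    have F: "(\<integral>\<^sup>+u. ennreal (?N / 2 * u powr (- 0) * indicator {M..} u) \<partial>kern_mix s) = ennreal (c * ?N powr (1 + s / real d))"
    proof -
      have "(\<integral>\<^sup>+u. ennreal (?N / 2 * u powr (- 0) * indicator {M..} u) \<partial>kern_mix s) = (\<integral>\<^sup>+u. ennreal (?N / 2 * u powr (- 0)) * indicator {M..} u \<partial>kern_mix s)"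
        by (intro nn_integral_cong) (auto simp: indicator_def)
      also have "\<dots> = ennreal (?k * (?N / 2) * (M powr (s / 2 - 0) / (0 - s / 2)))"
        using s N by (intro kern_mix_tail M) auto
      also have "?k * (?N / 2) * (M powr (s / 2 - 0) / (0 - s / 2)) = c * ?N powr (1 + s / real d)"
      proof -
        have "M powr (s / 2 - 0) = (2 * C) powr (s / real d) * ?N powr (s / real d)"
          using C N by (simp add: M_def powr_powr powr_mult)
        moreover have "?N powr (1 + s / real d) = ?N * ?N powr (s / real d)"
          using N by (simp add: powr_add)
        ultimately show ?thesis
          by (simp add: c_def)
      qed
      finally show ?thesis .
    qed
    have "?N\<^sup>2 * (kmean s - kern s 4) + c * ?N powr (1 + s / real d) \<le> (\<Sum>(i, j)\<in>A \<times> A. kern s (sqd (x i) (x j)) - kern s 4) + 0"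
    proof (rule energy_compare[OF s(1) sd])
      show "?N\<^sup>2 * (gmean u - exp (- u * 4)) + ?N / 2 * u powr (- 0) * indicator {M..} u
          \<le> (\<Sum>(i, j)\<in>A \<times> A. exp (- u * sqd (x i) (x j)) - exp (- u * 4)) + 0" if u: "u > 0" for u
      proof -
        have S: "(\<Sum>(i, j)\<in>A \<times> A. exp (- u * sqd (x i) (x j)) - exp (- u * 4)) = (\<Sum>i\<in>A. \<Sum>j\<in>A. exp (- u * sqd (x i) (x j))) - ?N\<^sup>2 * exp (- u * 4)"
          unfolding cc[symmetric] by (simp add: split_beta sum_subtractf sum.cartesian_product)
        show ?thesis
        proof (cases "u < M")
          case True
          then show ?thesis
            unfolding S using gauss_sum_ge_real[of u A x, OF u A(3,1)] by (simp add: algebra_simps)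
        next
          case False
          have "(\<Sum>i\<in>A. (1::real)) \<le> (\<Sum>i\<in>A. \<Sum>j\<in>A. exp (- u * sqd (x i) (x j)))"
          proof (rule sum_mono)
            fix i assume i: "i \<in> A"
            have "(\<Sum>j\<in>{i}. exp (- u * sqd (x i) (x j))) \<le> (\<Sum>j\<in>A. exp (- u * sqd (x i) (x j)))"
              using i A(1) by (intro sum_mono2) auto
            then show "1 \<le> (\<Sum>j\<in>A. exp (- u * sqd (x i) (x j)))" by simp
          qed
          then have "?N \<le> (\<Sum>i\<in>A. \<Sum>j\<in>A. exp (- u * sqd (x i) (x j)))" by simp
          moreover have "?N\<^sup>2 * gmean u \<le> ?N / 2"
          proof -
            have "u powr (- (real d / 2)) \<le> M powr (- (real d / 2))"
              using False M by (intro powr_mono2') auto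
            also have "\<dots> = 1 / (2 * C * ?N)"
              using N C(1) d2 by (simp add: M_def powr_powr powr_neg_one)
            finally have "?N\<^sup>2 * (C * u powr (- (real d / 2))) \<le> ?N\<^sup>2 * (C * (1 / (2 * C * ?N)))"
              using C(1) by (intro mult_left_mono) auto
            also have "\<dots> = ?N / 2"
              using C(1) N by (simp add: power2_eq_square)
            finally show ?thesis
              using mult_left_mono[OF C(2)[OF u], of "?N\<^sup>2"] by simp
          qed
          ultimately show ?thesis
            unfolding S using False u by (simp add: algebra_simps)
        qed
      qed
    qed (use A F c s in auto)
    moreover have "(\<Sum>(i, j)\<in>A \<times> A. kern s (sqd (x i) (x j)) - kern s 4) = (\<Sum>(i, j)\<in>A \<times> A. kern s (sqd (x i) (x j))) - ?N\<^sup>2 * kern s 4"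
      unfolding cc[symmetric] by (simp add: split_beta sum_subtractf)
    ultimately show "kmean s * ?N\<^sup>2 + c * ?N powr (1 + s / real d) \<le> (\<Sum>(i, j)\<in>A \<times> A. kern s (sqd (x i) (x j)))"
      by (simp add: algebra_simps)
  qed
qed

end

section \<open>Minima of potentials\<close>

text \<open>The sign convention f x - f (x + h) makes the differences of x powr (- p), for p > 0,
  nonnegative at every order.\<close>

primrec fdiff :: "nat \<Rightarrow> real \<Rightarrow> (real \<Rightarrow> real) \<Rightarrow> real \<Rightarrow> real" where
  "fdiff 0 h f x = f x"
| "fdiff (Suc m) h f x = fdiff m h f x - fdiff m h f (x + h)"

lemma fdiff_cmult: "fdiff m h (\<lambda>x. c * f x) x = c * fdiff m h f x"
  by (induction m arbitrary: x) (simp_all add: algebra_simps)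

lemma DERIV_fdiff:
  assumes "\<And>x. x > 0 \<Longrightarrow> (f has_real_derivative f' x) (at x)" and "h \<ge> 0" and "x > 0"
  shows "(fdiff m h f has_real_derivative fdiff m h f' x) (at x)"
  using assms(3)
proof (induction m arbitrary: x)
  case 0
  have "fdiff 0 h f = f" by (simp add: fun_eq_iff)
  with assms(1)[OF 0] show ?case by simp
next
  case (Suc m)
  have eq: "fdiff (Suc m) h f = (\<lambda>x. fdiff m h f x - fdiff m h f (x + h))"
    by (simp add: fun_eq_iff)
  have "((\<lambda>x. fdiff m h f (x + h)) has_real_derivative fdiff m h f' (x + h)) (at x)"
    using DERIV_shift[of "fdiff m h f" "fdiff m h f' (x + h)" x h] Suc.IH[of "x + h"] Suc.prems assms(2) by simp
  with Suc.IH[OF Suc.prems] show ?case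
    unfolding eq fdiff.simps by (intro DERIV_diff)
qed

text \<open>One difference is traded for one derivative, which commutes with the remaining
  differences and raises p to p + 1.\<close>

lemma fdiff_powr_mean_value:
  assumes h: "h > 0" and x: "x > 0"
  obtains \<xi> where "x < \<xi>" "\<xi> < x + h"
    "fdiff (Suc m) h (\<lambda>x. x powr (- p)) x = h * p * fdiff m h (\<lambda>x. x powr (- (p + 1))) \<xi>"
proof -
  have der: "((\<lambda>x. x powr (- p)) has_real_derivative - p * x powr (- (p + 1))) (at x)" if "x > 0" for x
  proof -
    have "- p - 1 = - (p + 1)" by simp
    then show ?thesis
      using has_real_derivative_powr[OF that, of "- p"] by (simp only:)
  qed
  have "\<exists>\<xi>>x. \<xi> < x + h \<and> fdiff m h (\<lambda>x. x powr (- p)) (x + h) - fdiff m h (\<lambda>x. x powr (- p)) x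
      = (x + h - x) * fdiff m h (\<lambda>x. - p * x powr (- (p + 1))) \<xi>"
  proof (rule MVT2)
    fix y assume "x \<le> y"
    then show "(fdiff m h (\<lambda>x. x powr (- p)) has_real_derivative fdiff m h (\<lambda>x. - p * x powr (- (p + 1))) y) (at y)"
      by (intro DERIV_fdiff[OF der]) (use h x in auto)
  qed (use h in simp)
  then obtain \<xi> where \<xi>: "x < \<xi>" "\<xi> < x + h"
    "fdiff m h (\<lambda>x. x powr (- p)) (x + h) - fdiff m h (\<lambda>x. x powr (- p)) x
      = (x + h - x) * fdiff m h (\<lambda>x. - p * x powr (- (p + 1))) \<xi>"
    by blast
  show thesis
    by (rule that[OF \<xi>(1,2)]) (use \<xi>(3) in \<open>simp add: fdiff_cmult[of m h "- p", simplified] fdiff_cmult algebra_simps\<close>)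
qed

text \<open>The induction step from order m at p + 1 to order m + 1 at p. It admits -1 < p < 0,
  where p + 1 is positive but the factor \<open>p\<close> from the derivative is negative; hence
  \<open>sgn p\<close> on one side and \<open>\<bar>p\<bar>\<close> on the other.\<close>

lemma fdiff_powr_sgn_bounds_step:
  fixes m :: nat
  assumes h: "h > 0" and x: "x > 0" and p: "p > - 1"
    and B: "\<And>\<xi>. \<xi> > 0 \<Longrightarrow> h ^ m * pochhammer (p + 1) m * (\<xi> + real m * h) powr (- (p + real (Suc m))) \<le> fdiff m h (\<lambda>x. x powr (- (p + 1))) \<xi>"
    "\<And>\<xi>. \<xi> > 0 \<Longrightarrow> fdiff m h (\<lambda>x. x powr (- (p + 1))) \<xi> \<le> h ^ m * pochhammer (p + 1) m * \<xi> powr (- (p + real (Suc m)))"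
  defines "A \<equiv> \<bar>p\<bar> * pochhammer (p + 1) m"
  shows "A * h ^ Suc m * (x + real (Suc m) * h) powr (- (p + real (Suc m))) \<le> sgn p * fdiff (Suc m) h (\<lambda>x. x powr (- p)) x"
    and "sgn p * fdiff (Suc m) h (\<lambda>x. x powr (- p)) x \<le> A * h ^ Suc m * x powr (- (p + real (Suc m)))"
proof -
  obtain \<xi> where \<xi>: "x < \<xi>" "\<xi> < x + h"
    "fdiff (Suc m) h (\<lambda>x. x powr (- p)) x = h * p * fdiff m h (\<lambda>x. x powr (- (p + 1))) \<xi>"
    by (rule fdiff_powr_mean_value[OF h x])
  have \<xi>0: "\<xi> > 0" using \<xi> x by simp
  let ?q = "- (p + real (Suc m))"
  have poch: "pochhammer (p + 1) m \<ge> 0"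
    using p by (intro pochhammer_nonneg) auto
  have "(x + real (Suc m) * h) powr ?q \<le> (\<xi> + real m * h) powr ?q"
    using \<xi> x h p by (intro powr_mono2') (auto simp: algebra_simps add_pos_nonneg)
  then have L: "h ^ m * pochhammer (p + 1) m * (x + real (Suc m) * h) powr ?q \<le> fdiff m h (\<lambda>x. x powr (- (p + 1))) \<xi>"
    using h poch by (intro order_trans[OF mult_left_mono B(1)[OF \<xi>0]]) auto
  have "\<xi> powr ?q \<le> x powr ?q"
    using \<xi> x p by (intro powr_mono2') auto
  then have U: "fdiff m h (\<lambda>x. x powr (- (p + 1))) \<xi> \<le> h ^ m * pochhammer (p + 1) m * x powr ?q"
    using h poch by (intro order_trans[OF B(2)[OF \<xi>0] mult_left_mono]) auto
  have sg: "sgn p * fdiff (Suc m) h (\<lambda>x. x powr (- p)) x = h * \<bar>p\<bar> * fdiff m h (\<lambda>x. x powr (- (p + 1))) \<xi>"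
    unfolding \<xi>(3) by (simp add: abs_sgn mult_ac)
  have c: "A * h ^ Suc m * z = h * \<bar>p\<bar> * (h ^ m * pochhammer (p + 1) m * z)" for z
    by (simp add: A_def mult_ac)
  show "A * h ^ Suc m * (x + real (Suc m) * h) powr ?q \<le> sgn p * fdiff (Suc m) h (\<lambda>x. x powr (- p)) x"
    unfolding sg c using h by (intro mult_left_mono L) auto
  show "sgn p * fdiff (Suc m) h (\<lambda>x. x powr (- p)) x \<le> A * h ^ Suc m * x powr ?q"
    unfolding sg c using h by (intro mult_left_mono U) auto
qed

text \<open>Up to moving the argument by at most m h, the m-th difference is h^m times the absolute
  value of the m-th derivative; differentiating the power m times produces the Pochhammer
  factor.\<close>

lemma fdiff_powr_bounds:
  assumes h: "h > 0" and "x > 0" and "p > 0"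
  shows "h ^ m * pochhammer p m * (x + real m * h) powr (- (p + real m)) \<le> fdiff m h (\<lambda>x. x powr (- p)) x"
    and "fdiff m h (\<lambda>x. x powr (- p)) x \<le> h ^ m * pochhammer p m * x powr (- (p + real m))"
proof -
  have "h ^ m * pochhammer p m * (x + real m * h) powr (- (p + real m)) \<le> fdiff m h (\<lambda>x. x powr (- p)) x \<and>
    fdiff m h (\<lambda>x. x powr (- p)) x \<le> h ^ m * pochhammer p m * x powr (- (p + real m))"
    using assms(2,3)
  proof (induction m arbitrary: x p)
    case (Suc m)
    have q: "p + 1 + real m = p + real (Suc m)" by simp
    have c: "\<bar>p\<bar> * pochhammer (p + 1) m * h ^ Suc m = h ^ Suc m * pochhammer p (Suc m)"
      using Suc.prems by (simp add: pochhammer_rec mult_ac)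
    have sg: "sgn p * z = z" for z
      using Suc.prems by simp
    show ?case
      using fdiff_powr_sgn_bounds_step[OF h Suc.prems(1), of p m] Suc.IH[of _ "p + 1"] Suc.prems
      unfolding q c sg by auto
  qed simp
  then show "h ^ m * pochhammer p m * (x + real m * h) powr (- (p + real m)) \<le> fdiff m h (\<lambda>x. x powr (- p)) x"
    and "fdiff m h (\<lambda>x. x powr (- p)) x \<le> h ^ m * pochhammer p m * x powr (- (p + real m))"
    by auto
qed

text \<open>For \<open>p < 0\<close> only the first difference changes sign.\<close>

lemma fdiff_powr_sgn_bounds:
  fixes m :: nat
  assumes h: "h > 0" and x: "x > 0" and p: "p > - 1"
  defines "A \<equiv> \<bar>p\<bar> * pochhammer (p + 1) m"
  shows "A * h ^ Suc m * (x + real (Suc m) * h) powr (- (p + real (Suc m))) \<le> sgn p * fdiff (Suc m) h (\<lambda>x. x powr (- p)) x"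
    and "sgn p * fdiff (Suc m) h (\<lambda>x. x powr (- p)) x \<le> A * h ^ Suc m * x powr (- (p + real (Suc m)))"
proof -
  have q: "p + 1 + real m = p + real (Suc m)" by simp
  have "p + 1 > 0" using p by simp
  note B = fdiff_powr_bounds[OF h _ this, of _ m, unfolded q]
  from fdiff_powr_sgn_bounds_step[OF h x p B]
  show "A * h ^ Suc m * (x + real (Suc m) * h) powr (- (p + real (Suc m))) \<le> sgn p * fdiff (Suc m) h (\<lambda>x. x powr (- p)) x"
    and "sgn p * fdiff (Suc m) h (\<lambda>x. x powr (- p)) x \<le> A * h ^ Suc m * x powr (- (p + real (Suc m)))"
    unfolding A_def by blast+
qed

section \<open>Signed densities with explicit potentials\<close>

context unit_sphere
begin

definition rmean :: "real \<Rightarrow> real" where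
  "rmean p = enn2real (smean (\<lambda>t. ennreal (t powr (- p))))"

context
  fixes p :: real
  assumes p: "- 1 < p" "p < real d / 2" "p \<noteq> 0"
begin

lemma smean_powr: "smean (\<lambda>t. ennreal (t powr (- p))) = ennreal (rmean p)"
  using smean_powr_finite[OF p(2)] by (simp add: rmean_def)

lemma rmean_pos: "rmean p > 0"
proof -
  have "smean (\<lambda>t. ennreal (t powr (- p))) \<noteq> 0"
  proof
    assume "smean (\<lambda>t. ennreal (t powr (- p))) = 0"
    then have "AE w in sph. ennreal (sqd pole w powr (- p)) = 0"
      unfolding smean_def by (subst (asm) nn_integral_0_iff_AE) auto
    then have "AE w in (sph :: 'a measure). False"
      using AE_sqd_pole by eventually_elim auto
    then show False
      by simp
  qed
  then show ?thesis
    unfolding smean_powr by (simp add: ennreal_eq_0_iff)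
qed

lemma kern_eq_powr: "kern (2 * p) t = sgn p * t powr (- p)"
  using p by (simp add: kern_def sgn_mult)

lemma kmean_eq_rmean: "kmean (2 * p) = sgn p * rmean p"
proof -
  have "(\<integral>w. sqd pole w powr (- p) \<partial>sph) = rmean p"
    unfolding rmean_def smean_def by (rule integral_eq_nn_integral) auto
  then show ?thesis
    by (simp add: kmean_def kern_eq_powr)
qed

text \<open>The double integral of the distance power against the bubble is computed in both orders:
  one gives the potential of the bubble, the other the mean of the power. The common factor
  \<open>rmean p\<close> is positive and finite and cancels.\<close>

lemma bubble_mean:
  assumes e: "e > 0"
  shows "smean (\<lambda>t. ennreal (bubble p e t)) = smean (\<lambda>t. ennreal ((e + t) powr (- p)))"
proof -
  interpret pair_sigma_finite "sph :: 'a measure" "sph :: 'a measure" ..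
  have "ennreal (rmean p) * smean (\<lambda>t. ennreal ((e + t) powr (- p))) = (\<integral>\<^sup>+z. ennreal (rmean p) * ennreal ((e + sqd pole z) powr (- p)) \<partial>sph)"
    unfolding smean_def by (rule nn_integral_cmult[symmetric]) measurable
  also have "\<dots> = (\<integral>\<^sup>+z. (\<integral>\<^sup>+w. ennreal (sqd z w powr (-p)) * ennreal (bubble p e (sqd pole w)) \<partial>sph) \<partial>sph)"
  proof (rule nn_integral_cong_AE)
    show "AE z in sph. ennreal (rmean p) * ennreal ((e + sqd pole z) powr (- p)) =
        (\<integral>\<^sup>+w. ennreal (sqd z w powr (-p)) * ennreal (bubble p e (sqd pole w)) \<partial>sph)"
      using AE_sph_norm by eventually_elim (simp add: bubble_potential[OF pole _ e] smean_powr)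
  qed
  also have "\<dots> = (\<integral>\<^sup>+w. (\<integral>\<^sup>+z. ennreal (sqd z w powr (-p)) * ennreal (bubble p e (sqd pole w)) \<partial>sph) \<partial>sph)"
    by (rule Fubini') measurable
  also have "\<dots> = (\<integral>\<^sup>+w. ennreal (rmean p) * ennreal (bubble p e (sqd pole w)) \<partial>sph)"
  proof (rule nn_integral_cong_AE)
    show "AE w in sph. (\<integral>\<^sup>+z. ennreal (sqd z w powr (-p)) * ennreal (bubble p e (sqd pole w)) \<partial>sph) = ennreal (rmean p) * ennreal (bubble p e (sqd pole w))"
      using AE_sph_norm
    proof eventually_elim
      case (elim w)
      have "(\<integral>\<^sup>+z. ennreal (sqd z w powr (-p)) * ennreal (bubble p e (sqd pole w)) \<partial>sph)
          = (\<integral>\<^sup>+z. ennreal (sqd w z powr (-p)) \<partial>sph) * ennreal (bubble p e (sqd pole w))"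
        by (subst sqd_commute, rule nn_integral_multc) measurable
      also have "(\<integral>\<^sup>+z. ennreal (sqd w z powr (-p)) \<partial>sph) = ennreal (rmean p)"
        unfolding smean_powr[symmetric] by (rule smean_eq[OF _ elim]) measurable
      finally show ?case .
    qed
  qed
  also have "\<dots> = ennreal (rmean p) * smean (\<lambda>t. ennreal (bubble p e t))"
    unfolding smean_def by (rule nn_integral_cmult) measurable
  finally show ?thesis
    using rmean_pos by (simp add: ennreal_mult_cancel_left)
qed

lemma bubble_nonneg: "bubble p e t \<ge> 0"
  by (simp add: bubble_def)

text \<open>The point is uniformity as e tends to 0, while the bubble concentrates at its centre.
  For p < 0 the power (e + t) powr (- p) increases with t, whence the term with E + 4.\<close>

lemma bubble_mean_le:
  assumes e: "e > 0" "e \<le> E"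
  shows "smean (\<lambda>t. ennreal (bubble p e t)) \<le> ennreal (rmean p + (E + 4) powr \<bar>p\<bar>)"
proof (cases "p > 0")
  case True
  have "smean (\<lambda>t. ennreal ((e + t) powr (- p))) \<le> smean (\<lambda>t. ennreal (t powr (- p)))"
    using e True by (intro smean_mono_pos ennreal_leI powr_mono2') auto
  also have "\<dots> \<le> ennreal (rmean p + (E + 4) powr \<bar>p\<bar>)"
    unfolding smean_powr by (intro ennreal_leI) simp
  finally show ?thesis
    unfolding bubble_mean[OF e(1)] .
next
  case False
  then have "p < 0" using p by simp
  then have "smean (\<lambda>t. ennreal ((e + t) powr (- p))) \<le> smean (\<lambda>t. ennreal ((E + 4) powr \<bar>p\<bar>))"
    using e by (intro smean_mono_pos ennreal_leI) (auto intro!: powr_mono2)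
  also have "\<dots> \<le> ennreal (rmean p + (E + 4) powr \<bar>p\<bar>)"
    unfolding smean_const using rmean_pos by (intro ennreal_leI) simp
  finally show ?thesis
    unfolding bubble_mean[OF e(1)] .
qed

lemma bubble_integral:
  fixes y :: 'a
  assumes y: "norm y = 1" and e: "e > 0"
  shows "integrable sph (\<lambda>x. bubble p e (sqd y x))"
    and "(\<integral>x. bubble p e (sqd y x) \<partial>sph) = (\<integral>x. (e + sqd pole x) powr (- p) \<partial>sph)"
    and "e \<le> E \<Longrightarrow> (\<integral>x. bubble p e (sqd y x) \<partial>sph) \<le> rmean p + (E + 4) powr \<bar>p\<bar>"
proof -
  have eq: "(\<integral>\<^sup>+x. ennreal (bubble p e (sqd y x)) \<partial>sph) = smean (\<lambda>t. ennreal (bubble p e t))"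
    by (rule smean_eq[OF _ y]) measurable
  have fin: "smean (\<lambda>t. ennreal (bubble p e t)) < \<infinity>"
    using bubble_mean_le[OF e order_refl] by (rule order_le_less_trans) simp
  show "integrable sph (\<lambda>x. bubble p e (sqd y x))"
    using fin unfolding eq[symmetric] by (intro integrableI_nonneg) (auto simp: bubble_nonneg)
  have I: "(\<integral>x. bubble p e (sqd y x) \<partial>sph) = enn2real (smean (\<lambda>t. ennreal (bubble p e t)))"
    unfolding eq[symmetric] by (rule integral_eq_nn_integral) (auto simp: bubble_nonneg)
  show "(\<integral>x. bubble p e (sqd y x) \<partial>sph) = (\<integral>x. (e + sqd pole x) powr (- p) \<partial>sph)"
    unfolding I bubble_mean[OF e] smean_def by (rule integral_eq_nn_integral[symmetric]) auto
  show "(\<integral>x. bubble p e (sqd y x) \<partial>sph) \<le> rmean p + (E + 4) powr \<bar>p\<bar>" if "e \<le> E"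
    unfolding I using rmean_pos by (intro enn2real_leI bubble_mean_le[OF e that]) auto
qed

lemma bubble_kern_integral:
  fixes x z :: 'a
  assumes x: "norm x = 1" and z: "norm z = 1" and e: "e > 0"
  shows "integrable sph (\<lambda>w. kern (2 * p) (sqd z w) * bubble p e (sqd x w))"
    and "(\<integral>w. kern (2 * p) (sqd z w) * bubble p e (sqd x w) \<partial>sph) = sgn p * rmean p * (e + sqd x z) powr (- p)"
proof -
  have eq: "(\<integral>\<^sup>+w. ennreal (sqd z w powr (-p) * bubble p e (sqd x w)) \<partial>sph) = ennreal (rmean p * (e + sqd x z) powr (- p))"
    using bubble_potential[OF x z e, of p] rmean_pos by (simp add: smean_powr ennreal_mult bubble_nonneg)
  have int: "integrable sph (\<lambda>w. sqd z w powr (-p) * bubble p e (sqd x w))"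
    by (rule integrableI_nonneg) (auto simp: bubble_nonneg eq)
  have I: "(\<integral>w. sqd z w powr (-p) * bubble p e (sqd x w) \<partial>sph) = rmean p * (e + sqd x z) powr (- p)"
    using rmean_pos by (subst integral_eq_nn_integral) (auto simp: bubble_nonneg eq)
  have k: "kern (2 * p) (sqd z w) * bubble p e (sqd x w) = sgn p * (sqd z w powr (-p) * bubble p e (sqd x w))" for w
    by (simp add: kern_eq_powr)
  show "integrable sph (\<lambda>w. kern (2 * p) (sqd z w) * bubble p e (sqd x w))"
    unfolding k using int by simp
  show "(\<integral>w. kern (2 * p) (sqd z w) * bubble p e (sqd x w) \<partial>sph) = sgn p * rmean p * (e + sqd x z) powr (- p)"
    unfolding k using I by simp
qed

text \<open>A signed density. Differences in \<open>e\<close> commute with forming potentials, so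
  its potential is \<open>sgn p * rmean p\<close> times the same difference of the power.\<close>

definition psi :: "nat \<Rightarrow> real \<Rightarrow> real \<Rightarrow> real \<Rightarrow> real" where
  "psi m h e t = fdiff m h (\<lambda>e. bubble p e t) e"

lemma psi_simps: "psi 0 h e t = bubble p e t" "psi (Suc m) h e t = psi m h e t - psi m h (e + h) t"
  by (simp_all add: psi_def)

lemma measurable_psi [measurable]: "psi m h e \<in> borel_measurable borel"
proof (induction m arbitrary: e)
  case 0
  then show ?case by (simp add: psi_simps cong: measurable_cong)
next
  case (Suc m)
  note Suc.IH [measurable]
  show ?case by (simp add: psi_simps cong: measurable_cong)
qed

text \<open>Only qualitative: \<open>B\<close> depends on \<open>e\<close> and \<open>h\<close> and
  serves to justify exchanges of integrals. The uniform control is the L1 bound in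
  \<open>psi_integral\<close>.\<close>

lemma psi_bounded:
  assumes "e > 0" "h > 0"
  obtains B where "\<And>t. t \<ge> 0 \<Longrightarrow> \<bar>psi m h e t\<bar> \<le> B"
  using assms(1)
proof (induction m arbitrary: e thesis)
  case 0
  show ?case
  proof (rule 0(1))
    fix t :: real assume "t \<ge> 0"
    then have "(e + t) powr (p - real d) \<le> e powr (p - real d)"
      using 0(2) p d2 by (intro powr_mono2') auto
    then show "\<bar>psi 0 h e t\<bar> \<le> (e\<^sup>2 + 4 * e) powr (real d / 2 - p) * e powr (p - real d)"
      by (simp add: psi_simps bubble_def mult_left_mono)
  qed
next
  case (Suc m)
  obtain B1 where B1: "\<And>t. t \<ge> 0 \<Longrightarrow> \<bar>psi m h e t\<bar> \<le> B1"
    using Suc.IH[OF _ Suc.prems(2)] by blast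
  obtain B2 where B2: "\<And>t. t \<ge> 0 \<Longrightarrow> \<bar>psi m h (e + h) t\<bar> \<le> B2"
    using Suc.IH[of "e + h"] Suc.prems(2) assms(2) by (metis add_pos_pos)
  show ?case
  proof (rule Suc.prems(1))
    fix t :: real assume "t \<ge> 0"
    show "\<bar>psi (Suc m) h e t\<bar> \<le> B1 + B2"
      using B1[OF \<open>t \<ge> 0\<close>] B2[OF \<open>t \<ge> 0\<close>] by (simp add: psi_simps)
  qed
qed

text \<open>All parts follow from the bubble by linearity. Each difference doubles the number of
  bubbles, which gives the factor 2^m; the L1 bound sees \<open>e\<close> and \<open>h\<close> only
  through the upper end \<open>E\<close> of the parameters.\<close>

lemma psi_integral:
  fixes y :: 'a
  assumes y: "norm y = 1" and e: "e > 0" and h: "h > 0"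
  shows "integrable sph (\<lambda>x. psi m h e (sqd y x))"
    and "(\<integral>x. psi m h e (sqd y x) \<partial>sph) = (\<integral>x. fdiff m h (\<lambda>x. x powr (- p)) (e + sqd pole x) \<partial>sph)"
    and "integrable sph (\<lambda>x. fdiff m h (\<lambda>x. x powr (- p)) (e + sqd pole x))"
    and "e + real m * h \<le> E \<Longrightarrow> (\<integral>x. \<bar>psi m h e (sqd y x)\<bar> \<partial>sph) \<le> 2 ^ m * (rmean p + (E + 4) powr \<bar>p\<bar>)"
proof -
  have "integrable sph (\<lambda>x. psi m h e (sqd y x)) \<and>
     (\<integral>x. psi m h e (sqd y x) \<partial>sph) = (\<integral>x. fdiff m h (\<lambda>x. x powr (- p)) (e + sqd pole x) \<partial>sph) \<and>
     integrable sph (\<lambda>x. fdiff m h (\<lambda>x. x powr (- p)) (e + sqd pole x)) \<and>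
     (e + real m * h \<le> E \<longrightarrow> (\<integral>x. \<bar>psi m h e (sqd y x)\<bar> \<partial>sph) \<le> 2 ^ m * (rmean p + (E + 4) powr \<bar>p\<bar>))"
    using e
  proof (induction m arbitrary: e)
    case 0
    have "(\<integral>\<^sup>+x. ennreal ((e + sqd pole x) powr (- p)) \<partial>sph) < \<infinity>"
      using bubble_mean_le[OF 0 order_refl] unfolding bubble_mean[OF 0] smean_def
      by (rule order_le_less_trans) simp
    then have "integrable sph (\<lambda>x. (e + sqd pole x) powr (- p))"
      by (intro integrableI_nonneg) auto
    then show ?case
      using bubble_integral[OF y 0] by (simp add: psi_simps bubble_nonneg)
  next
    case (Suc m)
    have eh: "e + h > 0" using Suc.prems h by simp
    note 1 = Suc.IH[OF Suc.prems] and 2 = Suc.IH[OF eh]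
    have sh: "fdiff (Suc m) h (\<lambda>x. x powr (- p)) (e + sqd pole x) = fdiff m h (\<lambda>x. x powr (- p)) (e + sqd pole x) - fdiff m h (\<lambda>x. x powr (- p)) (e + h + sqd pole x)" for x
      by (simp add: algebra_simps)
    have "(\<integral>x. \<bar>psi (Suc m) h e (sqd y x)\<bar> \<partial>sph) \<le> 2 ^ Suc m * (rmean p + (E + 4) powr \<bar>p\<bar>)" if "e + real (Suc m) * h \<le> E"
    proof -
      have le: "e + real m * h \<le> E" "e + h + real m * h \<le> E"
        using that h by (simp_all add: algebra_simps)
      have "(\<integral>x. \<bar>psi (Suc m) h e (sqd y x)\<bar> \<partial>sph) \<le> (\<integral>x. \<bar>psi m h e (sqd y x)\<bar> + \<bar>psi m h (e + h) (sqd y x)\<bar> \<partial>sph)"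
        using 1 2 by (intro integral_mono) (auto simp: psi_simps)
      also have "\<dots> = (\<integral>x. \<bar>psi m h e (sqd y x)\<bar> \<partial>sph) + (\<integral>x. \<bar>psi m h (e + h) (sqd y x)\<bar> \<partial>sph)"
        using 1 2 by (intro Bochner_Integration.integral_add) auto
      also have "\<dots> \<le> 2 ^ Suc m * (rmean p + (E + 4) powr \<bar>p\<bar>)"
        using 1 2 le by simp
      finally show ?thesis .
    qed
    then show ?case
      using 1 2 unfolding sh psi_simps(2) by simp
  qed
  then show "integrable sph (\<lambda>x. psi m h e (sqd y x))"
    "(\<integral>x. psi m h e (sqd y x) \<partial>sph) = (\<integral>x. fdiff m h (\<lambda>x. x powr (- p)) (e + sqd pole x) \<partial>sph)"
    "integrable sph (\<lambda>x. fdiff m h (\<lambda>x. x powr (- p)) (e + sqd pole x))"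
    "e + real m * h \<le> E \<Longrightarrow> (\<integral>x. \<bar>psi m h e (sqd y x)\<bar> \<partial>sph) \<le> 2 ^ m * (rmean p + (E + 4) powr \<bar>p\<bar>)"
    by auto
qed

lemma psi_kern_integral:
  fixes x z :: 'a
  assumes x: "norm x = 1" and z: "norm z = 1" and e: "e > 0" and h: "h > 0"
  shows "integrable sph (\<lambda>w. kern (2 * p) (sqd z w) * psi m h e (sqd x w)) \<and>
    (\<integral>w. kern (2 * p) (sqd z w) * psi m h e (sqd x w) \<partial>sph) = sgn p * rmean p * fdiff m h (\<lambda>x. x powr (- p)) (e + sqd x z)"
  using e
proof (induction m arbitrary: e)
  case 0
  then show ?case
    using bubble_kern_integral[OF x z] by (simp add: psi_simps)
next
  case (Suc m)
  have eh: "e + h > 0" using Suc.prems h by simp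
  note 1 = Suc.IH[OF Suc.prems] and 2 = Suc.IH[OF eh]
  have e: "e + sqd x z + h = e + h + sqd x z" by simp
  show ?case
    using 1 2 by (simp add: psi_simps right_diff_distrib e)
qed

end

end

section \<open>A positive spike, its mean and its tail\<close>

context unit_sphere
begin

context
  fixes p :: real
  assumes p: "- 1 < p" "p < real d / 2" "p \<noteq> 0"
begin

text \<open>Order d + 2 gives the spike the decay exponent p + d + 2, above d + 1 for every p > -1:
  it decays faster, by more than one power, than the conformal weight (h + t)^(-d) with which it is
  compared. The form \<open>Suc (d + 1)\<close> matches
  \<open>fdiff_powr_sgn_bounds\<close>.\<close>

definition diff_order :: nat where
  "diff_order = Suc (d + 1)"

text \<open>The potential of \<open>psi diff_order h h\<close> divided by \<open>rmean p\<close>: positive, and concentrated at scale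
  \<open>sqrt h\<close>.\<close>

definition spike :: "real \<Rightarrow> real \<Rightarrow> real" where
  "spike h t = sgn p * fdiff diff_order h (\<lambda>x. x powr (- p)) (h + t)"

definition spike_mean :: "real \<Rightarrow> real" where
  "spike_mean h = (\<integral>x. spike h (sqd pole x) \<partial>sph)"

definition decay :: real where
  "decay = p + real diff_order"

definition spike_coeff :: real where
  "spike_coeff = \<bar>p\<bar> * pochhammer (p + 1) (d + 1)"

lemma spike_coeff_pos: "spike_coeff > 0"
  unfolding spike_coeff_def using p by (intro mult_pos_pos pochhammer_pos) auto

lemma decay_ge: "decay \<ge> real d + 1"
  using p by (simp add: decay_def diff_order_def)

lemma spike_bounds:
  assumes h: "h > 0" and t: "t \<ge> 0"
  shows "spike_coeff * h ^ diff_order * ((real diff_order + 1) * h + t) powr (- decay) \<le> spike h t"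
    and "spike h t \<le> spike_coeff * h ^ diff_order * (h + t) powr (- decay)"
proof -
  have e: "h + t + real (Suc (d + 1)) * h = (real (Suc (d + 1)) + 1) * h + t"
    by (simp add: algebra_simps)
  show "spike_coeff * h ^ diff_order * ((real diff_order + 1) * h + t) powr (- decay) \<le> spike h t"
    and "spike h t \<le> spike_coeff * h ^ diff_order * (h + t) powr (- decay)"
    using fdiff_powr_sgn_bounds[OF h, of "h + t" p "d + 1"] h t p(1)
    unfolding e spike_def spike_coeff_def decay_def diff_order_def by auto
qed

lemma measurable_spike [measurable]: "spike h \<in> borel_measurable borel"
proof -
  have "fdiff m h (\<lambda>x. x powr (- p)) \<in> borel_measurable borel" for m
  proof (induction m)
    case 0
    then show ?case by (simp cong: measurable_cong)
  next
    case (Suc m)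
    note Suc.IH [measurable]
    show ?case by (simp cong: measurable_cong)
  qed
  note this [measurable]
  show ?thesis
    unfolding spike_def by measurable
qed

lemma spike_nonneg: "h > 0 \<Longrightarrow> t \<ge> 0 \<Longrightarrow> spike h t \<ge> 0"
  using spike_bounds(1)[of h t] spike_coeff_pos by (meson mult_nonneg_nonneg less_imp_le order_trans powr_ge_zero zero_le_power)

lemma spike_integral:
  fixes y :: 'a
  assumes y: "norm y = 1" and h: "h > 0"
  shows "integrable sph (\<lambda>x. spike h (sqd y x))"
    and "(\<integral>x. spike h (sqd y x) \<partial>sph) = spike_mean h"
    and "(\<integral>\<^sup>+x. ennreal (spike h (sqd y x)) \<partial>sph) = ennreal (spike_mean h)"
proof -
  have int: "integrable sph (\<lambda>x. spike h (sqd pole x))"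
    unfolding spike_def using psi_integral(3)[OF p y h h] by simp
  have nn: "(\<integral>\<^sup>+x. ennreal (spike h (sqd pole x)) \<partial>sph) = ennreal (spike_mean h)"
    unfolding spike_mean_def by (rule nn_integral_eq_integral[OF int]) (simp add: spike_nonneg h)
  show nny: "(\<integral>\<^sup>+x. ennreal (spike h (sqd y x)) \<partial>sph) = ennreal (spike_mean h)"
    unfolding nn[symmetric] using smean_eq[OF _ y, of "\<lambda>t. ennreal (spike h t)"] by (simp add: smean_def)
  show "integrable sph (\<lambda>x. spike h (sqd y x))"
    by (rule integrableI_nonneg) (simp_all add: nny spike_nonneg h)
  have "spike_mean h \<ge> 0"
    unfolding spike_mean_def by (rule integral_nonneg_AE) (simp add: spike_nonneg h)
  then show "(\<integral>x. spike h (sqd y x) \<partial>sph) = spike_mean h"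
    by (subst integral_eq_nn_integral) (simp_all add: nny spike_nonneg h)
qed

lemma spike_mean_nonneg: "h > 0 \<Longrightarrow> spike_mean h \<ge> 0"
  unfolding spike_mean_def by (rule integral_nonneg_AE) (simp add: spike_nonneg)

text \<open>The lower bound of the spike at t = 31 h, where (diff_order + 1) h + t = (diff_order +
  32) h, multiplied by the constant in \<open>cap_ge\<close>.\<close>

definition spike_lower :: real where
  "spike_lower = spike_coeff * (real diff_order + 32) powr (- decay) * (8 powr (- (real d / 2)) / 2)"

lemma spike_lower_pos: "spike_lower > 0"
  using spike_coeff_pos by (simp add: spike_lower_def)

lemma spike_scaling:
  assumes h: "h > 0"
  shows "h ^ diff_order * h powr (- decay) * h powr (real d / 2) = h powr (real d / 2 - p)"
proof -
  have "h ^ diff_order = h powr real diff_order"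
    using h by (simp add: powr_realpow)
  then have "h ^ diff_order * h powr (- decay) * h powr (real d / 2) = h powr (real diff_order + - decay + real d / 2)"
    by (simp only: powr_add)
  also have "real diff_order + - decay + real d / 2 = real d / 2 - p"
    by (simp add: decay_def)
  finally show ?thesis .
qed

text \<open>Only the cap t <= 31 h is kept; there the spike is at least its lower bound at the rim,
  and the cap has measure at least of order h^(d/2).\<close>

lemma spike_mean_ge:
  assumes h: "0 < h" "h \<le> 4"
  shows "spike_lower * h powr (real d / 2 - p) \<le> spike_mean h"
proof -
  let ?a = "spike_coeff * h ^ diff_order * ((real diff_order + 32) * h) powr (- decay)"
  have a: "?a \<ge> 0"
    using spike_coeff_pos h by simp
  have "ennreal ?a * ennreal (8 powr (- (real d / 2)) / 2 * h powr (real d / 2)) \<le> ennreal ?a * smean (indicator {..31 * h})"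
    by (intro mult_left_mono cap_ge h) auto
  also have "\<dots> = smean (\<lambda>t. ennreal ?a * indicator {..31 * h} t)"
    by (rule smean_cmult[symmetric]) measurable
  also have "\<dots> \<le> smean (\<lambda>t. ennreal (spike h t))"
  proof (rule smean_mono)
    fix t :: real assume t: "0 \<le> t" "t \<le> 4"
    show "ennreal ?a * indicator {..31 * h} t \<le> ennreal (spike h t)"
    proof (cases "t \<le> 31 * h")
      case True
      have "((real diff_order + 32) * h) powr (- decay) \<le> ((real diff_order + 1) * h + t) powr (- decay)"
        using True t h decay_ge by (intro powr_mono2') (auto simp: algebra_simps add_pos_nonneg)
      then have "?a \<le> spike_coeff * h ^ diff_order * ((real diff_order + 1) * h + t) powr (- decay)"
        using spike_coeff_pos h by (intro mult_left_mono) auto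
      also have "\<dots> \<le> spike h t"
        by (rule spike_bounds(1)[OF h(1) t(1)])
      finally show ?thesis
        using True by (simp add: ennreal_leI)
    qed simp
  qed
  also have "\<dots> = ennreal (spike_mean h)"
    unfolding smean_def by (rule spike_integral(3)[OF pole h(1)])
  finally have "?a * (8 powr (- (real d / 2)) / 2 * h powr (real d / 2)) \<le> spike_mean h"
    using a spike_mean_nonneg[OF h(1)] by (simp add: ennreal_mult[symmetric])
  moreover have "?a * (8 powr (- (real d / 2)) / 2 * h powr (real d / 2)) = spike_lower * h powr (real d / 2 - p)"
  proof -
    have "((real diff_order + 32) * h) powr (- decay) = (real diff_order + 32) powr (- decay) * h powr (- decay)"
      by (rule powr_mult)
    then show ?thesis
      unfolding spike_lower_def spike_scaling[OF h(1), symmetric] by (simp only: mult_ac)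
  qed
  ultimately show ?thesis by simp
qed

text \<open>Of the decay, the power d is kept for the conformal weight, whose mean is known; the
  surplus decay - d >= 1, evaluated beyond L h, gives the factor 1 / L. A large L thus makes the
  tail a small fraction of the mean, uniformly in h.\<close>

lemma spike_tail:
  assumes h: "h > 0" and L: "L \<ge> 1"
  shows "smean (\<lambda>t. ennreal (spike h t) * indicator {L * h<..} t) \<le> ennreal (spike_coeff * 4 powr (- (real d / 2)) / L * h powr (real d / 2 - p))"
proof -
  let ?a = "spike_coeff * h ^ diff_order * (L * h) powr (real d - decay)"
  have a: "?a \<ge> 0"
    using spike_coeff_pos h by simp
  have "smean (\<lambda>t. ennreal (spike h t) * indicator {L * h<..} t) \<le> smean (\<lambda>t. ennreal ?a * ennreal ((h + t) powr (- real d)))"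
  proof (rule smean_mono)
    fix t :: real assume t: "0 \<le> t" "t \<le> 4"
    show "ennreal (spike h t) * indicator {L * h<..} t \<le> ennreal ?a * ennreal ((h + t) powr (- real d))"
    proof (cases "t > L * h")
      case True
      have "spike h t \<le> spike_coeff * h ^ diff_order * (h + t) powr (- decay)"
        by (rule spike_bounds(2)[OF h t(1)])
      also have "(h + t) powr (- decay) = (h + t) powr (real d - decay) * (h + t) powr (- real d)"
        by (simp flip: powr_add)
      also have "\<dots> \<le> (L * h) powr (real d - decay) * (h + t) powr (- real d)"
        using True h L t decay_ge by (intro mult_right_mono powr_mono2') auto
      finally have "spike h t \<le> ?a * (h + t) powr (- real d)"
        using spike_coeff_pos h by (simp add: mult.assoc mult_left_mono)
      then show ?thesis
        using True a by (simp add: ennreal_mult[symmetric] ennreal_leI)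
    qed simp
  qed
  also have "\<dots> = ennreal ?a * smean (\<lambda>t. ennreal ((h + t) powr (- real d)))"
    by (rule smean_cmult) measurable
  also have "\<dots> \<le> ennreal ?a * ennreal ((4 * h) powr (- (real d / 2)))"
    by (intro mult_left_mono smean_conformal_le h) auto
  also have "\<dots> = ennreal (?a * (4 * h) powr (- (real d / 2)))"
    using a by (simp add: ennreal_mult)
  also have "\<dots> \<le> ennreal (spike_coeff * 4 powr (- (real d / 2)) / L * h powr (real d / 2 - p))"
  proof (rule ennreal_leI)
    have hh: "h powr (real d - decay) * h powr (- (real d / 2)) = h powr (- decay) * h powr (real d / 2)"
      unfolding powr_add[symmetric] by (rule arg_cong[where f = "(powr) h"]) simp
    have "?a * (4 * h) powr (- (real d / 2)) =
        spike_coeff * h ^ diff_order * (L powr (real d - decay) * h powr (real d - decay)) * (4 powr (- (real d / 2)) * h powr (- (real d / 2)))"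
      by (simp only: powr_mult)
    also have "\<dots> = spike_coeff * 4 powr (- (real d / 2)) * L powr (real d - decay) * (h ^ diff_order * (h powr (real d - decay) * h powr (- (real d / 2))))"
      by (simp only: mult_ac)
    also have "\<dots> = spike_coeff * 4 powr (- (real d / 2)) * L powr (real d - decay) * h powr (real d / 2 - p)"
      unfolding hh spike_scaling[OF h, symmetric] by (simp only: mult_ac)
    also have "\<dots> \<le> spike_coeff * 4 powr (- (real d / 2)) * L powr (- 1) * h powr (real d / 2 - p)"
      using L decay_ge spike_coeff_pos by (intro mult_right_mono mult_left_mono powr_mono) auto
    also have "L powr (- 1) = 1 / L"
      using L by (simp add: powr_neg_one)
    finally show "?a * (4 * h) powr (- (real d / 2)) \<le> spike_coeff * 4 powr (- (real d / 2)) / L * h powr (real d / 2 - p)"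
      by (simp only: times_divide_eq_right mult_1_right)
  qed
  finally show ?thesis .
qed

text \<open>\<open>g\<close> may be unbounded, as the kernel is, but \<open>psi\<close> is bounded
  for fixed \<open>h\<close>; the integrand is therefore dominated by a multiple of |g y|,
  integrable on the product of two probability spaces.\<close>

lemma psi_Fubini:
  fixes g :: "'a \<Rightarrow> real"
  assumes g: "integrable sph g" and [measurable]: "G \<in> sets borel" and h: "h > 0"
  shows "integrable sph (\<lambda>y. g y * (\<integral>x. indicator G x * psi p m h h (sqd x y) \<partial>sph))"
    and "(\<integral>y. g y * (\<integral>x. indicator G x * psi p m h h (sqd x y) \<partial>sph) \<partial>sph) =
      (\<integral>x. indicator G x * (\<integral>y. g y * psi p m h h (sqd x y) \<partial>sph) \<partial>sph)"
proof -
  interpret pair_sigma_finite "sph :: 'a measure" "sph :: 'a measure" ..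
  have [measurable]: "g \<in> borel_measurable borel"
    using borel_measurable_integrable[OF g] by simp
  note measurable_psi[OF p, measurable]
  obtain B where B: "\<And>t. t \<ge> 0 \<Longrightarrow> \<bar>psi p m h h t\<bar> \<le> B"
    using psi_bounded[OF p h h] by blast
  define f where "f x y = indicator G x * (g y * psi p m h h (sqd x y))" for x y
  have [measurable]: "case_prod f \<in> borel_measurable (borel \<Otimes>\<^sub>M borel)"
    unfolding f_def by measurable
  have B0: "B \<ge> 0"
    using B[of 0] by auto
  have bd: "\<bar>f x y\<bar> \<le> B * \<bar>g y\<bar>" for x y
    using mult_mono[OF order_refl[of "\<bar>g y\<bar>"] B[of "sqd x y"]] B0 
    by (auto simp: f_def indicator_def abs_mult mult.commute)
  have intf: "integrable (sph \<Otimes>\<^sub>M sph) (case_prod f)"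
  proof (rule Bochner_Integration.integrable_bound)
    show "integrable (sph \<Otimes>\<^sub>M sph) (\<lambda>(x :: 'a, y :: 'a). B * \<bar>g y\<bar>)"
    proof (rule Fubini_integrable)
      show "integrable sph (\<lambda>x :: 'a. \<integral>y. norm (case (x, y) of (x, y) \<Rightarrow> B * \<bar>g y\<bar>) \<partial>sph)"
        by simp
      show "AE x in (sph :: 'a measure). integrable sph (\<lambda>y. case (x, y) of (x, y) \<Rightarrow> B * \<bar>g y\<bar>)"
        using g by simp
    qed measurable
    show "AE z in sph \<Otimes>\<^sub>M sph. norm (case_prod f z) \<le> norm (case z of (x, y) \<Rightarrow> B * \<bar>g y\<bar>)"
      using bd B0 by (auto simp: split_beta abs_mult)
  qed measurable
  have e1: "(\<integral>x. f x y \<partial>sph) = g y * (\<integral>x. indicator G x * psi p m h h (sqd x y) \<partial>sph)" for y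
    unfolding f_def by (subst integral_mult_right_zero[symmetric]) (simp add: mult_ac)
  have e2: "(\<integral>y. f x y \<partial>sph) = indicator G x * (\<integral>y. g y * psi p m h h (sqd x y) \<partial>sph)" for x
    unfolding f_def by (rule integral_mult_right_zero)
  show "integrable sph (\<lambda>y. g y * (\<integral>x. indicator G x * psi p m h h (sqd x y) \<partial>sph))"
    using integrable_snd[OF intf] unfolding e1 .
  show "(\<integral>y. g y * (\<integral>x. indicator G x * psi p m h h (sqd x y) \<partial>sph) \<partial>sph) =
      (\<integral>x. indicator G x * (\<integral>y. g y * psi p m h h (sqd x y) \<partial>sph) \<partial>sph)"
    using Fubini_integral[OF intf] unfolding e1 e2 .
qed

end

end

section \<open>Bounds for the minimum of a potential\<close>

context unit_sphere
begin

lemma kern_integral: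
  fixes z :: 'a
  assumes s: "- 2 < s" "s < real d" and z: "norm z = 1"
  shows "integrable sph (\<lambda>w. kern s (sqd z w))" "(\<integral>w. kern s (sqd z w) \<partial>sph) = kmean s"
proof -
  have nn: "(\<integral>\<^sup>+w. ennreal (kern s (sqd z w) - kern s 4) \<partial>sph) = ennreal (kmean s - kern s 4)"
    unfolding kmean_eq(2)[OF s, symmetric] by (rule smean_eq[OF _ z]) measurable
  have ae: "AE w in sph. 0 \<le> kern s (sqd z w) - kern s 4"
    using AE_sph_ne[OF z] AE_sph_norm
  proof eventually_elim
    case (elim w)
    then show ?case
      using sqd_le_4[OF z, of w] by (auto intro!: kern_antimono)
  qed
  have int: "integrable sph (\<lambda>w. kern s (sqd z w) - kern s 4)"
    by (rule integrableI_nonneg) (use ae nn in auto)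
  from Bochner_Integration.integrable_add[OF int, of "\<lambda>_. kern s 4"]
  show i: "integrable sph (\<lambda>w. kern s (sqd z w))"
    by simp
  have "(\<integral>w. kern s (sqd z w) - kern s 4 \<partial>sph) = kmean s - kern s 4"
    using kmean_eq(3)[OF s] by (subst integral_eq_nn_integral[OF _ ae]) (auto simp: nn)
  then show "(\<integral>w. kern s (sqd z w) \<partial>sph) = kmean s"
    using i by (simp add: sph.prob_space[simplified])
qed

text \<open>A minimum is at most the average, and this is all the case s = 0 requires. The
  hypothesis is stated almost everywhere because for s >= 0 the default \<open>kern s 0 = 0\<close>
  differs from the true value at coincident points.\<close>

lemma potential_min_le_mean:
  fixes x :: "nat \<Rightarrow> 'a"
  assumes s: "- 2 < s" "s < real d" and x: "\<And>i. i \<in> A \<Longrightarrow> norm (x i) = 1"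
    and m: "AE y in sph. m \<le> (\<Sum>i\<in>A. kern s (sqd (x i) y))"
  shows "m \<le> real (card A) * kmean s"
proof -
  have "(\<integral>y. m \<partial>(sph :: 'a measure)) \<le> (\<integral>y. (\<Sum>i\<in>A. kern s (sqd (x i) y)) \<partial>sph)"
    by (rule integral_mono_AE) (use m kern_integral(1)[OF s x] in auto)
  also have "\<dots> = (\<Sum>i\<in>A. \<integral>y. kern s (sqd (x i) y) \<partial>sph)"
    by (rule Bochner_Integration.integral_sum) (rule kern_integral(1)[OF s x])
  also have "\<dots> = real (card A) * kmean s"
    using kern_integral(2)[OF s x] by simp
  finally show ?thesis
    by (simp add: sph.prob_space[simplified])
qed

text \<open>A union bound: the caps of squared radius \<open>r\<close> about the points have total
  measure at most 1/2.\<close>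

lemma cap_avoidance:
  fixes x :: "nat \<Rightarrow> 'a"
  assumes A: "finite A" "\<And>i. i \<in> A \<Longrightarrow> norm (x i) = 1" and r: "r > 0" "real (card A) * r powr (real d / 2) \<le> 1 / 2"
  defines "G \<equiv> {y. \<forall>i\<in>A. r < sqd (x i) y}"
  shows "G \<in> sets borel" "measure sph G \<ge> 1 / 2"
proof -
  let ?D = "\<lambda>i. {y. sqd (x i) y \<le> r}"
  have Dm: "?D i \<in> sets borel" for i
    by measurable
  have G: "G = UNIV - (\<Union>i\<in>A. ?D i)"
    by (auto simp: G_def not_le)
  have Um: "(\<Union>i\<in>A. ?D i) \<in> sets borel"
    using A(1) Dm by (intro sets.finite_UN) auto
  show "G \<in> sets borel"
    unfolding G by (intro sets.Diff Um) simp
  have "measure sph (?D i) \<le> r powr (real d / 2)" if "i \<in> A" for i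
  proof -
    have "emeasure sph (?D i) = (\<integral>\<^sup>+w. indicator (?D i) w \<partial>sph)"
      using Dm[of i] by (intro nn_integral_indicator[symmetric]) simp
    also have "\<dots> = (\<integral>\<^sup>+w. indicator {..r} (sqd (x i) w) \<partial>sph)"
      by (simp add: indicator_def)
    also have "\<dots> = smean (indicator {..r})"
      by (rule smean_eq[OF _ A(2)[OF that]]) measurable
    also have "\<dots> \<le> ennreal (r powr (real d / 2))"
      by (rule cap_le[OF r(1)])
    finally show ?thesis
      by (simp add: sph.emeasure_eq_measure)
  qed
  then have "measure sph (\<Union>i\<in>A. ?D i) \<le> (\<Sum>i\<in>A. r powr (real d / 2))"
    using A(1) Dm by (intro order_trans[OF sph.finite_measure_subadditive_finite] sum_mono) auto
  also have "\<dots> \<le> 1 / 2"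
    using r(2) by simp
  finally have "measure sph (\<Union>i\<in>A. ?D i) \<le> 1 / 2" .
  moreover have "measure sph G = 1 - measure sph (\<Union>i\<in>A. ?D i)"
    unfolding G using sph.prob_compl[of "\<Union>i\<in>A. ?D i"] Um by simp
  ultimately show "measure sph G \<ge> 1 / 2" by simp
qed

text \<open>The function \<open>H + C\<close> is nonnegative, so integrating the potential against it preserves the
  lower bound \<open>m\<close>; the bumps in \<open>H\<close> contribute much less than average to the left-hand side, as their
  centres lie in the set \<open>G\<close> away from the points.\<close>

lemma polarization_step:
  fixes x :: "nat \<Rightarrow> 'a"
  assumes p: "- 1 < p" "p < real d / 2" "p \<noteq> 0"
    and A: "finite A" "\<And>i. i \<in> A \<Longrightarrow> norm (x i) = 1"
    and m: "AE y in sph. m \<le> (\<Sum>i\<in>A. kern (2 * p) (sqd (x i) y))"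
    and h: "0 < h" "h \<le> 1" and L: "L \<ge> 1" "4 * (spike_coeff p * 4 powr (- (real d / 2)) / L) \<le> spike_lower p"
    and card: "real (card A) * (L * h) powr (real d / 2) \<le> 1 / 2"
  defines "C \<equiv> 2 ^ diff_order * (rmean p + (real diff_order + 5) powr \<bar>p\<bar>) + 1"
  shows "m \<le> real (card A) * kmean (2 * p) - real (card A) * rmean p * spike_mean p h / (8 * C)"
proof -
  let ?n = "real (card A)" and ?R = "rmean p" and ?T = "spike_mean p h" and ?sg = "sgn p"
  let ?\<psi> = "psi p diff_order h h"
  note measurable_psi[OF p, measurable] measurable_spike[OF p, measurable]
  have s: "- 2 < 2 * p" "2 * p < real d" using p by auto
  have R: "?R > 0" by (rule rmean_pos[OF p])
  have T: "?T \<ge> 0" by (rule spike_mean_nonneg[OF p h(1)])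
  have C1: "C \<ge> 1" using R by (simp add: C_def)
  have sg2: "?sg * ?sg = 1" using p by (simp add: sgn_if)
  have k: "kmean (2 * p) = ?sg * ?R" by (rule kmean_eq_rmean[OF p])
  have Lh: "L * h > 0" using L h by simp
  define G where "G = {y. \<forall>i\<in>A. L * h < sqd (x i) y}"
  have Gm [measurable]: "G \<in> sets borel" and Gm2: "measure sph G \<ge> 1 / 2"
    using cap_avoidance[OF A Lh card] unfolding G_def by auto
  \<comment> \<open>The densities \<open>psi\<close> averaged over centres in G. For fixed y the
    integral of |psi| over x is an L1 norm, so H is bounded uniformly in h although psi itself can
    be large. C exceeds this bound by 1, so that H + C >= 1 on the sphere.\<close>
  define H where "H y = (\<integral>x. indicator G x * ?\<psi> (sqd x y) \<partial>sph)" for y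
  have Hb: "\<bar>H y\<bar> \<le> C - 1" if y: "norm y = 1" for y
  proof -
    have i: "integrable sph (\<lambda>x. ?\<psi> (sqd x y))"
      using psi_integral(1)[OF p y h(1) h(1)] by (simp add: sqd_commute)
    have "\<bar>H y\<bar> \<le> (\<integral>x. \<bar>indicator G x * ?\<psi> (sqd x y)\<bar> \<partial>sph)"
      unfolding H_def by (rule integral_abs_bound)
    also have "\<dots> \<le> (\<integral>x. \<bar>?\<psi> (sqd y x)\<bar> \<partial>sph)"
      using i by (intro integral_mono integrable_abs Bochner_Integration.integrable_bound[OF i])
         (auto simp: sqd_commute indicator_def)
    also have "\<dots> \<le> 2 ^ diff_order * (?R + (real diff_order + 1 + 4) powr \<bar>p\<bar>)"
    proof (rule psi_integral(4)[OF p y h(1) h(1)])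
      have "real diff_order * h \<le> real diff_order * 1"
        using h by (intro mult_left_mono) auto
      then show "h + real diff_order * h \<le> real diff_order + 1"
        using h by simp
    qed
    finally show ?thesis
      by (simp add: C_def add.assoc)
  qed
  have Hi: "integrable sph H"
    using psi_Fubini(1)[OF p _ Gm h(1), of "\<lambda>_. 1" diff_order] by (simp add: H_def[abs_def])
  have HI: "(\<integral>y. H y \<partial>sph) = measure sph G * (?sg * ?T)"
  proof -
    have "(\<integral>y. H y \<partial>sph) = (\<integral>x. indicator G x * (\<integral>y. 1 * ?\<psi> (sqd x y) \<partial>sph) \<partial>sph)"
      using psi_Fubini(2)[OF p _ Gm h(1), of "\<lambda>_. 1" diff_order] by (simp add: H_def)
    also have "\<dots> = (\<integral>x. indicator G x * (?sg * ?T) \<partial>sph)"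
    proof (rule integral_cong_AE)
      show "AE x in sph. indicator G x * (\<integral>y. 1 * ?\<psi> (sqd x y) \<partial>sph) = indicator G x * (?sg * ?T)"
        using AE_sph_norm
      proof eventually_elim
        case (elim x)
        have "?T = ?sg * (\<integral>x. fdiff diff_order h (\<lambda>x. x powr (- p)) (h + sqd pole x) \<partial>sph)"
          by (simp add: spike_mean_def[OF p] spike_def[OF p])
        then have "?sg * ?T = (\<integral>x. fdiff diff_order h (\<lambda>x. x powr (- p)) (h + sqd pole x) \<partial>sph)"
          by (simp only: mult.assoc[symmetric] sg2 mult_1_left)
        then show ?case
          using psi_integral(2)[OF p elim h(1) h(1), of diff_order] by simp
      qed
    qed measurable
    also have "\<dots> = measure sph G * (?sg * ?T)"
      by simp
    finally show ?thesis .
  qed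
  \<comment> \<open>The potential of H at \<open>x i\<close> is \<open>rmean p\<close> times the
    integral over G of the spike about \<open>x i\<close>. On G the squared distance exceeds L h, so
    only the tail of the spike counts, and the condition on L makes it at most a quarter of the
    mean.\<close>
  have KH: "integrable sph (\<lambda>y. kern (2 * p) (sqd (x i) y) * H y)"
    "(\<integral>y. kern (2 * p) (sqd (x i) y) * H y \<partial>sph) \<le> ?R * ?T / 4" if i: "i \<in> A" for i
  proof -
    note z = A(2)[OF i]
    note ki = kern_integral(1)[OF s z]
    show "integrable sph (\<lambda>y. kern (2 * p) (sqd (x i) y) * H y)"
      using psi_Fubini(1)[OF p ki Gm h(1), of diff_order] by (simp add: H_def)
    have "(\<integral>y. kern (2 * p) (sqd (x i) y) * H y \<partial>sph) = (\<integral>w. indicator G w * (\<integral>y. kern (2 * p) (sqd (x i) y) * ?\<psi> (sqd w y) \<partial>sph) \<partial>sph)"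
      unfolding H_def by (rule psi_Fubini(2)[OF p ki Gm h(1)])
    also have "\<dots> = (\<integral>w. indicator G w * (?R * spike p h (sqd (x i) w)) \<partial>sph)"
    proof (rule integral_cong_AE)
      show "AE w in sph. indicator G w * (\<integral>y. kern (2 * p) (sqd (x i) y) * ?\<psi> (sqd w y) \<partial>sph) = indicator G w * (?R * spike p h (sqd (x i) w))"
        using AE_sph_norm
      proof eventually_elim
        case (elim w)
        show ?case
          using psi_kern_integral[OF p elim z h(1) h(1), of diff_order] by (simp add: spike_def[OF p] sqd_commute[of "x i" w])
      qed
    qed measurable
    also have "\<dots> \<le> ?R * (\<integral>w. spike p h (sqd (x i) w) * indicator {L * h<..} (sqd (x i) w) \<partial>sph)"
    proof -
      have si: "integrable sph (\<lambda>w. spike p h (sqd (x i) w))"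
        by (rule spike_integral(1)[OF p z h(1)])
      have "(\<integral>w. indicator G w * (?R * spike p h (sqd (x i) w)) \<partial>sph) \<le> (\<integral>w. ?R * (spike p h (sqd (x i) w) * indicator {L * h<..} (sqd (x i) w)) \<partial>sph)"
      proof (rule integral_mono)
        show "integrable sph (\<lambda>w. indicator G w * (?R * spike p h (sqd (x i) w)))"
          using R by (intro Bochner_Integration.integrable_bound[OF integrable_mult_right[OF si, of ?R]]) (auto simp: indicator_def)
        show "integrable sph (\<lambda>w. ?R * (spike p h (sqd (x i) w) * indicator {L * h<..} (sqd (x i) w)))"
          using R by (intro Bochner_Integration.integrable_bound[OF integrable_mult_right[OF si, of ?R]]) (auto simp: indicator_def)
        show "indicator G w * (?R * spike p h (sqd (x i) w)) \<le> ?R * (spike p h (sqd (x i) w) * indicator {L * h<..} (sqd (x i) w))" for w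
          using R i spike_nonneg[OF p h(1), of "sqd (x i) w"] by (auto simp: G_def indicator_def)
      qed
      then show ?thesis by simp
    qed
    also have "\<dots> \<le> ?R * (?T / 4)"
    proof (rule mult_left_mono)
      have "(\<integral>\<^sup>+w. ennreal (spike p h (sqd (x i) w) * indicator {L * h<..} (sqd (x i) w)) \<partial>sph) =
          (\<integral>\<^sup>+w. ennreal (spike p h (sqd (x i) w)) * indicator {L * h<..} (sqd (x i) w) \<partial>sph)"
        by (intro nn_integral_cong) (simp add: indicator_def)
      also have "\<dots> = smean (\<lambda>t. ennreal (spike p h t) * indicator {L * h<..} t)"
        by (rule smean_eq[OF _ z]) measurable
      also have "\<dots> \<le> ennreal (spike_coeff p * 4 powr (- (real d / 2)) / L * h powr (real d / 2 - p))"
        by (rule spike_tail[OF p h(1) L(1)])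
      also have "\<dots> \<le> ennreal (?T / 4)"
      proof (rule ennreal_leI)
        have "4 * (spike_coeff p * 4 powr (- (real d / 2)) / L) * h powr (real d / 2 - p) \<le> spike_lower p * h powr (real d / 2 - p)"
          by (intro mult_right_mono L(2)) auto
        also have "\<dots> \<le> ?T"
          using h by (intro spike_mean_ge[OF p]) auto
        finally show "spike_coeff p * 4 powr (- (real d / 2)) / L * h powr (real d / 2 - p) \<le> ?T / 4"
          by (simp add: mult_ac)
      qed
      finally have nn: "(\<integral>\<^sup>+w. ennreal (spike p h (sqd (x i) w) * indicator {L * h<..} (sqd (x i) w)) \<partial>sph) \<le> ennreal (?T / 4)" .
      have "(\<integral>w. spike p h (sqd (x i) w) * indicator {L * h<..} (sqd (x i) w) \<partial>sph) =
          enn2real (\<integral>\<^sup>+w. ennreal (spike p h (sqd (x i) w) * indicator {L * h<..} (sqd (x i) w)) \<partial>sph)"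
      proof (rule integral_eq_nn_integral)
        show "AE w in sph. 0 \<le> spike p h (sqd (x i) w) * indicator {L * h<..} (sqd (x i) w)"
          by (intro AE_I2 mult_nonneg_nonneg spike_nonneg[OF p h(1)]) auto
      qed measurable
      also have "\<dots> \<le> ?T / 4"
        by (rule enn2real_leI[OF _ nn]) (use T in simp)
      finally show "(\<integral>w. spike p h (sqd (x i) w) * indicator {L * h<..} (sqd (x i) w) \<partial>sph) \<le> ?T / 4" .
    qed (use R in simp)
    finally show "(\<integral>y. kern (2 * p) (sqd (x i) y) * H y \<partial>sph) \<le> ?R * ?T / 4"
      by simp
  qed
  let ?U = "\<lambda>y. \<Sum>i\<in>A. kern (2 * p) (sqd (x i) y)"
  have ki: "integrable sph (\<lambda>y. kern (2 * p) (sqd (x i) y))" if "i \<in> A" for i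
    using kern_integral(1)[OF s A(2)[OF that]] .
  have UH: "?U y * (H y + C) = (\<Sum>i\<in>A. kern (2 * p) (sqd (x i) y) * H y) + (\<Sum>i\<in>A. C * kern (2 * p) (sqd (x i) y))" for y
    unfolding sum_distrib_right sum.distrib[symmetric] by (intro sum.cong) (simp_all add: algebra_simps)
  have iUH: "integrable sph (\<lambda>y. ?U y * (H y + C))"
    unfolding UH using KH(1) ki by (intro Bochner_Integration.integrable_add Bochner_Integration.integrable_sum integrable_mult_right) auto
  have "(\<integral>y. m * (H y + C) \<partial>sph) \<le> (\<integral>y. ?U y * (H y + C) \<partial>sph)"
  proof (rule integral_mono_AE[OF _ iUH])
    show "integrable sph (\<lambda>y. m * (H y + C))"
      using Hi by simp
    show "AE y in sph. m * (H y + C) \<le> ?U y * (H y + C)"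
      using m AE_sph_norm
    proof eventually_elim
      case (elim y)
      then show ?case
        using Hb[of y] by (intro mult_right_mono) auto
    qed
  qed
  also have "\<dots> = (\<integral>y. (\<Sum>i\<in>A. kern (2 * p) (sqd (x i) y) * H y) \<partial>sph) + (\<integral>y. (\<Sum>i\<in>A. C * kern (2 * p) (sqd (x i) y)) \<partial>sph)"
    unfolding UH using KH(1) ki by (intro Bochner_Integration.integral_add Bochner_Integration.integrable_sum integrable_mult_right) auto
  also have "(\<integral>y. (\<Sum>i\<in>A. kern (2 * p) (sqd (x i) y) * H y) \<partial>sph) = (\<Sum>i\<in>A. \<integral>y. kern (2 * p) (sqd (x i) y) * H y \<partial>sph)"
    using KH(1) by (intro Bochner_Integration.integral_sum) auto
  also have "\<dots> \<le> (\<Sum>i\<in>A. ?R * ?T / 4)"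
    by (intro sum_mono KH(2))
  also have "(\<integral>y. (\<Sum>i\<in>A. C * kern (2 * p) (sqd (x i) y)) \<partial>sph) = (\<Sum>i\<in>A. \<integral>y. C * kern (2 * p) (sqd (x i) y) \<partial>sph)"
    using ki by (intro Bochner_Integration.integral_sum integrable_mult_right) auto
  also have "\<dots> = (\<Sum>i\<in>A. C * kmean (2 * p))"
    using kern_integral(2)[OF s A(2)] by (intro sum.cong) auto
  finally have main: "(\<integral>y. m * (H y + C) \<partial>sph) \<le> ?n * (?R * ?T / 4) + ?n * (C * kmean (2 * p))"
    by simp
  \<comment> \<open>The total mass of H + C; the bound |H| <= C - 1 confines it between 1 and 2
    C.\<close>
  define P where "P = measure sph G * (?sg * ?T) + C"
  have PI: "(\<integral>y. H y + C \<partial>sph) = P"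
    unfolding P_def HI[symmetric] using Hi by (simp add: sph.prob_space[simplified])
  have P1: "1 \<le> P" "P \<le> 2 * C"
  proof -
    have "(\<integral>y. 1 \<partial>(sph :: 'a measure)) \<le> (\<integral>y. H y + C \<partial>sph)"
    proof (rule integral_mono_AE)
      show "AE y in sph. 1 \<le> H y + C"
        using AE_sph_norm by eventually_elim (use Hb in \<open>force simp: abs_le_iff\<close>)
    qed (use Hi in auto)
    then show "1 \<le> P" unfolding PI by (simp add: sph.prob_space[simplified])
    have "(\<integral>y. H y + C \<partial>sph) \<le> (\<integral>y. 2 * C \<partial>(sph :: 'a measure))"
    proof (rule integral_mono_AE)
      show "AE y in sph. H y + C \<le> 2 * C"
        using AE_sph_norm by eventually_elim (use Hb in \<open>force simp: abs_le_iff\<close>)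
    qed (use Hi in auto)
    then show "P \<le> 2 * C" unfolding PI by (simp add: sph.prob_space[simplified])
  qed
  \<comment> \<open>Since kmean (2 p) = sgn p * rmean p, the mean value n kmean (2 p) paired with H
    gives n R T times the measure of G, at least n R T / 2 for either sign of p. The actual
    contribution of H is at most n R T / 4, and the difference is the gain.\<close>
  have "m * P \<le> ?n * (?R * ?T / 4) + ?n * (C * kmean (2 * p))"
    using main unfolding PI[symmetric] by simp
  moreover have "?n * kmean (2 * p) * P = (?sg * ?sg) * (?n * ?R * ?T * measure sph G) + ?n * (C * kmean (2 * p))"
    unfolding P_def k by (simp only: distrib_left mult_ac)
  moreover have "?n * ?R * ?T * (1 / 2) \<le> ?n * ?R * ?T * measure sph G"
    using R T by (intro mult_left_mono Gm2) auto
  ultimately have le: "(m - ?n * kmean (2 * p)) * P \<le> - (?n * ?R * ?T / 4)"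
    using sg2 by (simp add: left_diff_distrib)
  \<comment> \<open>As P <= 2 C, w P is at most the gain n R T / 4; dividing by P thus costs only a
    constant.\<close>
  define w where "w = ?n * ?R * ?T / (8 * C)"
  have w: "w \<ge> 0" using R T C1 by (simp add: w_def)
  have wC: "w * (2 * C) = ?n * ?R * ?T / 4"
    using C1 by (simp add: w_def field_simps)
  have "m - ?n * kmean (2 * p) \<le> - w"
  proof (rule ccontr)
    assume "\<not> ?thesis"
    then have "- w * P < (m - ?n * kmean (2 * p)) * P"
      using P1 by (intro mult_strict_right_mono) auto
    moreover have "w * P \<le> w * (2 * C)"
      using P1 w by (intro mult_left_mono) auto
    ultimately show False
      using le wC by simp
  qed
  then show ?thesis
    by (simp add: w_def)
qed

lemma polarization:
  assumes s: "- 2 < s" "s < real d" "s \<noteq> 0"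
  obtains c where "c > 0" "\<And>(x :: nat \<Rightarrow> 'a) A m. finite A \<Longrightarrow> A \<noteq> {} \<Longrightarrow> (\<And>i. i \<in> A \<Longrightarrow> norm (x i) = 1) \<Longrightarrow>
    (AE y in sph. m \<le> (\<Sum>i\<in>A. kern s (sqd (x i) y))) \<Longrightarrow> m \<le> real (card A) * kmean s - c * real (card A) powr (s / real d)"
proof -
  define p where "p = s / 2"
  have p: "- 1 < p" "p < real d / 2" "p \<noteq> 0" and s2: "s = 2 * p"
    using s by (auto simp: p_def)
  \<comment> \<open>Large enough for the coefficient in \<open>spike_tail\<close> to be at most a
    quarter of \<open>spike_lower p\<close>.\<close>
  define L where "L = max 1 (4 * (spike_coeff p * 4 powr (- (real d / 2))) / spike_lower p)"
  have L1: "L \<ge> 1" by (simp add: L_def)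
  have L2: "4 * (spike_coeff p * 4 powr (- (real d / 2)) / L) \<le> spike_lower p"
  proof -
    have "4 * (spike_coeff p * 4 powr (- (real d / 2))) / spike_lower p \<le> L"
      by (simp add: L_def)
    then show ?thesis
      using L1 spike_lower_pos[OF p] by (simp add: pos_divide_le_eq mult.commute)
  qed
  define C where "C = 2 ^ diff_order * (rmean p + (real diff_order + 5) powr \<bar>p\<bar>) + 1"
  have C1: "C > 0" using rmean_pos[OF p] by (simp add: C_def add_pos_pos)
  define c where "c = rmean p * spike_lower p * (2 powr (s / real d - 1) * L powr (- (real d / 2 - p))) / (8 * C)"
  have c: "c > 0"
    using rmean_pos[OF p] spike_lower_pos[OF p] C1 L1 by (simp add: c_def)
  show thesis
  proof (rule that[OF c])
    fix x :: "nat \<Rightarrow> 'a" and A :: "nat set" and m :: real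
    assume A: "finite A" "A \<noteq> {}" "\<And>i. i \<in> A \<Longrightarrow> norm (x i) = 1"
      and m: "AE y in sph. m \<le> (\<Sum>i\<in>A. kern s (sqd (x i) y))"
    let ?n = "real (card A)"
    have n: "?n \<ge> 1" using A(1,2) by (simp add: Suc_leI card_gt_0_iff)
    \<comment> \<open>This makes L h = (2 n)^(-2/d), so that n caps of squared radius L h have total
      measure at most n / (2 n) = 1/2.\<close>
    define h where "h = (2 * ?n) powr (- (2 / real d)) / L"
    have d0: "real d \<noteq> 0" using d2 by simp
    have h0: "h > 0" using n L1 by (simp add: h_def)
    have "(2 * ?n) powr (- (2 / real d)) \<le> 1 powr (- (2 / real d))"
      using n by (intro powr_mono2') auto
    then have h1: "h \<le> 1"
      using L1 by (simp add: h_def pos_divide_le_eq)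
    have "L * h = (2 * ?n) powr (- (2 / real d))"
      using L1 by (simp add: h_def)
    then have "(L * h) powr (real d / 2) = (2 * ?n) powr (- 1)"
      using d0 by (simp add: powr_powr)
    then have card: "?n * (L * h) powr (real d / 2) \<le> 1 / 2"
      using n by (simp add: powr_neg_one)
    have "m \<le> ?n * kmean s - ?n * rmean p * spike_mean p h / (8 * C)"
      unfolding s2 C_def by (rule polarization_step[OF p A(1,3) m[unfolded s2] h0 h1 L1 L2 card])
    moreover have "c * ?n powr (s / real d) \<le> ?n * rmean p * spike_mean p h / (8 * C)"
    proof -
      \<comment> \<open>The exponent of the theorem appears here: h is a multiple of n^(-2/d), so n
        h^(d/2 - p) is a multiple of n^(2 p / d), and 2 p = s.\<close>
      have hp: "?n * h powr (real d / 2 - p) = 2 powr (s / real d - 1) * L powr (- (real d / 2 - p)) * ?n powr (s / real d)"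
      proof -
        have "h powr (real d / 2 - p) = ((2 * ?n) powr (- (2 / real d))) powr (real d / 2 - p) / L powr (real d / 2 - p)"
          unfolding h_def by (rule powr_divide)
        also have "((2 * ?n) powr (- (2 / real d))) powr (real d / 2 - p) = (2 * ?n) powr (s / real d - 1)"
          unfolding powr_powr using d0 by (intro arg_cong[where f = "(powr) (2 * ?n)"]) (simp add: s2 field_simps)
        also have "\<dots> = 2 powr (s / real d - 1) * ?n powr (s / real d - 1)"
          by (rule powr_mult)
        also have "?n powr (s / real d - 1) = ?n powr (s / real d) / ?n"
          using n by (simp add: powr_diff)
        finally have "h powr (real d / 2 - p) = 2 powr (s / real d - 1) * (?n powr (s / real d) / ?n) / L powr (real d / 2 - p)" .
        moreover have "L powr (- (real d / 2 - p)) = 1 / L powr (real d / 2 - p)"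
          by (simp only: powr_minus inverse_eq_divide)
        ultimately show ?thesis
          using n by simp
      qed
      have "spike_lower p * h powr (real d / 2 - p) \<le> spike_mean p h"
        using h0 h1 by (intro spike_mean_ge[OF p]) auto
      then have "?n * rmean p * (spike_lower p * h powr (real d / 2 - p)) / (8 * C) \<le> ?n * rmean p * spike_mean p h / (8 * C)"
        using rmean_pos[OF p] C1 by (intro divide_right_mono mult_left_mono) auto
      moreover have "?n * rmean p * (spike_lower p * h powr (real d / 2 - p)) = rmean p * spike_lower p * (?n * h powr (real d / 2 - p))"
        by (simp only: mult_ac)
      ultimately show ?thesis
        unfolding hp c_def by (simp only: times_divide_eq_left mult.assoc)
    qed
    ultimately show "m \<le> ?n * kmean s - c * ?n powr (s / real d)"
      by linarith
  qed
qed

end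

section \<open>Greedy sequences\<close>

text \<open>At coincident points with s >= 0 both sides of the first equation are 0, since
  \<open>real_of_ereal \<infinity> = 0\<close> agrees with the default value of
  \<open>kern\<close>.\<close>

lemma kern_sqd:
  "real_of_ereal (riesz_kernel s x y) = kern s (sqd x y)"
  "x \<noteq> y \<or> s < 0 \<Longrightarrow> riesz_kernel s x y = ereal (kern s (sqd x y))"
proof -
  have sq: "sqd x y powr (- s / 2) = norm (x - y) powr (- s)"
  proof (cases "x = y")
    case False
    then have "sqd x y = norm (x - y) powr 2" by simp
    then show ?thesis by (simp only: powr_powr) simp
  qed simp
  have ln: "ln (sqd x y) = 2 * ln (norm (x - y))"
    by (cases "x = y") (simp_all add: ln_realpow)
  show e: "riesz_kernel s x y = ereal (kern s (sqd x y))" if "x \<noteq> y \<or> s < 0"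
    using that sq ln by (auto simp: riesz_kernel_def kern_def)
  show "real_of_ereal (riesz_kernel s x y) = kern s (sqd x y)"
  proof (cases "x \<noteq> y \<or> s < 0")
    case False
    then show ?thesis by (auto simp: riesz_kernel_def kern_def)
  qed (simp add: e)
qed

lemma kern_zero: "kern s 0 = 0"
  by (simp add: kern_def)

lemma double_sum_sym:
  fixes F :: "nat \<Rightarrow> nat \<Rightarrow> real"
  assumes "\<And>i j. F i j = F j i" "\<And>i. F i i = 0"
  shows "(\<Sum>(i, j)\<in>{1..N} \<times> {1..N}. F i j) = 2 * (\<Sum>i=1..N. \<Sum>j=i+1..N. F i j)"
proof (induction N)
  case (Suc N)
  have "(\<Sum>(i, j)\<in>{1..Suc N} \<times> {1..Suc N}. F i j) = (\<Sum>i=1..Suc N. \<Sum>j=1..Suc N. F i j)"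
    by (rule sum.cartesian_product[symmetric])
  also have "\<dots> = (\<Sum>i=1..N. \<Sum>j=1..N. F i j) + 2 * (\<Sum>i=1..N. F i (Suc N))"
    using assms(1)[of _ "Suc N"] by (simp add: sum.distrib assms(2))
  also have "(\<Sum>i=1..N. \<Sum>j=1..N. F i j) = 2 * (\<Sum>i=1..N. \<Sum>j=i+1..N. F i j)"
    using Suc.IH by (simp only: sum.cartesian_product)
  also have "2 * (\<Sum>i=1..N. \<Sum>j=i+1..N. F i j) + 2 * (\<Sum>i=1..N. F i (Suc N)) = 2 * (\<Sum>i=1..N. \<Sum>j=i+1..Suc N. F i j)"
    by (simp add: sum.distrib distrib_left)
  also have "\<dots> = 2 * (\<Sum>i=1..Suc N. \<Sum>j=i+1..Suc N. F i j)"
    by simp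
  finally show ?case .
qed simp

text \<open>Grouping the pairs by their larger index exhibits the quantities that the greedy choice
  minimises: the potential of the first n points at the next one.\<close>

lemma triangle_sum_last:
  fixes F :: "nat \<Rightarrow> nat \<Rightarrow> real"
  shows "(\<Sum>i=1..N. \<Sum>j=i+1..N. F i j) = (\<Sum>n=1..<N. \<Sum>i=1..n. F i (n + 1))"
proof (induction N)
  case (Suc N)
  have "(\<Sum>i=1..Suc N. \<Sum>j=i+1..Suc N. F i j) = (\<Sum>i=1..N. \<Sum>j=i+1..N. F i j) + (\<Sum>i=1..N. F i (Suc N))"
    by (simp add: sum.distrib)
  with Suc.IH show ?case
    by (cases "N = 0") auto
qed simp

text \<open>As q <= 1, n^q = n^(q - 1) n >= N^(q - 1) n, which reduces every exponent, negative ones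
  included, to the sum of the integers below N; N >= 2 gives N (N - 1) / 2 >= N^2 / 4.\<close>

lemma sum_powr_ge:
  fixes q :: real
  assumes q: "q \<le> 1" and N: "N \<ge> 2"
  shows "real N powr (1 + q) / 4 \<le> (\<Sum>n=1..<N. real n powr q)"
proof -
  have S: "(\<Sum>n=1..<N. real n) = real N * (real N - 1) / 2" for N
    by (induction N) (auto simp: field_simps not_less_eq_eq)
  have "real N powr (1 + q) = real N powr (q - 1) * (real N)\<^sup>2"
    using N by (simp add: powr_add powr_diff power2_eq_square)
  then have "real N powr (1 + q) / 4 = real N powr (q - 1) * (real N * real N / 4)"
    by (simp add: power2_eq_square)
  also have "\<dots> \<le> real N powr (q - 1) * (real N * (real N - 1) / 2)"
  proof -
    have "real N * real N \<le> real N * (2 * (real N - 1))"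
      using N by (intro mult_left_mono) auto
    then show ?thesis
      by (intro mult_left_mono) (auto simp: algebra_simps)
  qed
  also have "\<dots> = (\<Sum>n=1..<N. real N powr (q - 1) * real n)"
    by (simp only: S sum_distrib_left[symmetric])
  also have "\<dots> \<le> (\<Sum>n=1..<N. real n powr q)"
  proof (rule sum_mono)
    fix n assume n: "n \<in> {1..<N}"
    have "real N powr (q - 1) * real n \<le> real n powr (q - 1) * real n"
      using n q by (intro mult_right_mono powr_mono2') auto
    also have "\<dots> = real n powr q"
      using n by (simp add: powr_diff)
    finally show "real N powr (q - 1) * real n \<le> real n powr q" .
  qed
  finally show ?thesis .
qed

context unit_sphere
begin

lemma continuous_energy_riesz:
  assumes s: "- 2 < s" "s < real d"
  shows "continuous_energy (riesz_kernel s) (sphere_measure :: 'a measure) = kmean s"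
proof -
  have inner: "(\<integral>x. real_of_ereal (riesz_kernel s x y) \<partial>sphere_measure) = kmean s" if y: "norm y = 1" for y :: 'a
  proof -
    have "(\<integral>x. kern s (sqd y x) \<partial>sph) = (\<integral>x. kern s (sqd y x) \<partial>sphere_measure)"
      unfolding sph_def by (rule integral_distr[OF measurable_sphere_measure]) measurable
    then show ?thesis
      using kern_integral(2)[OF s y] by (simp add: kern_sqd sqd_commute)
  qed
  interpret prob_space "sphere_measure :: 'a measure"
    by standard (use emeasure_sphere_measure_space[where 'a='a] in simp)
  have "continuous_energy (riesz_kernel s) (sphere_measure :: 'a measure) = (\<integral>y. kmean s \<partial>(sphere_measure :: 'a measure))"
    unfolding continuous_energy_def by (rule Bochner_Integration.integral_cong) (auto intro!: inner)
  also have "\<dots> = kmean s"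
    using prob_space by simp
  finally show ?thesis .
qed

lemma greedy_unit:
  fixes x :: "nat \<Rightarrow> 'a"
  assumes "greedy_sequence K a x" "n \<ge> 1"
  shows "norm (x n) = 1"
proof (cases "n = 1")
  case True
  then show ?thesis using assms by (auto simp: greedy_sequence_def)
next
  case False
  then obtain k where "n = k + 1" "k \<ge> 1"
    using assms(2) by (metis add.commute le_Suc_ex le_antisym nat_le_linear not_less_eq_eq plus_1_eq_Suc)
  then show ?thesis
    using assms(1) by (auto simp: greedy_sequence_def is_arg_min_def)
qed

lemma AE_sph_avoid:
  fixes x :: "nat \<Rightarrow> 'a"
  assumes "finite A" "\<And>i. i \<in> A \<Longrightarrow> norm (x i) = 1"
  shows "AE y in sph. norm y = 1 \<and> (\<forall>i\<in>A. y \<noteq> x i)"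
proof -
  have "AE y in sph. \<forall>i\<in>A. y \<noteq> x i"
    using assms by (intro AE_finite_allI AE_sph_ne) auto
  with AE_sph_norm show ?thesis
    by eventually_elim auto
qed

text \<open>Almost every point avoids the first n, so the potential is finite somewhere and hence at
  its minimiser; for s >= 0 this forces the new point to be distinct. The comparison is made off the
  earlier points, where \<open>kern\<close> agrees with the true kernel, hence almost
  everywhere.\<close>

lemma greedy_step:
  fixes x :: "nat \<Rightarrow> 'a"
  assumes g: "greedy_sequence (riesz_kernel s) a x" and n: "n \<ge> 1"
  shows "\<And>i. i \<in> {1..n} \<Longrightarrow> x (n + 1) \<noteq> x i \<or> s < 0"
    and "AE y in sph. (\<Sum>i=1..n. kern s (sqd (x i) (x (n + 1)))) \<le> (\<Sum>i=1..n. kern s (sqd (x i) y))"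
proof -
  have min: "(\<Sum>i=1..n. riesz_kernel s (x (n + 1)) (x i)) \<le> (\<Sum>i=1..n. riesz_kernel s y (x i))" if "norm y = 1" for y
    using g n that by (auto simp: greedy_sequence_def is_arg_min_def not_less)
  have fin: "(\<Sum>i=1..n. riesz_kernel s y (x i)) = ereal (\<Sum>i=1..n. kern s (sqd (x i) y))" if "\<forall>i\<in>{1..n}. y \<noteq> x i \<or> s < 0" for y
    unfolding sum_ereal[symmetric]
  proof (rule sum.cong[OF refl])
    fix i assume "i \<in> {1..n}"
    with that have "y \<noteq> x i \<or> s < 0" by blast
    then show "riesz_kernel s y (x i) = ereal (kern s (sqd (x i) y))"
      by (simp add: kern_sqd(2) norm_minus_commute[of y])
  qed
  have av: "AE y in sph. norm y = 1 \<and> (\<forall>i\<in>{1..n}. y \<noteq> x i)"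
    by (rule AE_sph_avoid) (use greedy_unit[OF g] in auto)
  have "\<exists>y. norm y = 1 \<and> (\<forall>i\<in>{1..n}. y \<noteq> x i)"
  proof (rule ccontr)
    assume "\<not> ?thesis"
    then have no: "\<not> (norm y = 1 \<and> (\<forall>i\<in>{1..n}. y \<noteq> x i))" for y
      by blast
    from av have "AE y in (sph :: 'a measure). False"
      by (rule eventually_mono) (use no in blast)
    then show False by simp
  qed
  then obtain y where y: "norm y = 1" "\<forall>i\<in>{1..n}. y \<noteq> x i" by blast
  have "(\<Sum>i=1..n. riesz_kernel s (x (n + 1)) (x i)) \<noteq> \<infinity>"
    using min[OF y(1)] fin[of y] y(2) by auto
  then have ni: "riesz_kernel s (x (n + 1)) (x i) \<noteq> \<infinity>" if "i \<in> {1..n}" for i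
    using that by (auto simp: sum_Pinfty)
  show ne: "x (n + 1) \<noteq> x i \<or> s < 0" if "i \<in> {1..n}" for i
    using ni[OF that] by (cases "s < 0") (auto simp: riesz_kernel_def not_less)
  show "AE y in sph. (\<Sum>i=1..n. kern s (sqd (x i) (x (n + 1)))) \<le> (\<Sum>i=1..n. kern s (sqd (x i) y))"
    using av
  proof eventually_elim
    case (elim y)
    have "(\<Sum>i=1..n. riesz_kernel s (x (n + 1)) (x i)) = ereal (\<Sum>i=1..n. kern s (sqd (x i) (x (n + 1))))"
      using ne by (intro fin) blast
    moreover have "(\<Sum>i=1..n. riesz_kernel s y (x i)) = ereal (\<Sum>i=1..n. kern s (sqd (x i) y))"
      using elim by (intro fin) blast
    ultimately show ?case
      using min[of y] elim by simp
  qed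
qed

lemma greedy_ne:
  fixes x :: "nat \<Rightarrow> 'a"
  assumes g: "greedy_sequence (riesz_kernel s) a x" and ij: "1 \<le> i" "i < j"
  shows "x i \<noteq> x j \<or> s < 0"
proof -
  from ij obtain n where "j = n + 1" "n \<ge> 1" "i \<in> {1..n}"
    by (cases j) auto
  then show ?thesis
    using greedy_step(1)[OF g, of n i] by auto
qed

lemma greedy_energy:
  fixes x :: "nat \<Rightarrow> 'a"
  assumes g: "greedy_sequence (riesz_kernel s) a x"
  shows "discrete_energy (riesz_kernel s) x N = ereal (2 * (\<Sum>i=1..N. \<Sum>j=i+1..N. kern s (sqd (x i) (x j))))"
proof -
  have "(\<Sum>i=1..N. \<Sum>j=i+1..N. riesz_kernel s (x i) (x j)) = (\<Sum>i=1..N. \<Sum>j=i+1..N. ereal (kern s (sqd (x i) (x j))))"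
    by (intro sum.cong refl kern_sqd(2) greedy_ne[OF g]) auto
  then show ?thesis
    by (simp add: discrete_energy_def)
qed

text \<open>Summing n k over 1 <= n < N gives k N (N - 1) / 2, whose double accounts for the term -
  k N; the gains add up to at least c N^(1 + s/d) / 4 by \<open>sum_powr_ge\<close>.\<close>

lemma greedy_energy_le:
  fixes x :: "nat \<Rightarrow> 'a"
  assumes s: "s < real d" and c: "c \<ge> 0" and N: "N \<ge> 2"
    and m: "\<And>n. n \<ge> 1 \<Longrightarrow> (\<Sum>i=1..n. kern s (sqd (x i) (x (n + 1)))) \<le> real n * k - c * real n powr (s / real d)"
  shows "2 * (\<Sum>i=1..N. \<Sum>j=i+1..N. kern s (sqd (x i) (x j))) \<le> k * (real N)\<^sup>2 - k * real N - c / 2 * real N powr (1 + s / real d)"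
proof -
  have S: "(\<Sum>n=1..<N. real n) = real N * (real N - 1) / 2" for N
    by (induction N) (auto simp: field_simps not_less_eq_eq)
  have "(\<Sum>i=1..N. \<Sum>j=i+1..N. kern s (sqd (x i) (x j))) = (\<Sum>n=1..<N. \<Sum>i=1..n. kern s (sqd (x i) (x (n + 1))))"
    by (rule triangle_sum_last)
  also have "\<dots> \<le> (\<Sum>n=1..<N. real n * k - c * real n powr (s / real d))"
    by (intro sum_mono m) auto
  also have "\<dots> = (\<Sum>n=1..<N. real n) * k - c * (\<Sum>n=1..<N. real n powr (s / real d))"
    by (simp only: sum_subtractf sum_distrib_left sum_distrib_right)
  also have "\<dots> \<le> real N * (real N - 1) / 2 * k - c * (real N powr (1 + s / real d) / 4)"
    unfolding S using s N c d2 by (intro diff_left_mono mult_left_mono sum_powr_ge) (auto simp: pos_divide_le_eq)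
  finally show ?thesis
    by (simp add: power2_eq_square field_simps)
qed

lemma greedy_offdiag:
  fixes x :: "nat \<Rightarrow> 'a"
  shows "(\<Sum>(i, j)\<in>{(i, j)\<in>{1..N} \<times> {1..N}. i \<noteq> j}. kern s (sqd (x i) (x j))) = 2 * (\<Sum>i=1..N. \<Sum>j=i+1..N. kern s (sqd (x i) (x j)))"
    and "(\<Sum>(i, j)\<in>{1..N} \<times> {1..N}. kern s (sqd (x i) (x j))) = 2 * (\<Sum>i=1..N. \<Sum>j=i+1..N. kern s (sqd (x i) (x j)))"
proof -
  show A: "(\<Sum>(i, j)\<in>{1..N} \<times> {1..N}. kern s (sqd (x i) (x j))) = 2 * (\<Sum>i=1..N. \<Sum>j=i+1..N. kern s (sqd (x i) (x j)))"
    by (rule double_sum_sym) (simp_all add: norm_minus_commute kern_zero)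
  show "(\<Sum>(i, j)\<in>{(i, j)\<in>{1..N} \<times> {1..N}. i \<noteq> j}. kern s (sqd (x i) (x j))) = 2 * (\<Sum>i=1..N. \<Sum>j=i+1..N. kern s (sqd (x i) (x j)))"
    unfolding A[symmetric] by (rule sum.mono_neutral_left) (auto simp: kern_zero)
qed

lemma greedy_inj:
  fixes x :: "nat \<Rightarrow> 'a"
  assumes g: "greedy_sequence (riesz_kernel s) a x" and s: "s \<ge> 0"
  shows "inj_on x {1..N}"
proof (rule inj_onI)
  fix i j assume "i \<in> {1..N}" "j \<in> {1..N}" "x i = x j"
  then show "i = j"
    using greedy_ne[OF g, of i j] greedy_ne[OF g, of j i] s by (cases i j rule: linorder_cases) auto
qed

end

text \<open>The constants are quantified before the initial point and the sequence, so they depend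
  on \<open>s\<close> and the dimension only. \<open>B\<close> is the implied constant of the O(N)
  bound, for which - kmean 0 serves.\<close>

theorem theorem2p2:
  fixes d :: nat and s :: real
  assumes "CARD('n::finite) = d + 1" and "d \<ge> 2" and "- 2 < s" and "s < real d"
  shows "\<exists>C>0. \<exists>C'>0. \<exists>B.
    \<forall>(a :: real ^ 'n) x. greedy_sequence (riesz_kernel s) a x \<longrightarrow> (\<forall>N\<ge>2.
      (let E = discrete_energy (riesz_kernel s) x N;
           I = continuous_energy (riesz_kernel s) (sphere_measure :: (real ^ 'n) measure)
       in
        (0 < s \<longrightarrow>
           ereal (- C * real N powr (1 + s / d)) \<le> E - ereal (I * (real N)\<^sup>2) \<and>
           E - ereal (I * (real N)\<^sup>2) \<le> ereal (- C' * real N powr (1 + s / d))) \<and>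
        (s < 0 \<longrightarrow>
           ereal (C * real N powr (1 + s / d)) \<le> E - ereal (I * (real N)\<^sup>2) \<and>
           E - ereal (I * (real N)\<^sup>2) \<le> ereal (- I * real N - C' * real N powr (1 + s / d))) \<and>
        (s = 0 \<longrightarrow>
           ereal (- (1 / d) * real N * ln (real N) - C' * real N) \<le> E - ereal (I * (real N)\<^sup>2) \<and>
           E - ereal (I * (real N)\<^sup>2) \<le> ereal (B * real N))))"
proof -
  define e :: "real ^ 'n" where "e = axis undefined 1"
  interpret unit_sphere d e
    by standard (use assms in \<open>simp_all add: e_def norm_axis_1\<close>)
  note s = assms(3,4)
  note I = continuous_energy_riesz[OF s]
  define D where "D x N = 2 * (\<Sum>i=1..N. \<Sum>j=i+1..N. kern s (sqd (x i) (x j))) - kmean s * (real N)\<^sup>2"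
    for x :: "nat \<Rightarrow> real ^ 'n" and N
  have unit: "norm (x i) = 1" if "greedy_sequence (riesz_kernel s) a x" "i \<in> {1..N}"
    for a and x :: "nat \<Rightarrow> real ^ 'n" and i N
    using greedy_unit[OF that(1)] that(2) by auto
  \<comment> \<open>Along a greedy sequence the energy is finite, so the extended-real claims reduce
    to real ones about the deviation \<open>D\<close>.\<close>
  have real_form: ?thesis
    if "C > 0" "C' > 0" and *: "\<And>a x N. greedy_sequence (riesz_kernel s) a x \<Longrightarrow> N \<ge> 2 \<Longrightarrow>
        (0 < s \<longrightarrow> - C * real N powr (1 + s / real d) \<le> D x N \<and> D x N \<le> - C' * real N powr (1 + s / real d)) \<and>
        (s < 0 \<longrightarrow> C * real N powr (1 + s / real d) \<le> D x N \<and>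
          D x N \<le> - kmean s * real N - C' * real N powr (1 + s / real d)) \<and>
        (s = 0 \<longrightarrow> - (1 / real d) * real N * ln (real N) - C' * real N \<le> D x N \<and> D x N \<le> B * real N)"
    for C C' B
    by (rule exI[of _ C], rule conjI[OF that(1)], rule exI[of _ C'], rule conjI[OF that(2)], rule exI[of _ B], intro allI impI)
       (unfold Let_def I greedy_energy ereal_minus(1) ereal_less_eq(3), fold D_def, rule *)
  have upper: "D x N \<le> - kmean s * real N - c / 2 * real N powr (1 + s / real d)"
    if g: "greedy_sequence (riesz_kernel s) a x" and N: "N \<ge> 2" and c: "c \<ge> 0"
      and min: "\<And>A m. finite A \<Longrightarrow> A \<noteq> {} \<Longrightarrow> (\<And>i. i \<in> A \<Longrightarrow> norm (x i) = 1) \<Longrightarrow>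
        (AE y in sph. m \<le> (\<Sum>i\<in>A. kern s (sqd (x i) y))) \<Longrightarrow> m \<le> real (card A) * kmean s - c * real (card A) powr (s / real d)"
    for a x N c
  proof -
    have "(\<Sum>i=1..n. kern s (sqd (x i) (x (n + 1)))) \<le> real n * kmean s - c * real n powr (s / real d)" if "n \<ge> 1" for n
      using min[of "{1..n}", OF _ _ _ greedy_step(2)[OF g that]] unit[OF g] that by auto
    from greedy_energy_le[OF s(2) c N this] show ?thesis
      by (simp add: D_def)
  qed
  consider "s > 0" | "s < 0" | "s = 0" by linarith
  then show ?thesis
  proof cases
    case 1
    obtain C where C: "C > 0" "\<And>(x :: nat \<Rightarrow> real ^ 'n) A. finite A \<Longrightarrow> A \<noteq> {} \<Longrightarrow> (\<And>i. i \<in> A \<Longrightarrow> norm (x i) = 1) \<Longrightarrow> inj_on x A \<Longrightarrow>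
      kmean s * (real (card A))\<^sup>2 - C * real (card A) powr (1 + s / real d) \<le> (\<Sum>(i, j)\<in>{(i, j)\<in>A \<times> A. i \<noteq> j}. kern s (sqd (x i) (x j)))"
      using energy_ge_pos[OF 1 s(2)] by blast
    obtain c where c: "c > 0" "\<And>(x :: nat \<Rightarrow> real ^ 'n) A m. finite A \<Longrightarrow> A \<noteq> {} \<Longrightarrow> (\<And>i. i \<in> A \<Longrightarrow> norm (x i) = 1) \<Longrightarrow>
      (AE y in sph. m \<le> (\<Sum>i\<in>A. kern s (sqd (x i) y))) \<Longrightarrow> m \<le> real (card A) * kmean s - c * real (card A) powr (s / real d)"
      using polarization[OF s] 1 by blast
    have k: "kmean s \<ge> 0"
      using 1 unfolding kmean_def by (intro integral_nonneg_AE) (simp add: kern_def)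
    have lo: "- C * real N powr (1 + s / real d) \<le> D x N" if g: "greedy_sequence (riesz_kernel s) a x" and N: "N \<ge> 2" for a x N
      using C(2)[of "{1..N}" x, OF _ _ unit[OF g, of _ N] greedy_inj[OF g]] 1 N unfolding greedy_offdiag D_def by simp
    have up: "D x N \<le> - (c / 2) * real N powr (1 + s / real d)" if g: "greedy_sequence (riesz_kernel s) a x" and N: "N \<ge> 2" for a x N
    proof -
      have "D x N \<le> - kmean s * real N - c / 2 * real N powr (1 + s / real d)"
        by (rule upper[OF g N less_imp_le[OF c(1)]]) (rule c(2))
      moreover have "0 \<le> kmean s * real N" using k by simp
      ultimately show ?thesis by simp
    qed
    show ?thesis
      by (rule real_form[of C "c / 2" 0]) (use C(1) c(1) 1 lo up in auto)
  next
    case 2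
    obtain C where C: "C > 0" "\<And>(x :: nat \<Rightarrow> real ^ 'n) A. finite A \<Longrightarrow> A \<noteq> {} \<Longrightarrow> (\<And>i. i \<in> A \<Longrightarrow> norm (x i) = 1) \<Longrightarrow>
      kmean s * (real (card A))\<^sup>2 + C * real (card A) powr (1 + s / real d) \<le> (\<Sum>(i, j)\<in>A \<times> A. kern s (sqd (x i) (x j)))"
      using energy_ge_neg[OF s(1) 2] by blast
    obtain c where c: "c > 0" "\<And>(x :: nat \<Rightarrow> real ^ 'n) A m. finite A \<Longrightarrow> A \<noteq> {} \<Longrightarrow> (\<And>i. i \<in> A \<Longrightarrow> norm (x i) = 1) \<Longrightarrow>
      (AE y in sph. m \<le> (\<Sum>i\<in>A. kern s (sqd (x i) y))) \<Longrightarrow> m \<le> real (card A) * kmean s - c * real (card A) powr (s / real d)"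
      using polarization[OF s] 2 by blast
    have lo: "C * real N powr (1 + s / real d) \<le> D x N" if g: "greedy_sequence (riesz_kernel s) a x" and N: "N \<ge> 2" for a x N
      using C(2)[of "{1..N}" x, OF _ _ unit[OF g, of _ N]] N unfolding greedy_offdiag D_def by simp
    have up: "D x N \<le> - kmean s * real N - (c / 2) * real N powr (1 + s / real d)" if g: "greedy_sequence (riesz_kernel s) a x" and N: "N \<ge> 2" for a x N
      by (rule upper[OF g N less_imp_le[OF c(1)]]) (rule c(2))
    show ?thesis
      by (rule real_form[of C "c / 2" 0]) (use C(1) c(1) 2 lo up in auto)
  next
    case 3
    obtain C where C: "C > 0" "\<And>(x :: nat \<Rightarrow> real ^ 'n) A. finite A \<Longrightarrow> A \<noteq> {} \<Longrightarrow> (\<And>i. i \<in> A \<Longrightarrow> norm (x i) = 1) \<Longrightarrow> inj_on x A \<Longrightarrow>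
      kmean 0 * (real (card A))\<^sup>2 - 1 / real d * real (card A) * ln (real (card A)) - C * real (card A)
      \<le> (\<Sum>(i, j)\<in>{(i, j)\<in>A \<times> A. i \<noteq> j}. kern 0 (sqd (x i) (x j)))"
      using energy_ge_zero by blast
    have lo: "- (1 / real d) * real N * ln (real N) - C * real N \<le> D x N" if g: "greedy_sequence (riesz_kernel s) a x" and N: "N \<ge> 2" for a x N
      using C(2)[of "{1..N}" x, OF _ _ unit[OF g, of _ N] greedy_inj[OF g]] 3 N unfolding greedy_offdiag D_def by simp
    have up: "D x N \<le> - kmean s * real N" if g: "greedy_sequence (riesz_kernel s) a x" and N: "N \<ge> 2" for a x N
    proof -
      \<comment> \<open>With c = 0 the hypothesis of \<open>upper\<close> is plain
        averaging.\<close>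
      have "m \<le> real (card A) * kmean s - 0 * real (card A) powr (s / real d)"
        if "\<And>i. i \<in> A \<Longrightarrow> norm (x i) = 1" "AE y in sph. m \<le> (\<Sum>i\<in>A. kern s (sqd (x i) y))" for A m
        using potential_min_le_mean[OF s that] by simp
      then have "D x N \<le> - kmean s * real N - 0 / 2 * real N powr (1 + s / real d)"
        by (intro upper[OF g N order_refl]) blast
      then show ?thesis by simp
    qed
    show ?thesis
      by (rule real_form[of 1 C "- kmean s"]) (use C(1) 3 lo up in auto)
  qed
qed

end
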